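(* For every $q\in\mathbb{N}$ with $q\geq 2$, every subgroup $G$ of the symmetric group $\mathfrak{S}_q$, and every $k\in\mathbb{N}$: every semi-simple action of the Nekrashevych-Röver group $V_q(G)$ on a complete CAT(0) space of topological dimension $k$ has a global fixed point. (That is, $V_q(G)$ has property $\mathrm{F}\mathcal{A}_k$ for semi-simple actions for every $k\in\mathbb{N}$.)
   Context: Fix $q\ge2$ and a subgroup $G$ of the symmetric group $\mathfrak{S}_q$ of the alphabet $A_q=\{0,1,\ldots,q-1\}$. Let $C_q=A_q^{\mathbb{N}}$ be the set of all infinite words in $A_q$; $G$ acts on $C_q$ by applying its action on $A_q$ to every letter. For a finite word $w$ in $A_q$, let $I(w)\subset C_q$ be the set of all infinite words starting with $w$. A division of $C_q$ is a finite sequence of finite words $(w_i)_{1\le i\le m}$ such that the sets $I(w_i)$ are mutually disjoint and cover $C_q$. Given two divisions $W=(w_i)_{1\le i\le m}$ and $W'=(w_i')_{1\le i\le m}$ of the same cardinality and a sequence $(\sigma_i)_{1\le i\le m}$ of elements of $G$, define a bijection $v=v(W,W',(\sigma_i)_i)$ of $C_q$ by $v(w_iu)=w_i'\sigma_i(u)$ for every $i$ and every $u\in C_q$. The Nekrashevych-Röver group $V_q(G)$ is the group of all bijections of $C_q$ of the form $v(W,W',(\sigma_i)_i)$. For an isometry $\gamma$ of a metric space $(X,d)$, let $|\gamma|=\inf\{d(x,\gamma(x))\mid x\in X\}$; $\gamma$ is semi-simple if this infimum is attained. An isometric action of a group on a metric space is semi-simple if every group element acts as a semi-simple isometry. A global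 fixed point is a point fixed by all group elements. CAT(0) spaces are taken to be non-empty. Topological dimension means covering dimension. *)

theory Defs
  imports "HOL-Analysis.Analysis" "HOL-Algebra.Group_Action" "HOL-Library.Stream"
begin

section \<open>Nekrashevych-Roever groups\<close>

text \<open>The alphabet with \<^term>\<open>q\<close> letters is \<^term>\<open>{..<q::nat}\<close>; finite words are lists, infinite
  words are streams, and \<^term>\<open>w @- u\<close> is the concatenation of a finite and an infinite word.\<close>

definition cantor :: "nat \<Rightarrow> nat stream set" where
  "cantor q = streams {..<q}"

definition cylinder :: "nat \<Rightarrow> nat list \<Rightarrow> nat stream set" where
  "cylinder q w = {w @- u | u. u \<in> cantor q}"

definition division :: "nat \<Rightarrow> nat list list \<Rightarrow> bool" where
  "division q W \<longleftrightarrow> set W \<subseteq> lists {..<q} \<and>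
     disjoint_family_on (\<lambda>i. cylinder q (W ! i)) {..<length W} \<and>
     (\<Union>i<length W. cylinder q (W ! i)) = cantor q"

text \<open>The elements of the group are functions that are extensional on \<^term>\<open>cantor q\<close>, as
  required by \<^const>\<open>Bij\<close>. The equation in the last line determines
  such a function, since the words in \<^term>\<open>W\<close> form a division.\<close>

definition NR_maps :: "nat \<Rightarrow> (nat \<Rightarrow> nat) set \<Rightarrow> (nat stream \<Rightarrow> nat stream) set" where
  "NR_maps q G = {f \<in> Bij (cantor q). \<exists>W W' \<sigma>.
     division q W \<and> division q W' \<and> length W = length W' \<and>
     (\<forall>i<length W. \<sigma> i \<in> G) \<and>
     (\<forall>i<length W. \<forall>u\<in>cantor q. f (W ! i @- u) = W' ! i @- smap (\<sigma> i) u)}"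

definition NR_group :: "nat \<Rightarrow> (nat \<Rightarrow> nat) set \<Rightarrow> (nat stream \<Rightarrow> nat stream) monoid" where
  "NR_group q G = (BijGroup (cantor q))\<lparr>carrier := NR_maps q G\<rparr>"


section \<open>CAT(0) spaces\<close>

definition geodesic_segment ::
  "'a set \<Rightarrow> ('a \<Rightarrow> 'a \<Rightarrow> real) \<Rightarrow> 'a \<Rightarrow> 'a \<Rightarrow> 'a set \<Rightarrow> bool" where
  "geodesic_segment M d x y S \<longleftrightarrow> (\<exists>c l. 0 \<le> l \<and> c \<in> {0..l} \<rightarrow> M \<and> c 0 = x \<and> c l = y \<and>
     (\<forall>s\<in>{0..l}. \<forall>t\<in>{0..l}. d (c s) (c t) = \<bar>s - t\<bar>) \<and> S = c ` {0..l})"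

definition geodesic_space :: "'a set \<Rightarrow> ('a \<Rightarrow> 'a \<Rightarrow> real) \<Rightarrow> bool" where
  "geodesic_space M d \<longleftrightarrow> (\<forall>x\<in>M. \<forall>y\<in>M. \<exists>S. geodesic_segment M d x y S)"

text \<open>\<^term>\<open>x'\<close> is a comparison point, on the segment from \<^term>\<open>p'\<close> to \<^term>\<open>q'\<close> in the
  Euclidean plane, of the point \<^term>\<open>x\<close> of the geodesic segment \<^term>\<open>S\<close> starting at \<^term>\<open>p\<close>.\<close>

definition comparison_point ::
  "('a \<Rightarrow> 'a \<Rightarrow> real) \<Rightarrow> 'a set \<Rightarrow> 'a \<Rightarrow> real^2 \<Rightarrow> real^2 \<Rightarrow> 'a \<Rightarrow> real^2 \<Rightarrow> bool" where
  "comparison_point d S p p' q' x x' \<longleftrightarrow>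
     x \<in> S \<and> x' \<in> closed_segment p' q' \<and> dist p' x' = d p x"

definition CAT0_triangle_condition :: "'a set \<Rightarrow> ('a \<Rightarrow> 'a \<Rightarrow> real) \<Rightarrow> bool" where
  "CAT0_triangle_condition M d \<longleftrightarrow>
     (\<forall>p\<in>M. \<forall>q\<in>M. \<forall>r\<in>M. \<forall>S T U p' q' r'.
        geodesic_segment M d p q S \<and> geodesic_segment M d q r T \<and> geodesic_segment M d r p U \<and>
        dist p' q' = d p q \<and> dist q' r' = d q r \<and> dist r' p' = d r p \<longrightarrow>
        (let comparison = (\<lambda>x x'. comparison_point d S p p' q' x x' \<or>
                                  comparison_point d T q q' r' x x' \<or>
                                  comparison_point d U r r' p' x x')
         in \<forall>x x' y y'. comparison x x' \<and> comparison y y' \<longrightarrow> d x y \<le> dist x' y'))"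

definition CAT0_space :: "'a set \<Rightarrow> ('a \<Rightarrow> 'a \<Rightarrow> real) \<Rightarrow> bool" where
  "CAT0_space M d \<longleftrightarrow>
     Metric_space M d \<and> M \<noteq> {} \<and> geodesic_space M d \<and> CAT0_triangle_condition M d"


section \<open>Covering dimension\<close>

text \<open>The predicate \<open>dim_le\<close> of the library is the small inductive dimension, which may differ from
  the covering dimension on non-separable metric spaces. Below, arbitrary open covers are used;
  on metrizable (indeed paracompact Hausdorff) spaces, finite open covers give the same notion.\<close>

definition covering_dim_le :: "'a topology \<Rightarrow> nat \<Rightarrow> bool" where
  "covering_dim_le X n \<longleftrightarrow>
     (\<forall>\<U>. (\<forall>u\<in>\<U>. openin X u) \<and> \<Union>\<U> = topspace X \<longrightarrow>
        (\<exists>\<V>. (\<forall>v\<in>\<V>. openin X v) \<and> \<Union>\<V> = topspace X \<and> (\<forall>v\<in>\<V>. \<exists>u\<in>\<U>. v \<subseteq> u) \<and>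
             (\<forall>x\<in>topspace X. finite {v \<in> \<V>. x \<in> v} \<and> card {v \<in> \<V>. x \<in> v} \<le> n + 1)))"

text \<open>Only meant for non-empty spaces: the dimension of the empty space is -1.\<close>

definition covering_dim_eq :: "'a topology \<Rightarrow> nat \<Rightarrow> bool" where
  "covering_dim_eq X n \<longleftrightarrow> covering_dim_le X n \<and> (\<forall>m<n. \<not> covering_dim_le X m)"


section \<open>Semi-simple isometric actions\<close>

definition translation_length :: "'a set \<Rightarrow> ('a \<Rightarrow> 'a \<Rightarrow> real) \<Rightarrow> ('a \<Rightarrow> 'a) \<Rightarrow> real" where
  "translation_length M d \<gamma> = (INF x\<in>M. d x (\<gamma> x))"

definition semisimple :: "'a set \<Rightarrow> ('a \<Rightarrow> 'a \<Rightarrow> real) \<Rightarrow> ('a \<Rightarrow> 'a) \<Rightarrow> bool" where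
  "semisimple M d \<gamma> \<longleftrightarrow> (\<exists>x\<in>M. d x (\<gamma> x) = translation_length M d \<gamma>)"

definition isometric_action ::
  "('g, 'b) monoid_scheme \<Rightarrow> 'a set \<Rightarrow> ('a \<Rightarrow> 'a \<Rightarrow> real) \<Rightarrow> ('g \<Rightarrow> 'a \<Rightarrow> 'a) \<Rightarrow> bool" where
  "isometric_action H M d \<phi> \<longleftrightarrow> group_action H M \<phi> \<and>
     (\<forall>g\<in>carrier H. \<forall>x\<in>M. \<forall>y\<in>M. d (\<phi> g x) (\<phi> g y) = d x y)"

definition semisimple_action ::
  "('g, 'b) monoid_scheme \<Rightarrow> 'a set \<Rightarrow> ('a \<Rightarrow> 'a \<Rightarrow> real) \<Rightarrow> ('g \<Rightarrow> 'a \<Rightarrow> 'a) \<Rightarrow> bool" where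
  "semisimple_action H M d \<phi> \<longleftrightarrow> isometric_action H M d \<phi> \<and>
     (\<forall>g\<in>carrier H. semisimple M d (\<phi> g))"

definition has_global_fixed_point ::
  "('g, 'b) monoid_scheme \<Rightarrow> 'a set \<Rightarrow> ('g \<Rightarrow> 'a \<Rightarrow> 'a) \<Rightarrow> bool" where
  "has_global_fixed_point H M \<phi> \<longleftrightarrow> (\<exists>x\<in>M. \<forall>g\<in>carrier H. \<phi> g x = x)"

end

theory Submission
  imports Defs "HOL-Library.Sublist"
begin

text \<open>A subgroup is called elliptic if it has a fixed point; in a complete CAT(0) space this holds as
  soon as it has a bounded orbit. Let \<open>R\<close> be the subgroup of elements supported in the cylinder
  \<open>I(0)\<close>. If two elliptic subsets of \<open>R\<close> had no common fixed point, then conjugating them into \<open>k + 1\<close>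
  disjoint cylinders would give \<open>k + 1\<close> disjoint pairs of closed convex sets for which every choice
  of one member of each pair has a common point; a cube of dimension \<open>k + 1\<close> spanned by such points
  shows that this is impossible in covering dimension \<open>k\<close>. Since \<open>R\<close> is generated by finitely many
  elements of finite order, it is elliptic, and so are its conjugates, one of which contains the
  pointwise stabilizer of \<open>I(0)\<close>. Finally every element of the whole group is a product of boundedly
  many elements of such conjugates and of a fixed finite set, so all orbits are bounded.\<close>

section \<open>CAT(0) spaces and the CN inequality\<close>

text \<open>The doubling argument needs room: conjugates of \<open>R\<close> into disjoint cylinders
  commute, so any choice among their fixed-point sets has a common point, found as the circumcenter
  of an invariant sphere. The whole group leaves no such room, which is why ellipticity is first
  proved for \<open>R\<close> and only then carried over by displacement estimates. It suffices to
  join two elliptic pieces at a time, so only pairs of convex sets are played against the dimension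
  and a finite generating set is absorbed element by element. For pairs no homology is used: the
  obstruction to covers of small order is a cubical KKM lemma, obtained from Poincare-Miranda and
  Kuhn's combinatorial lemma. It produces \<open>k + 2\<close> members of a cover through one point,
  one more than covering dimension \<open>k\<close> permits. The geometry enters only through the CN
  inequality, which yields unique geodesics, their continuity and circumcenters. For q > 2 the
  complement of I(0) is not a single cylinder and no swap puts it into I(0); hence the special
  involution \<open>spread\<close>.\<close>

lemma comparison_triangle_exists:
  fixes a b c :: real
  assumes "0 \<le> a" "0 \<le> b" "0 \<le> c" "a \<le> b + c" "b \<le> a + c" "c \<le> a + b"
  obtains p q r :: "real^2" where "dist p q = a" "dist q r = b" "dist r p = c"
proof -
  \<comment> \<open>Law of cosines: with p at the origin and q at \<open>(a, 0)\<close>, the vertex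
    r has first coordinate \<open>u\<close>. The formula divides by \<open>a\<close>, so a
    degenerate base is treated apart.\<close>
  define u where "u = (a\<^sup>2 + c\<^sup>2 - b\<^sup>2) / (2 * a)"
  define v where "v = sqrt (c\<^sup>2 - u\<^sup>2)"
  have dist2: "dist (vector [x, y] :: real^2) (vector [x', y']) = sqrt ((x - x')\<^sup>2 + (y - y')\<^sup>2)"
    for x y x' y' :: real
    by (simp add: dist_vec_def L2_set_def UNIV_2 dist_real_def)
  show thesis
  proof (cases "a = 0")
    case True
    then have "b = c" using assms by simp
    then show thesis
      using that[of "vector [0, 0]" "vector [0, 0]" "vector [c, 0]"] True assms by (simp add: dist2)
  next
    case False
    then have a: "a > 0" using assms by simp
    have "(a - c)\<^sup>2 \<le> b\<^sup>2" using assms by (simp add: abs_le_square_iff[symmetric])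
    moreover have "b\<^sup>2 \<le> (a + c)\<^sup>2" using assms by (simp add: power_mono)
    ultimately have "u \<le> c" "- c \<le> u"
      using a by (auto simp: u_def field_simps power2_eq_square)
    then have "u\<^sup>2 \<le> c\<^sup>2" by (simp add: abs_le_square_iff[symmetric] abs_le_iff assms)
    then have v: "v\<^sup>2 = c\<^sup>2 - u\<^sup>2" by (simp add: v_def)
    have "2 * a * u = a\<^sup>2 + c\<^sup>2 - b\<^sup>2" using a by (simp add: u_def)
    then have "(a - u)\<^sup>2 + v\<^sup>2 = b\<^sup>2" using v by (simp add: power2_eq_square algebra_simps)
    moreover have "u\<^sup>2 + v\<^sup>2 = c\<^sup>2" using v by simp
    ultimately show thesis
      using that[of "vector [0, 0]" "vector [a, 0]" "vector [u, v]"] assms by (simp add: dist2)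
  qed
qed

text \<open>Stewart's theorem, by expanding inner products. This equality in the plane turns the
  comparison of a vertex with a point of the opposite side into the CN inequality.\<close>

lemma dist_affine_combination:
  fixes p q r :: "'a::real_inner"
  shows "(dist r ((1 - t) *\<^sub>R p + t *\<^sub>R q))\<^sup>2
    = (1 - t) * (dist r p)\<^sup>2 + t * (dist r q)\<^sup>2 - t * (1 - t) * (dist p q)\<^sup>2"
proof -
  define x y where "x = r - p" and "y = r - q"
  have "r - ((1 - t) *\<^sub>R p + t *\<^sub>R q) = (1 - t) *\<^sub>R x + t *\<^sub>R y"
    by (simp add: x_def y_def algebra_simps)
  moreover have "p - q = y - x" by (simp add: x_def y_def)
  moreover have "(norm ((1 - t) *\<^sub>R x + t *\<^sub>R y))\<^sup>2
      = (1 - t) * (norm x)\<^sup>2 + t * (norm y)\<^sup>2 - t * (1 - t) * (norm (y - x))\<^sup>2"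
    unfolding power2_norm_eq_inner
    by (simp add: inner_simps inner_commute[of y x] algebra_simps)
  ultimately show ?thesis by (simp only: dist_norm x_def[symmetric] y_def[symmetric])
qed

text \<open>The Bruhat-Tits inequality for all parameters instead of midpoints only, with one chosen
  path \<open>\<gamma> x y\<close> per pair. Uniqueness and continuity of the paths follow from it,
  so neither is assumed.\<close>

locale CN_space = Metric_space M d for M :: "'a set" and d +
  fixes \<gamma> :: "'a \<Rightarrow> 'a \<Rightarrow> real \<Rightarrow> 'a"
  assumes \<gamma>_in: "\<lbrakk>x \<in> M; y \<in> M; 0 \<le> t; t \<le> 1\<rbrakk> \<Longrightarrow> \<gamma> x y t \<in> M"
    and CN: "\<lbrakk>x \<in> M; y \<in> M; z \<in> M; 0 \<le> t; t \<le> 1\<rbrakk> \<Longrightarrow>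
      (d z (\<gamma> x y t))\<^sup>2 \<le> (1 - t) * (d z x)\<^sup>2 + t * (d z y)\<^sup>2 - t * (1 - t) * (d x y)\<^sup>2"

text \<open>Only a vertex \<open>z\<close> has to be compared with a point of the opposite side, and
  the plane distance is then given exactly by \<open>dist_affine_combination\<close>.\<close>

lemma CAT0_imp_CN_space:
  assumes "CAT0_space M d"
  obtains \<gamma> where "CN_space M d \<gamma>"
proof -
  interpret Metric_space M d using assms by (simp add: CAT0_space_def)
  have geo: "geodesic_space M d" and tri: "CAT0_triangle_condition M d"
    using assms by (simp_all add: CAT0_space_def)
  have "\<exists>c l. 0 \<le> l \<and> c \<in> {0..l} \<rightarrow> M \<and> c 0 = x \<and> c l = y \<and>
     (\<forall>s\<in>{0..l}. \<forall>t\<in>{0..l}. d (c s) (c t) = \<bar>s - t\<bar>)" if "x \<in> M" "y \<in> M" for x y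
    using geo that unfolding geodesic_space_def geodesic_segment_def by metis
  then obtain c l where c: "\<And>x y. x \<in> M \<Longrightarrow> y \<in> M \<Longrightarrow> 0 \<le> l x y \<and> c x y \<in> {0..l x y} \<rightarrow> M \<and>
      c x y 0 = x \<and> c x y (l x y :: real) = y \<and>
     (\<forall>s\<in>{0..l x y}. \<forall>t\<in>{0..l x y}. d (c x y s) (c x y t) = \<bar>s - t\<bar>)"
    by metis
  have l: "l x y = d x y" if "x \<in> M" "y \<in> M" for x y
  proof -
    have "d (c x y 0) (c x y (l x y)) = \<bar>0 - l x y\<bar>" using c[OF that] by fastforce
    then show ?thesis using c[OF that] by simp
  qed
  define \<gamma> where "\<gamma> x y t = c x y (t * d x y)" for x y t
  have seg: "t * d x y \<in> {0..l x y}" if "x \<in> M" "y \<in> M" "0 \<le> t" "t \<le> 1" for x y t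
    using that l[OF that(1,2)] by (simp add: mult_left_le_one_le)
  have "CN_space M d \<gamma>"
  proof
    fix x y t assume *: "x \<in> M" "y \<in> M" "0 \<le> t" "t \<le> (1::real)"
    show "\<gamma> x y t \<in> M"
      unfolding \<gamma>_def using c[OF *(1,2)] seg[OF *] by blast
    fix z assume z: "z \<in> M"
    obtain p' q' r' :: "real^2" where pqr: "dist p' q' = d x y" "dist q' r' = d y z" "dist r' p' = d z x"
      using comparison_triangle_exists[of "d x y" "d y z" "d z x"]
        triangle[of x z y] triangle[of y x z] triangle[of z y x] * z commute
      by (metis nonneg add.commute)
    obtain T where T: "geodesic_segment M d y z T"
      using geo * z unfolding geodesic_space_def by blast
    obtain U where U: "geodesic_segment M d z x U"
      using geo * z unfolding geodesic_space_def by blast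
    have S: "geodesic_segment M d x y (c x y ` {0..l x y})"
      unfolding geodesic_segment_def using c[OF *(1,2)] by blast
    \<comment> \<open>\<open>m'\<close> divides the comparison side in the same ratio as
      \<open>\<gamma> x y t\<close> divides the geodesic. The vertex \<open>z\<close> counts as the
      starting point of the side \<open>U\<close>, with comparison point \<open>r'\<close>.\<close>
    define m' where "m' = (1 - t) *\<^sub>R p' + t *\<^sub>R q'"
    have "dist p' m' = t * dist p' q'"
    proof -
      have "p' - m' = t *\<^sub>R (p' - q')" by (simp add: m'_def algebra_simps)
      then show ?thesis using * by (simp add: dist_norm)
    qed
    moreover have "d x (\<gamma> x y t) = t * d x y"
    proof -
      have "d (c x y 0) (c x y (t * d x y)) = \<bar>0 - t * d x y\<bar>"
        using c[OF *(1,2)] seg[OF *] by fastforce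
      then show ?thesis using c[OF *(1,2)] * by (simp add: \<gamma>_def)
    qed
    moreover have "m' \<in> closed_segment p' q'"
      unfolding m'_def closed_segment_def using * by blast
    moreover have "\<gamma> x y t \<in> c x y ` {0..l x y}"
      unfolding \<gamma>_def using seg[OF *] by blast
    ultimately have 1: "comparison_point d (c x y ` {0..l x y}) x p' q' (\<gamma> x y t) m'"
      by (simp add: comparison_point_def pqr)
    have "z \<in> U" using U unfolding geodesic_segment_def by force
    then have 2: "comparison_point d U z r' p' z r'"
      using z by (simp add: comparison_point_def)
    have "d z (\<gamma> x y t) \<le> dist r' m'"
      using tri *(1,2) z S T U pqr 1 2 unfolding CAT0_triangle_condition_def Let_def by blast
    then have "(d z (\<gamma> x y t))\<^sup>2 \<le> (dist r' m')\<^sup>2" by (simp add: power_mono)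
    then show "(d z (\<gamma> x y t))\<^sup>2 \<le> (1 - t) * (d z x)\<^sup>2 + t * (d z y)\<^sup>2 - t * (1 - t) * (d x y)\<^sup>2"
      using pqr by (simp add: m'_def dist_affine_combination dist_commute commute)
  qed
  then show thesis by (rule that)
qed

section \<open>Consequences of the CN inequality: geodesics and circumcenters\<close>

context CN_space
begin

text \<open>CN at the endpoint \<open>z = x\<close>: the right-hand side collapses to
  \<open>(t * d x y)\<^sup>2\<close>.\<close>

lemma \<gamma>_dist_left:
  assumes "x \<in> M" "y \<in> M" "0 \<le> t" "t \<le> 1"
  shows "d x (\<gamma> x y t) \<le> t * d x y"
proof -
  have "(d x (\<gamma> x y t))\<^sup>2 \<le> (t * d x y)\<^sup>2"
    using CN[OF assms(1,2,1,3,4)] assms by (simp add: algebra_simps power2_eq_square)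
  then show ?thesis by (rule power2_le_imp_le) (use assms in simp)
qed

lemma \<gamma>_dist_right:
  assumes "x \<in> M" "y \<in> M" "0 \<le> t" "t \<le> 1"
  shows "d y (\<gamma> x y t) \<le> (1 - t) * d x y"
proof -
  have "(d y (\<gamma> x y t))\<^sup>2 \<le> ((1 - t) * d x y)\<^sup>2"
    using CN[OF assms(1,2,2,3,4)] assms commute[of y x] by (simp add: algebra_simps power2_eq_square)
  then show ?thesis by (rule power2_le_imp_le) (use assms in simp)
qed

text \<open>Uniqueness and continuity of \<gamma> rest on this cancellation: for a point at
  distances \<open>t * L\<close> and \<open>(1 - t) * L\<close> from the ends, CN bounds the
  distance to the division point by 0.\<close>

lemma CN_defect: "(1 - t) * (t * L)\<^sup>2 + t * ((1 - t) * L)\<^sup>2 - t * (1 - t) * L\<^sup>2 = (0::real)"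
  by (simp add: algebra_simps power2_eq_square)

lemma \<gamma>_unique:
  assumes "x \<in> M" "y \<in> M" "0 \<le> t" "t \<le> 1" "m \<in> M"
    and "d x m \<le> t * d x y" "d y m \<le> (1 - t) * d x y"
  shows "m = \<gamma> x y t"
proof -
  have "(d m x)\<^sup>2 \<le> (t * d x y)\<^sup>2" "(d m y)\<^sup>2 \<le> ((1 - t) * d x y)\<^sup>2"
    using assms commute[of m x] commute[of m y] by (simp_all add: power_mono)
  then have "(1 - t) * (d m x)\<^sup>2 + t * (d m y)\<^sup>2 \<le> (1 - t) * (t * d x y)\<^sup>2 + t * ((1 - t) * d x y)\<^sup>2"
    using assms by (intro add_mono mult_left_mono) auto
  then have "(d m (\<gamma> x y t))\<^sup>2 \<le> 0"
    using CN[OF assms(1,2,5,3,4)] CN_defect[of t "d x y"] by linarith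
  then show ?thesis using assms \<gamma>_in by simp
qed

lemma \<gamma>_ends:
  assumes "x \<in> M" "y \<in> M"
  shows "\<gamma> x y 0 = x" "\<gamma> x y 1 = y"
  using \<gamma>_unique[OF assms, of 0 x] \<gamma>_unique[OF assms, of 1 y] assms commute by simp_all

text \<open>An isometry fixing both ends preserves the two distance bounds that characterize the
  division point. This is why fixed-point sets are convex.\<close>

lemma fixed_point_\<gamma>:
  assumes "g \<in> M \<rightarrow> M" "\<And>x y. x \<in> M \<Longrightarrow> y \<in> M \<Longrightarrow> d (g x) (g y) = d x y"
    and "x \<in> M" "y \<in> M" "g x = x" "g y = y" "0 \<le> t" "t \<le> 1"
  shows "g (\<gamma> x y t) = \<gamma> x y t"
proof (rule \<gamma>_unique)
  have m: "\<gamma> x y t \<in> M" using assms \<gamma>_in by blast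
  then show "g (\<gamma> x y t) \<in> M" using assms by blast
  show "d x (g (\<gamma> x y t)) \<le> t * d x y"
    using assms(2)[OF assms(3) m] \<gamma>_dist_left assms by simp
  show "d y (g (\<gamma> x y t)) \<le> (1 - t) * d x y"
    using assms(2)[OF assms(4) m] \<gamma>_dist_right assms by simp
qed (use assms in auto)

lemma \<gamma>_tendsto:
  assumes "eventually (\<lambda>u. a u \<in> M \<and> b u \<in> M \<and> 0 \<le> s u \<and> s u \<le> 1) F"
    and "a0 \<in> M" "b0 \<in> M" "0 \<le> s0" "s0 \<le> 1"
    and a: "((\<lambda>u. d (a u) a0) \<longlongrightarrow> 0) F" and b: "((\<lambda>u. d (b u) b0) \<longlongrightarrow> 0) F"
    and s: "(s \<longlongrightarrow> s0) F"
  shows "((\<lambda>u. d (\<gamma> (a u) (b u) (s u)) (\<gamma> a0 b0 s0)) \<longlongrightarrow> 0) F"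
proof -
  have "((\<lambda>u. d (a u) (b u) - d a0 b0) \<longlongrightarrow> 0) F"
  proof (rule tendsto_0_le[where K=1])
    show "((\<lambda>u. d (a u) a0 + d (b u) b0) \<longlongrightarrow> 0) F" using tendsto_add[OF a b] by simp
    show "\<forall>\<^sub>F u in F. norm (d (a u) (b u) - d a0 b0) \<le> norm (d (a u) a0 + d (b u) b0) * 1"
      using assms(1)
    proof eventually_elim
      case (elim u)
      have "d (a u) (b u) \<le> d (a u) a0 + d a0 b0 + d (b u) b0"
        using triangle[of "a u" a0 "b u"] triangle[of a0 b0 "b u"] elim assms commute[of b0 "b u"] by simp
      moreover have "d a0 b0 \<le> d (a u) a0 + d (a u) (b u) + d (b u) b0"
        using triangle[of a0 "a u" b0] triangle[of "a u" "b u" b0] elim assms commute[of a0 "a u"] by simp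
      ultimately show ?case by simp
    qed
  qed
  then have L: "((\<lambda>u. d (a u) (b u)) \<longlongrightarrow> d a0 b0) F" by (simp add: LIM_zero_iff)
  \<comment> \<open>The CN bound at the moving point for the limit path, with the distances to
    \<open>a0\<close> and \<open>b0\<close> replaced by triangle-inequality bounds. In the limit it
    becomes the expression of \<open>CN_defect\<close>.\<close>
  define E where "E u = (1 - s0) * (s u * d (a u) (b u) + d (a u) a0)\<^sup>2
    + s0 * ((1 - s u) * d (a u) (b u) + d (b u) b0)\<^sup>2 - s0 * (1 - s0) * (d a0 b0)\<^sup>2" for u
  have "(E \<longlongrightarrow> (1 - s0) * (s0 * d a0 b0 + 0)\<^sup>2
    + s0 * ((1 - s0) * d a0 b0 + 0)\<^sup>2 - s0 * (1 - s0) * (d a0 b0)\<^sup>2) F"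
    unfolding E_def by (intro tendsto_intros a b s L)
  then have E: "(E \<longlongrightarrow> 0) F" using CN_defect[of s0 "d a0 b0"] by simp
  have "\<forall>\<^sub>F u in F. (d (\<gamma> (a u) (b u) (s u)) (\<gamma> a0 b0 s0))\<^sup>2 \<le> E u"
    using assms(1)
  proof eventually_elim
    case (elim u)
    define m where "m = \<gamma> (a u) (b u) (s u)"
    have m: "m \<in> M" using elim \<gamma>_in by (simp add: m_def)
    have "d m a0 \<le> s u * d (a u) (b u) + d (a u) a0"
      using \<gamma>_dist_left[of "a u" "b u" "s u"] triangle[of m "a u" a0] elim assms m commute[of m]
      by (simp add: m_def)
    moreover have "d m b0 \<le> (1 - s u) * d (a u) (b u) + d (b u) b0"
      using \<gamma>_dist_right[of "a u" "b u" "s u"] triangle[of m "b u" b0] elim assms m commute[of m]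
      by (simp add: m_def)
    ultimately have "(1 - s0) * (d m a0)\<^sup>2 + s0 * (d m b0)\<^sup>2 \<le>
      (1 - s0) * (s u * d (a u) (b u) + d (a u) a0)\<^sup>2
    + s0 * ((1 - s u) * d (a u) (b u) + d (b u) b0)\<^sup>2"
      using assms by (intro add_mono mult_left_mono power_mono) auto
    then show ?case
      using CN[of a0 b0 m s0] assms m unfolding E_def m_def by linarith
  qed
  then have "((\<lambda>u. (d (\<gamma> (a u) (b u) (s u)) (\<gamma> a0 b0 s0))\<^sup>2) \<longlongrightarrow> 0) F"
    by (intro tendsto_sandwich[OF _ _ tendsto_const E]) auto
  then have "((\<lambda>u. sqrt ((d (\<gamma> (a u) (b u) (s u)) (\<gamma> a0 b0 s0))\<^sup>2)) \<longlongrightarrow> sqrt 0) F"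
    by (rule tendsto_real_sqrt)
  then show ?thesis by simp
qed

text \<open>Bruhat-Tits: the circumradius function \<open>r\<close> has a minimizer by completeness,
  and only one, which every isometry preserving \<open>Y\<close> must therefore fix. Existence and
  uniqueness both come from the estimate \<open>key\<close>.\<close>

lemma circumcenter:
  assumes complete: mcomplete and Y: "Y \<subseteq> M" "Y \<noteq> {}" and z0: "z0 \<in> M" "\<And>y. y \<in> Y \<Longrightarrow> d z0 y \<le> B"
  obtains c where "c \<in> M"
    "\<And>g. \<lbrakk>g \<in> M \<rightarrow> M; \<And>x y. x \<in> M \<Longrightarrow> y \<in> M \<Longrightarrow> d (g x) (g y) = d x y; g ` Y = Y\<rbrakk> \<Longrightarrow> g c = c"
proof -
  define r where "r z = (SUP y\<in>Y. d z y)" for z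
  have bdd: "bdd_above (d z ` Y)" if "z \<in> M" for z
  proof (rule bdd_aboveI2)
    fix y assume "y \<in> Y"
    then show "d z y \<le> d z z0 + B" using triangle[of z z0 y] z0 that Y by force
  qed
  have r_ge: "d z y \<le> r z" if "z \<in> M" "y \<in> Y" for z y
    unfolding r_def using bdd[OF that(1)] that by (simp add: cSUP_upper)
  have r_le: "r z \<le> b" if "\<And>y. y \<in> Y \<Longrightarrow> d z y \<le> b" for z b
    unfolding r_def using Y that by (intro cSUP_least) auto
  have r_nonneg: "0 \<le> r z" if "z \<in> M" for z
    using r_ge[OF that] Y by (meson all_not_in_conv nonneg order_trans)
  define R where "R = (INF z\<in>M. r z)"
  have bddR: "bdd_below (r ` M)" using r_nonneg by (rule bdd_belowI2)
  have R_le: "R \<le> r z" if "z \<in> M" for z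
    unfolding R_def using bddR that by (simp add: cINF_lower)
  have R_nonneg: "0 \<le> R" unfolding R_def using z0 r_nonneg by (intro cINF_greatest) auto
  \<comment> \<open>The midpoint of \<open>z\<close> and \<open>z'\<close> has radius at least
    \<open>R\<close>, while CN bounds its radius through those of \<open>z\<close> and
    \<open>z'\<close>. Near-minimizers are therefore close together.\<close>
  have key: "(d z z')\<^sup>2 \<le> 2 * (r z)\<^sup>2 + 2 * (r z')\<^sup>2 - 4 * R\<^sup>2" if "z \<in> M" "z' \<in> M" for z z'
  proof -
    define m where "m = \<gamma> z z' (1/2)"
    have m: "m \<in> M" using that \<gamma>_in by (simp add: m_def)
    define e where "e = (r z)\<^sup>2 / 2 + (r z')\<^sup>2 / 2 - (d z z')\<^sup>2 / 4"
    have *: "(d m y)\<^sup>2 \<le> e" if "y \<in> Y" for y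
    proof -
      have "(d y m)\<^sup>2 \<le> (1 - 1/2) * (d y z)\<^sup>2 + (1/2) * (d y z')\<^sup>2 - (1/2) * (1 - 1/2) * (d z z')\<^sup>2"
        unfolding m_def using CN[of z z' y "1/2"] \<open>z \<in> M\<close> \<open>z' \<in> M\<close> Y that by auto
      moreover have "(d y z)\<^sup>2 \<le> (r z)\<^sup>2" "(d y z')\<^sup>2 \<le> (r z')\<^sup>2"
        using r_ge[OF \<open>z \<in> M\<close> that] r_ge[OF \<open>z' \<in> M\<close> that]
        by (simp_all add: power_mono commute[of y])
      ultimately show ?thesis by (simp add: e_def commute)
    qed
    have "e \<ge> 0" using * Y by (meson all_not_in_conv order_trans zero_le_power2)
    have "d m y \<le> sqrt e" if "y \<in> Y" for y using *[OF that] by (simp add: real_le_rsqrt)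
    then have "r m \<le> sqrt e" by (rule r_le)
    then have "R \<le> sqrt e" using R_le[OF m] by linarith
    then have "R\<^sup>2 \<le> e" using R_nonneg \<open>e \<ge> 0\<close> by (metis power_mono real_sqrt_pow2)
    then show ?thesis by (simp add: e_def)
  qed
  have ex: "\<exists>z\<in>M. r z < R + 1 / real (Suc n)" for n
  proof -
    have "R < R + 1 / real (Suc n)" by simp
    then show ?thesis unfolding R_def using cInf_lessD[of "r ` M"] z0 by blast
  qed
  then obtain \<zeta> where \<zeta>: "\<And>n. \<zeta> n \<in> M" "\<And>n. r (\<zeta> n) < R + 1 / real (Suc n)" by metis
  have rlim: "(\<lambda>n. r (\<zeta> n)) \<longlonglongrightarrow> R"
  proof (rule tendsto_sandwich)
    show "\<forall>\<^sub>F n in sequentially. R \<le> r (\<zeta> n)" using R_le \<zeta> by simp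
    show "\<forall>\<^sub>F n in sequentially. r (\<zeta> n) \<le> R + 1 / real (Suc n)" by (intro always_eventually allI less_imp_le \<zeta>(2))
    show "(\<lambda>n. R + 1 / real (Suc n)) \<longlonglongrightarrow> R"
      using tendsto_add[OF tendsto_const LIMSEQ_Suc[OF lim_1_over_n]] by force
  qed simp
  have "MCauchy \<zeta>"
    unfolding MCauchy_def
  proof (intro conjI allI impI)
    show "range \<zeta> \<subseteq> M" using \<zeta> by blast
    fix \<epsilon> :: real assume "\<epsilon> > 0"
    have "(\<lambda>n. (r (\<zeta> n))\<^sup>2) \<longlonglongrightarrow> R\<^sup>2" using rlim by (intro tendsto_intros)
    then have "\<forall>\<^sub>F n in sequentially. (r (\<zeta> n))\<^sup>2 < R\<^sup>2 + \<epsilon>\<^sup>2 / 4"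
      using \<open>\<epsilon> > 0\<close> by (intro order_tendstoD(2)) auto
    then obtain N where N: "\<And>n. n \<ge> N \<Longrightarrow> (r (\<zeta> n))\<^sup>2 < R\<^sup>2 + \<epsilon>\<^sup>2 / 4"
      unfolding eventually_sequentially by blast
    have "d (\<zeta> n) (\<zeta> n') < \<epsilon>" if "n \<ge> N" "n' \<ge> N" for n n'
    proof -
      have "(d (\<zeta> n) (\<zeta> n'))\<^sup>2 < \<epsilon>\<^sup>2"
        using key[OF \<zeta>(1) \<zeta>(1), of n n'] N[OF that(1)] N[OF that(2)] by linarith
      then show ?thesis using \<open>\<epsilon> > 0\<close> by (meson less_imp_le power2_less_imp_less)
    qed
    then show "\<exists>N. \<forall>n n'. N \<le> n \<longrightarrow> N \<le> n' \<longrightarrow> d (\<zeta> n) (\<zeta> n') < \<epsilon>" by blast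
  qed
  then obtain c where c: "limitin mtopology \<zeta> c sequentially"
    using complete unfolding mcomplete_def by blast
  then have cM: "c \<in> M" and clim: "(\<lambda>n. d (\<zeta> n) c) \<longlonglongrightarrow> 0"
    by (auto simp: limitin_metric_dist_null)
  have "r c \<le> R"
  proof (rule LIMSEQ_le_const)
    show "(\<lambda>n. d (\<zeta> n) c + r (\<zeta> n)) \<longlonglongrightarrow> R" using tendsto_add[OF clim rlim] by simp
    have "r c \<le> d (\<zeta> n) c + r (\<zeta> n)" for n
    proof (rule r_le)
      fix y assume "y \<in> Y"
      then show "d c y \<le> d (\<zeta> n) c + r (\<zeta> n)"
        using triangle''[of c "\<zeta> n" y] r_ge[OF \<zeta>(1), of y n] cM \<zeta>(1) Y by force
    qed
    then show "\<exists>N. \<forall>n\<ge>N. r c \<le> d (\<zeta> n) c + r (\<zeta> n)" by blast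
  qed
  then have rc: "r c = R" using R_le[OF cM] by simp
  show thesis
  proof
    show "c \<in> M" by fact
    fix g assume g: "g \<in> M \<rightarrow> M" "\<And>x y. x \<in> M \<Longrightarrow> y \<in> M \<Longrightarrow> d (g x) (g y) = d x y" "g ` Y = Y"
    have gc: "g c \<in> M" using g cM by blast
    \<comment> \<open>\<open>g\<close> maps \<open>Y\<close> onto itself, so it does not increase
      the radius at \<open>c\<close>; then \<open>key\<close> with both radii equal to
      \<open>R\<close> forces \<open>g c = c\<close>.\<close>
    have "r (g c) \<le> r c"
    proof (rule r_le)
      fix y assume "y \<in> Y"
      then obtain y' where "y' \<in> Y" "y = g y'" using g(3) by blast
      then show "d (g c) y \<le> r c" using g(2)[OF cM, of y'] r_ge[OF cM] Y by auto
    qed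
    then have "r (g c) = R" using rc R_le[OF gc] by simp
    then have "(d (g c) c)\<^sup>2 \<le> 0" using key[OF gc cM] rc by simp
    then show "g c = c" using gc cM by simp
  qed
qed

end

section \<open>Pairs of convex sets and covering dimension\<close>

text \<open>Cubes of every dimension live in the one type \<open>nat \<Rightarrow> real\<close>,
  because the dimension \<open>k + 1\<close> is a variable of the theorem. Pinning the coordinates
  from \<open>n\<close> on to 0 makes the cube compact in the product topology.\<close>

definition unit_cube :: "nat \<Rightarrow> (nat \<Rightarrow> real) set" where
  "unit_cube n = {t. \<forall>i. if i < n then 0 \<le> t i \<and> t i \<le> 1 else t i = 0}"

lemma compact_unit_cube: "compact (unit_cube n)"
proof -
  have "unit_cube n = PiE UNIV (\<lambda>i. if i < n then {0..1} else {0})"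
    by (auto simp: unit_cube_def PiE_def Pi_def split: if_splits)
  moreover have "compactin (product_topology (\<lambda>i::nat. euclidean) UNIV)
      (PiE UNIV (\<lambda>i. if i < n then {0..1::real} else {0}))"
    by (auto simp: compactin_PiE)
  ultimately show ?thesis by (simp add: euclidean_product_topology)
qed

lemma tendsto_fun_coordinatewise:
  fixes a :: "'b \<Rightarrow> 'c \<Rightarrow> 'd::topological_space"
  shows "(a \<longlongrightarrow> l) F \<longleftrightarrow> (\<forall>i. ((\<lambda>u. a u i) \<longlongrightarrow> l i) F)"
  using limitin_componentwise[of "\<lambda>_. euclidean" UNIV a l F]
  by (simp add: euclidean_product_topology)

lemma tendsto_fun_perturb:
  fixes c a :: "nat \<Rightarrow> nat \<Rightarrow> real"
  assumes "c \<longlonglongrightarrow> x" "\<And>m j. \<bar>a m j - c m j\<bar> \<le> e m" "e \<longlonglongrightarrow> 0"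
  shows "a \<longlonglongrightarrow> x"
  unfolding tendsto_fun_coordinatewise
proof
  fix j
  have "(\<lambda>m. a m j - c m j) \<longlonglongrightarrow> 0"
    by (rule tendsto_0_le[OF assms(3), where K=1])
      (intro always_eventually allI, use assms(2)[of _ j] in \<open>auto intro: order_trans[OF _ abs_ge_self]\<close>)
  moreover have "(\<lambda>m. c m j) \<longlonglongrightarrow> x j" using assms(1) by (simp add: tendsto_fun_coordinatewise)
  ultimately show "(\<lambda>m. a m j) \<longlonglongrightarrow> x j" using tendsto_add by fastforce
qed

text \<open>Kuhn's lemma on a grid of mesh \<open>1 / Suc m\<close> gives, for each
  \<open>i\<close>, two points close to a common one where \<open>F i\<close> has opposite weak
  signs. A subsequential limit of the common points is a zero of all components.\<close>

theorem poincare_miranda: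
  fixes F :: "nat \<Rightarrow> (nat \<Rightarrow> real) \<Rightarrow> real"
  assumes cont: "\<And>i. i < n \<Longrightarrow> continuous_on (unit_cube n) (F i)"
    and F0: "\<And>i t. i < n \<Longrightarrow> t \<in> unit_cube n \<Longrightarrow> t i = 0 \<Longrightarrow> F i t \<le> 0"
    and F1: "\<And>i t. i < n \<Longrightarrow> t \<in> unit_cube n \<Longrightarrow> t i = 1 \<Longrightarrow> 0 \<le> F i t"
  shows "\<exists>t\<in>unit_cube n. \<forall>i<n. F i t = 0"
proof -
  have "\<exists>c\<in>unit_cube n. \<forall>i<n. \<exists>a\<in>unit_cube n. \<exists>b\<in>unit_cube n.
      (\<forall>j. \<bar>a j - c j\<bar> \<le> 1 / real (Suc m)) \<and> (\<forall>j. \<bar>b j - c j\<bar> \<le> 1 / real (Suc m)) \<and>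
      F i a \<le> 0 \<and> 0 \<le> F i b" for m
  proof -
    define p where "p = Suc m"
    have p: "0 < p" by (simp add: p_def)
    \<comment> \<open>\<open>min 1\<close> keeps \<open>e x\<close> in the cube even for arguments
      beyond the grid.\<close>
    define e where "e x i = (if i < n then min 1 (real (x i) / real p) else 0)" for x and i :: nat
    have e_cube: "e x \<in> unit_cube n" for x by (simp add: e_def unit_cube_def)
    \<comment> \<open>Kuhn's lemma prescribes the labels on the faces, so these override the sign of
      \<open>F i\<close>; the boundary assumptions make the override agree with a weak sign.\<close>
    define label where "label x i =
      (if x i = 0 then 0 else if x i = p then 1 else if F i (e x) \<le> 0 then 0 else 1 :: nat)" for x i
    have label0: "F i (e x) \<le> 0" if "i < n" "label x i = 0" for x i
      using that F0[OF that(1) e_cube, of x] by (auto simp: label_def e_def split: if_splits)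
    have label1: "0 \<le> F i (e x)" if "i < n" "label x i = 1" for x i
      using that F1[OF that(1) e_cube, of x] p by (auto simp: label_def e_def split: if_splits)
    have lab: "label x i = 0 \<or> label x i = 1" for x i by (auto simp: label_def)
    obtain q where q: "\<forall>i<n. q i < p"
      and rs: "\<forall>i<n. \<exists>r s. (\<forall>j<n. q j \<le> r j \<and> r j \<le> q j + 1) \<and>
        (\<forall>j<n. q j \<le> s j \<and> s j \<le> q j + 1) \<and> label r i \<noteq> label s i"
      by (rule kuhn_lemma[OF p, of n label]) (use p in \<open>auto simp: label_def\<close>)
    have close: "\<bar>e r j - e q j\<bar> \<le> 1 / real (Suc m)"
      if r: "\<forall>j<n. q j \<le> r j \<and> r j \<le> q j + 1" for r j
    proof (cases "j < n")
      case True
      have "real (q j) / real p \<le> real (r j) / real p"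
        using r True by (simp add: divide_right_mono)
      moreover have "real (r j) / real p \<le> real (q j) / real p + 1 / real p"
        using r True p by (metis add_divide_distrib divide_right_mono of_nat_0_le_iff of_nat_1
            of_nat_add of_nat_le_iff)
      ultimately have "\<bar>min 1 (real (r j) / real p) - min 1 (real (q j) / real p)\<bar> \<le> 1 / real p"
        by linarith
      then show ?thesis using True by (simp add: e_def p_def)
    qed (simp add: e_def)
    show ?thesis
    proof (rule bexI[of _ "e q"], rule allI, rule impI)
      fix i assume i: "i < n"
      obtain r s where rs: "\<forall>j<n. q j \<le> r j \<and> r j \<le> q j + 1"
        "\<forall>j<n. q j \<le> s j \<and> s j \<le> q j + 1" "label r i \<noteq> label s i"
        using rs i by blast
      show "\<exists>a\<in>unit_cube n. \<exists>b\<in>unit_cube n.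
      (\<forall>j. \<bar>a j - e q j\<bar> \<le> 1 / real (Suc m)) \<and> (\<forall>j. \<bar>b j - e q j\<bar> \<le> 1 / real (Suc m)) \<and>
      F i a \<le> 0 \<and> 0 \<le> F i b"
        using label0[OF i] label1[OF i] lab[of r i] lab[of s i] close[OF rs(1)] close[OF rs(2)]
          rs(3) e_cube by metis
    qed (rule e_cube)
  qed
  then obtain c a b where c: "\<And>m. c m \<in> unit_cube n"
    and ab: "\<And>m i. i < n \<Longrightarrow> a m i \<in> unit_cube n \<and> b m i \<in> unit_cube n \<and>
      (\<forall>j. \<bar>a m i j - c m j\<bar> \<le> 1 / real (Suc m)) \<and> (\<forall>j. \<bar>b m i j - c m j\<bar> \<le> 1 / real (Suc m)) \<and>
      F i (a m i) \<le> 0 \<and> 0 \<le> F i (b m i)"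
    by metis
  obtain x h where x: "x \<in> unit_cube n" "strict_mono h" "(c \<circ> h) \<longlonglongrightarrow> x"
    using seq_compactE[OF compact_imp_seq_compact[OF compact_unit_cube], of c n] c by blast
  have inv0: "(\<lambda>m. 1 / real (Suc (h m))) \<longlonglongrightarrow> 0"
    using LIMSEQ_subseq_LIMSEQ[OF LIMSEQ_Suc[OF lim_1_over_n] x(2)] by (simp add: o_def)
  have "F i x = 0" if i: "i < n" for i
  proof (rule antisym)
    have lim: "(\<lambda>m. F i (s (h m))) \<longlonglongrightarrow> F i x"
      if "\<And>m. s m \<in> unit_cube n" "\<And>m j. \<bar>s m j - c m j\<bar> \<le> 1 / real (Suc m)" for s
    proof (rule continuous_on_tendsto_compose[OF cont[OF i]])
      show "(\<lambda>m. s (h m)) \<longlonglongrightarrow> x"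
        by (rule tendsto_fun_perturb[OF x(3) _ inv0]) (use that(2) in \<open>simp add: o_def\<close>)
    qed (use x that(1) in auto)
    show "F i x \<le> 0"
      by (rule LIMSEQ_le_const2[OF lim[of "\<lambda>m. a m i"]]) (use ab[OF i] in auto)
    show "0 \<le> F i x"
      by (rule LIMSEQ_le_const[OF lim[of "\<lambda>m. b m i"]]) (use ab[OF i] in auto)
  qed
  then show ?thesis using x by blast
qed

text \<open>A point is sought where every distance \<open>g j\<close> to \<open>K j\<close> is
  positive. \<open>F i\<close> is the i-th distance minus the sum of the later ones, and the faces
  contained in the sets \<open>K j\<close> give it the boundary signs of Poincare-Miranda. At a
  common zero, \<open>g n = 0\<close> would propagate down to all \<open>g j\<close>, against the
  cover assumption; otherwise every \<open>g j\<close> is at least \<open>g n\<close>, which is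
  positive.\<close>

lemma unit_cube_KKM:
  assumes "0 < n" and closed: "\<And>j. j \<le> n \<Longrightarrow> closed (K j)"
    and K0: "\<And>j t. j < n \<Longrightarrow> t \<in> unit_cube n \<Longrightarrow> t j = 0 \<Longrightarrow> t \<in> K j"
    and K1: "\<And>i j t. i < j \<Longrightarrow> j \<le> n \<Longrightarrow> t \<in> unit_cube n \<Longrightarrow> t i = 1 \<Longrightarrow> t \<in> K j"
    and cover: "\<And>t. t \<in> unit_cube n \<Longrightarrow> \<exists>j\<le>n. t \<notin> K j"
  shows "\<exists>t\<in>unit_cube n. \<forall>j\<le>n. t \<notin> K j"
proof -
  define g where "g j t = infdist t (K j)" for j t
  define F where "F i t = g i t - (\<Sum>j\<in>{i<..n}. g j t)" for i t
  \<comment> \<open>\<open>infdist\<close> to the empty set is 0 by convention, so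
    \<open>g j t = 0\<close> describes \<open>K j\<close> only if that set is non-empty.\<close>
  have ne: "K j \<noteq> {}" if "j \<le> n" for j
  proof (cases "j < n")
    case True
    have "(\<lambda>_. 0) \<in> unit_cube n" by (simp add: unit_cube_def)
    then show ?thesis using K0[OF True] by auto
  next
    case False
    have "(\<lambda>i. if i = 0 then 1 else 0) \<in> unit_cube n" using assms(1) by (simp add: unit_cube_def)
    then have "(\<lambda>i. if i = 0 then 1 else 0) \<in> K j" using K1[of 0 j] that False assms(1) by simp
    then show ?thesis by blast
  qed
  have g0: "g j t = 0 \<longleftrightarrow> t \<in> K j" if "j \<le> n" for j t
    using in_closed_iff_infdist_zero[OF closed[OF that] ne[OF that]] by (simp add: g_def)
  have gnn: "0 \<le> g j t" for j t by (simp add: g_def infdist_nonneg)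
  have "\<exists>t\<in>unit_cube n. \<forall>i<n. F i t = 0"
  proof (rule poincare_miranda)
    show "continuous_on (unit_cube n) (F i)" for i
      unfolding F_def g_def by (intro continuous_intros)
    show "F i t \<le> 0" if "i < n" "t \<in> unit_cube n" "t i = 0" for i t
      using g0[of i t] K0[OF that] that(1) sum_nonneg[of "{i<..n}" "\<lambda>j. g j t"] gnn
      by (simp add: F_def)
    show "0 \<le> F i t" if "i < n" "t \<in> unit_cube n" "t i = 1" for i t
    proof -
      have "(\<Sum>j\<in>{i<..n}. g j t) = 0" using g0 K1 that by (intro sum.neutral) auto
      then show ?thesis using gnn by (simp add: F_def)
    qed
  qed
  then obtain t where t: "t \<in> unit_cube n" "\<And>i. i < n \<Longrightarrow> g i t = (\<Sum>j\<in>{i<..n}. g j t)"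
    unfolding F_def by auto
  have "g n t \<noteq> 0"
  proof
    assume *: "g n t = 0"
    \<comment> \<open>Downward induction on the index, written with \<open>n - i\<close>; for
      \<open>i > n\<close> truncated subtraction gives index 0 once more.\<close>
    have "g (n - i) t = 0" for i
    proof (induction i rule: less_induct)
      case (less i)
      show ?case
      proof (cases "0 < i \<and> i \<le> n")
        case True
        have "(\<Sum>j\<in>{n - i<..n}. g j t) = 0"
        proof (rule sum.neutral, rule ballI)
          fix j assume "j \<in> {n - i<..n}"
          then show "g j t = 0" using less.IH[of "n - j"] True by auto
        qed
        then show ?thesis using t(2)[of "n - i"] True by simp
      qed (use * less.IH[of n] in force)
    qed
    then have "g j t = 0" if "j \<le> n" for j using that by (metis diff_diff_cancel)
    then show False using cover[OF t(1)] g0 by blast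
  qed
  then have "0 < g j t" if "j \<le> n" for j
  proof (cases "j = n")
    case False
    have "g n t \<le> (\<Sum>j\<in>{j<..n}. g j t)"
      using that False gnn by (intro member_le_sum) auto
    then show ?thesis using t(2)[of j] that False gnn[of n t] \<open>g n t \<noteq> 0\<close> by simp
  qed (use gnn[of n t] in simp)
  then show ?thesis using g0 t(1) by force
qed

section \<open>Cubes spanned by iterated geodesics\<close>

context CN_space
begin

definition gconvex :: "'a set \<Rightarrow> bool" where
  "gconvex S \<longleftrightarrow> S \<subseteq> M \<and> (\<forall>x\<in>S. \<forall>y\<in>S. \<forall>t. 0 \<le> t \<and> t \<le> 1 \<longrightarrow> \<gamma> x y t \<in> S)"

text \<open>The coordinates \<open>t\<close> below \<open>m\<close> interpolate, by iterated geodesics, between the points \<open>x \<epsilon>\<close>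
  attached to the vertices of the cube.\<close>

fun cube_map :: "((nat \<Rightarrow> bool) \<Rightarrow> 'a) \<Rightarrow> nat \<Rightarrow> (nat \<Rightarrow> bool) \<Rightarrow> (nat \<Rightarrow> real) \<Rightarrow> 'a" where
  "cube_map x 0 \<epsilon> t = x \<epsilon>"
| "cube_map x (Suc m) \<epsilon> t =
    \<gamma> (cube_map x m (\<epsilon>(m := False)) t) (cube_map x m (\<epsilon>(m := True)) t) (t m)"

lemma cube_map_in:
  assumes "\<And>\<epsilon>. x \<epsilon> \<in> M" "t \<in> unit_cube n" "m \<le> n"
  shows "cube_map x m \<epsilon> t \<in> M"
  using assms(3)
proof (induction m arbitrary: \<epsilon>)
  case (Suc m)
  then show ?case using assms(2) by (auto intro!: \<gamma>_in simp: unit_cube_def dest: spec[of _ m])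
qed (use assms in simp)

text \<open>Coordinates below \<open>m\<close> are read from \<open>t\<close>, the others still from
  the vertex \<epsilon>. In the step, a value 0 or 1 at coordinate \<open>m\<close> selects one end
  of the geodesic; at any other coordinate both ends lie in the set and convexity finishes.\<close>

lemma cube_map_faces:
  assumes x: "\<And>\<epsilon> i. i < n \<Longrightarrow> x \<epsilon> \<in> C i (\<epsilon> i)" and C: "\<And>i b. i < n \<Longrightarrow> gconvex (C i b)"
    and t: "t \<in> unit_cube n" and "m \<le> n" "i < n"
    and i: "if i < m then t i = of_bool b else \<epsilon> i = b"
  shows "cube_map x m \<epsilon> t \<in> C i b"
  using \<open>m \<le> n\<close> i
proof (induction m arbitrary: \<epsilon>)
  case 0
  then show ?case using x[OF \<open>i < n\<close>, of \<epsilon>] by simp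
next
  case (Suc m)
  define y z where "y = cube_map x m (\<epsilon>(m := False)) t" and "z = cube_map x m (\<epsilon>(m := True)) t"
  have tm: "0 \<le> t m" "t m \<le> 1" using t Suc.prems by (auto simp: unit_cube_def dest: spec[of _ m])
  have CM: "C i b \<subseteq> M" for b using C[OF \<open>i < n\<close>, of b] by (simp add: gconvex_def)
  have xM: "x \<epsilon> \<in> M" for \<epsilon> using x[OF \<open>i < n\<close>, of \<epsilon>] CM by blast
  have yz: "y \<in> M" "z \<in> M" using cube_map_in[OF xM t] Suc.prems by (simp_all add: y_def z_def)
  have both: "\<gamma> y z (t m) \<in> C i b" if "y \<in> C i b" "z \<in> C i b"
    using that C[OF \<open>i < n\<close>, of b] tm by (simp add: gconvex_def)
  consider "i < m" | "i = m" | "m < i" by linarith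
  then have "\<gamma> y z (t m) \<in> C i b"
  proof cases
    case 2
    then show ?thesis
      using Suc.IH[of "\<epsilon>(m := b)"] Suc.prems \<gamma>_ends[OF yz]
      by (cases b) (simp_all add: y_def z_def fun_upd_def)
  qed (use Suc both in \<open>simp_all add: y_def z_def\<close>)
  then show ?case by (simp add: y_def z_def)
qed

lemma cube_map_continuous:
  assumes x: "\<And>\<epsilon>. x \<epsilon> \<in> M" and t: "t \<in> unit_cube n" and "m \<le> n"
  shows "((\<lambda>s. d (cube_map x m \<epsilon> s) (cube_map x m \<epsilon> t)) \<longlongrightarrow> 0) (at t within unit_cube n)"
  using \<open>m \<le> n\<close>
proof (induction m arbitrary: \<epsilon>)
  case 0
  then show ?case using x by simp
next
  case (Suc m)
  have "((\<lambda>s. s m) \<longlongrightarrow> t m) (at t within unit_cube n)"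
    using tendsto_ident_at[of t "unit_cube n"] by (simp add: tendsto_fun_coordinatewise)
  moreover have "\<forall>\<^sub>F s in at t within unit_cube n. cube_map x m (\<epsilon>(m := False)) s \<in> M \<and>
      cube_map x m (\<epsilon>(m := True)) s \<in> M \<and> 0 \<le> s m \<and> s m \<le> 1"
    using cube_map_in[of x _ n m, OF x] Suc.prems
    by (auto simp: eventually_at_filter unit_cube_def intro!: always_eventually dest: spec[of _ m])
  moreover have "0 \<le> t m" "t m \<le> 1"
    using t Suc.prems by (auto simp: unit_cube_def dest: spec[of _ m])
  ultimately show ?case
    using cube_map_in[OF x t] Suc by (auto intro!: \<gamma>_tendsto)
qed

text \<open>The cubical version of Helly's theorem: if all intersections failed, the cube map would pull
  back an open cover of small order to one that contradicts the KKM property of the cube.\<close>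

theorem convex_pairs_meet:
  assumes dim: "covering_dim_le mtopology k"
    and C: "\<And>i b. i \<le> k \<Longrightarrow> closedin mtopology (C i b) \<and> gconvex (C i b)"
    and meet: "\<And>\<epsilon>. \<exists>x\<in>M. \<forall>i\<le>k. x \<in> C i (\<epsilon> i)"
  shows "\<exists>i\<le>k. C i False \<inter> C i True \<noteq> {}"
proof (rule ccontr)
  assume "\<not> ?thesis"
  then have disj: "C i False \<inter> C i True = {}" if "i \<le> k" for i using that by blast
  define n where "n = Suc k"
  obtain x where x: "\<And>\<epsilon>. x \<epsilon> \<in> M" "\<And>\<epsilon> i. i < n \<Longrightarrow> x \<epsilon> \<in> C i (\<epsilon> i)"
    using meet unfolding n_def less_Suc_eq_le by metis
  define f where "f = cube_map x n (\<lambda>_. False)"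
  have fM: "f t \<in> M" if "t \<in> unit_cube n" for t
    unfolding f_def using cube_map_in[OF x(1) that] by simp
  have face: "f t \<in> C i b" if "t \<in> unit_cube n" "i < n" "t i = of_bool b" for t i b
    unfolding f_def using cube_map_faces[of n x C t n i b] x C that by (simp add: n_def)
  have fcont: "((\<lambda>s. d (f s) (f t)) \<longlongrightarrow> 0) (at t within unit_cube n)" if "t \<in> unit_cube n" for t
    unfolding f_def using cube_map_continuous[OF x(1) that] by simp
  \<comment> \<open>\<open>U \<epsilon>\<close> consists of the points avoiding the chosen member of
    every pair. As the pairs are disjoint, these open sets cover the space.\<close>
  define U where "U \<epsilon> = (\<Inter>i\<in>{..<n}. M - C i (\<epsilon> i))" for \<epsilon>
  have "(\<forall>u\<in>range U. openin mtopology u) \<and> \<Union> (range U) = topspace mtopology"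
  proof (intro conjI ballI)
    show "openin mtopology u" if u: "u \<in> range U" for u
    proof -
      obtain \<epsilon> where "u = U \<epsilon>" using u by blast
      moreover have "openin mtopology (U \<epsilon>)"
        unfolding U_def using C by (intro openin_INT2) (auto simp: n_def less_Suc_eq_le closedin_def)
      ultimately show ?thesis by simp
    qed
    show "\<Union> (range U) = topspace mtopology"
    proof (intro equalityI subsetI)
      fix y assume y: "y \<in> topspace mtopology"
      have "y \<notin> C i (y \<notin> C i True)" if "i \<le> k" for i
        using disj[OF that] by (cases "y \<in> C i True") auto
      then have "y \<in> U (\<lambda>i. y \<notin> C i True)"
        using y by (auto simp: U_def n_def less_Suc_eq_le)
      then show "y \<in> \<Union> (range U)" by blast
    next
      fix y assume "y \<in> \<Union> (range U)"
      then obtain \<epsilon> where "y \<in> U \<epsilon>" by blast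
      then have "y \<in> M - C 0 (\<epsilon> 0)" unfolding U_def n_def by blast
      then show "y \<in> topspace mtopology" by simp
    qed
  qed
  then have "\<exists>\<V>. (\<forall>v\<in>\<V>. openin mtopology v) \<and> \<Union>\<V> = M \<and> (\<forall>v\<in>\<V>. \<exists>u\<in>range U. v \<subseteq> u) \<and>
      (\<forall>y\<in>M. finite {v \<in> \<V>. y \<in> v} \<and> card {v \<in> \<V>. y \<in> v} \<le> k + 1)"
    using dim unfolding covering_dim_le_def topspace_mtopology by blast
  then obtain \<V> where *: "\<forall>v\<in>\<V>. openin mtopology v" "\<Union>\<V> = M" "\<forall>v\<in>\<V>. \<exists>u\<in>range U. v \<subseteq> u"
      "\<forall>y\<in>M. finite {v \<in> \<V>. y \<in> v} \<and> card {v \<in> \<V>. y \<in> v} \<le> k + 1"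
    by (elim exE conjE)
  have \<V>: "\<And>v. v \<in> \<V> \<Longrightarrow> openin mtopology v" "\<Union>\<V> = M" "\<And>v. v \<in> \<V> \<Longrightarrow> \<exists>\<epsilon>. v \<subseteq> U \<epsilon>"
      "\<And>y. y \<in> M \<Longrightarrow> finite {v \<in> \<V>. y \<in> v} \<and> card {v \<in> \<V>. y \<in> v} \<le> k + 1"
    using * by blast+
  \<comment> \<open>The label of \<open>v\<close> is the first \<open>i\<close> for which
    \<open>v\<close> misses \<open>C i False\<close>, or \<open>n\<close>. Since \<open>v\<close>
    lies in some \<open>U \<epsilon>\<close>, at smaller indices \<open>\<epsilon> i\<close> must be
    \<open>True\<close>, so \<open>v\<close> misses \<open>C i True\<close> there. These are the
    face conditions of \<open>unit_cube_KKM\<close>.\<close>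
  define J where "J v = (LEAST i. i = n \<or> v \<inter> C i False = {})" for v
  have J_le: "J v \<le> n" for v unfolding J_def by (rule Least_le) simp
  have J_False: "v \<inter> C (J v) False = {}" if "J v < n" for v
    using LeastI[of "\<lambda>i. i = n \<or> v \<inter> C i False = {}" n] that unfolding J_def by auto
  have J_True: "v \<inter> C i True = {}" if "i < J v" "v \<in> \<V>" for v i
  proof -
    obtain \<epsilon> where "v \<subseteq> U \<epsilon>" using \<V>(3) \<open>v \<in> \<V>\<close> by blast
    moreover have "i < n" using that J_le[of v] by simp
    ultimately have "v \<subseteq> M - C i (\<epsilon> i)" unfolding U_def by blast
    moreover have "v \<inter> C i False \<noteq> {}" using not_less_Least[of i] that unfolding J_def by blast
    ultimately show ?thesis by (cases "\<epsilon> i") auto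
  qed
  define K where "K j = {t \<in> unit_cube n. \<forall>v\<in>\<V>. J v = j \<longrightarrow> f t \<notin> v}" for j
  have "\<exists>t\<in>unit_cube n. \<forall>j\<le>n. t \<notin> K j"
  proof (rule unit_cube_KKM)
    show "0 < n" by (simp add: n_def)
    show "closed (K j)" for j
    proof -
      have "closedin (top_of_set (unit_cube n)) (K j)"
        unfolding closedin_def
      proof (intro conjI)
        have "\<forall>\<^sub>F s in at t within unit_cube n. s \<notin> K j"
          if t: "t \<in> unit_cube n" "t \<notin> K j" for t
        proof -
          obtain v where v: "v \<in> \<V>" "J v = j" "f t \<in> v" using t by (auto simp: K_def)
          obtain r where r: "0 < r" "mball (f t) r \<subseteq> v"
            using \<V>(1)[OF v(1)] v(3) by (auto simp: openin_mtopology)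
          have "\<forall>\<^sub>F s in at t within unit_cube n. d (f s) (f t) < r"
            using order_tendstoD(2)[OF fcont[OF t(1)] r(1)] .
          moreover have "\<forall>\<^sub>F s in at t within unit_cube n. s \<in> unit_cube n"
            by (simp add: eventually_at_filter)
          ultimately show ?thesis
          proof eventually_elim
            case (elim s)
            then have "f s \<in> v" using r(2) fM t(1) commute by auto
            then show ?case using v by (auto simp: K_def)
          qed
        qed
        then have "\<exists>S. open S \<and> t \<in> S \<and> S \<inter> unit_cube n \<subseteq> unit_cube n - K j"
          if t: "t \<in> unit_cube n - K j" for t
        proof -
          obtain S where "open S" "t \<in> S" "\<forall>s\<in>S. s \<noteq> t \<longrightarrow> s \<in> unit_cube n \<longrightarrow> s \<notin> K j"
            using \<open>\<And>t. t \<in> unit_cube n \<Longrightarrow> t \<notin> K j \<Longrightarrow> \<forall>\<^sub>F s in at t within unit_cube n. s \<notin> K j\<close>[of t] t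
            unfolding eventually_at_topological by auto
          then show ?thesis using t by (intro exI[of _ S]) auto
        qed
        then obtain S where S: "\<And>t. t \<in> unit_cube n - K j \<Longrightarrow>
            open (S t) \<and> t \<in> S t \<and> S t \<inter> unit_cube n \<subseteq> unit_cube n - K j"
          by metis
        then have "unit_cube n - K j = unit_cube n \<inter> (\<Union>t\<in>unit_cube n - K j. S t)" by blast
        moreover have "open (\<Union>t\<in>unit_cube n - K j. S t)" using S by (intro open_UN) blast
        ultimately have "openin (top_of_set (unit_cube n)) (unit_cube n - K j)"
          by (metis openin_open_Int)
        then show "openin (top_of_set (unit_cube n)) (topspace (top_of_set (unit_cube n)) - K j)"
          by simp
      qed (auto simp: K_def)
      then show ?thesis
        using closedin_closed_trans compact_imp_closed compact_unit_cube by blast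
    qed
    show "t \<in> K j" if "j < n" "t \<in> unit_cube n" "t j = 0" for j t
      using face[OF that(2,1), of False] J_False that by (auto simp: K_def)
    show "t \<in> K j" if "i < j" "j \<le> n" "t \<in> unit_cube n" "t i = 1" for i j t
      using face[OF that(3), of i True] J_True that by (auto simp: K_def)
    show "\<exists>j\<le>n. t \<notin> K j" if t: "t \<in> unit_cube n" for t
    proof -
      obtain v where "v \<in> \<V>" "f t \<in> v" using fM[OF t] \<V>(2) by blast
      then show ?thesis using J_le[of v] by (auto simp: K_def)
    qed
  qed
  then obtain t where t: "t \<in> unit_cube n" "\<forall>j\<le>n. \<exists>v\<in>\<V>. J v = j \<and> f t \<in> v"
    unfolding K_def by blast
  \<comment> \<open>Members with \<open>n + 1 = k + 2\<close> different labels contain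
    \<open>f t\<close>, one more than the order of the cover allows.\<close>
  have "{..n} \<subseteq> J ` {v \<in> \<V>. f t \<in> v}" using t(2) by force
  then have "card {..n} \<le> card {v \<in> \<V>. f t \<in> v}"
    using \<V>(4)[OF fM[OF t(1)]] by (meson card_image_le card_mono finite_imageI le_trans)
  then show False using \<V>(4)[OF fM[OF t(1)]] by (simp add: n_def)
qed

end

section \<open>Swaps and rotations of cylinders\<close>

definition pre :: "'a list \<Rightarrow> 'a stream \<Rightarrow> bool" where
  "pre w x \<longleftrightarrow> stake (length w) x = w"

lemma pre_altdef: "pre w x \<longleftrightarrow> (\<exists>u. x = w @- u)"
  unfolding pre_def by (metis append_Nil2 cancel_comm_monoid_add_class.diff_cancel stake.simps(1)
      stake_sdrop stake_shift take_all_iff order_refl)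

lemma pre_shiftI: "prefix w v \<Longrightarrow> pre w (v @- u)"
  unfolding pre_altdef prefix_def by auto

lemma pre_shift_self [simp]: "pre w (w @- u)"
  by (simp add: pre_shiftI)

lemma pre_prefix: "pre w x \<Longrightarrow> prefix v w \<Longrightarrow> pre v x"
  unfolding pre_altdef prefix_def by auto

lemma pre_stake: "pre w x \<Longrightarrow> length w \<le> n \<Longrightarrow> prefix w (stake n x)"
  unfolding pre_def by (metis min_absorb1 take_is_prefix take_stake)

lemma pre_comparable: "pre w x \<Longrightarrow> pre v x \<Longrightarrow> prefix w v \<or> prefix v w"
  using pre_stake[of w x "max (length w) (length v)"] pre_stake[of v x "max (length w) (length v)"]
  by (meson max.cobounded1 max.cobounded2 prefix_same_cases)

lemma parallel_not_pre [simp]: "w \<parallel> v \<Longrightarrow> \<not> pre w (v @- u)"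
  using pre_comparable pre_shift_self by blast

lemma pre_sdrop: "pre w x \<Longrightarrow> w @- sdrop (length w) x = x"
  unfolding pre_def by (metis stake_sdrop)

lemma sdrop_shift_self [simp]: "sdrop (length w) (w @- u) = u"
  by (simp add: sdrop_shift)

section \<open>Words over the alphabet and compactness\<close>

abbreviation word :: "nat \<Rightarrow> nat list \<Rightarrow> bool" where
  "word q w \<equiv> set w \<subseteq> {..<q}"

lemma cantor_shift [simp]: "w @- u \<in> cantor q \<longleftrightarrow> word q w \<and> u \<in> cantor q"
  by (simp add: cantor_def streams_iff_sset)

lemma cantor_SCons [simp]: "a ## u \<in> cantor q \<longleftrightarrow> a < q \<and> u \<in> cantor q"
  by (simp add: cantor_def streams_Stream)

lemma cantor_sconst [simp]: "sconst a \<in> cantor q \<longleftrightarrow> a < q"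
  by (simp add: cantor_def streams_iff_sset)

lemma cantor_sdrop: "x \<in> cantor q \<Longrightarrow> sdrop n x \<in> cantor q"
  by (simp add: cantor_def streams_iff_snth sdrop_snth)

lemma cantor_stake: "x \<in> cantor q \<Longrightarrow> word q (stake n x)"
  using cantor_shift[of "stake n x" "sdrop n x" q] by (simp add: stake_sdrop)

lemma cylinder_iff: "word q w \<Longrightarrow> x \<in> cylinder q w \<longleftrightarrow> x \<in> cantor q \<and> pre w x"
  unfolding cylinder_def pre_altdef by auto

text \<open>If \<open>z\<close> continued beyond \<open>y\<close>, its next letter would have to be
  the first letter of both constant tails 0 and 1. This is where two letters are needed.\<close>

lemma prefix_if_always_pre:
  assumes "2 \<le> q" "\<And>u. u \<in> cantor q \<Longrightarrow> pre z (y @- u)"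
  shows "prefix z y"
proof (rule ccontr)
  assume *: "\<not> prefix z y"
  have "pre z (y @- sconst a)" if "a < 2" for a using assms that by simp
  then have pre: "pre z (y @- sconst 0)" "pre z (y @- sconst 1)" by simp_all
  then have "prefix y z" using pre_comparable[OF pre(1), of y] * by simp
  then obtain s where s: "z = y @ s" unfolding prefix_def by blast
  then obtain c s' where "s = c # s'" using * by (cases s) auto
  then have "pre (c # s') (sconst 0)" "pre (c # s') (sconst 1)"
    using pre s by (auto simp: pre_altdef)
  then have "pre [c] (sconst 0)" "pre [c] (sconst 1)" by (auto elim: pre_prefix)
  then show False by (simp add: pre_def)
qed

text \<open>Koenig's lemma: if no uniform length existed, following bad letters would produce an
  infinite word without a good prefix.\<close>

lemma cantor_compactness:
  assumes ext: "\<And>w a. \<lbrakk>word q w; a < q; P w\<rbrakk> \<Longrightarrow> P (w @ [a])"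
    and local: "\<And>x. x \<in> cantor q \<Longrightarrow> \<exists>n. P (stake n x)"
  obtains N where "\<And>w. word q w \<Longrightarrow> N \<le> length w \<Longrightarrow> P w"
proof -
  have ext': "P (w @ v)" if "P w" "word q w" "word q v" for w v
    using that(3)
  proof (induction v rule: rev_induct)
    case (snoc a v)
    then show ?case using ext[of "w @ v" a] that by simp
  qed (use that in simp)
  \<comment> \<open>\<open>T w\<close> says that \<open>P\<close> holds at some uniform depth below
    \<open>w\<close>. Finitely many children with this property pass it on to their parent.\<close>
  define T where "T w \<longleftrightarrow> (\<exists>n. \<forall>v. word q v \<longrightarrow> length v = n \<longrightarrow> P (w @ v))" for w
  have T_step: "\<exists>a<q. \<not> T (w @ [a])" if "\<not> T w" "word q w" for w
  proof (rule ccontr)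
    assume "\<not> (\<exists>a<q. \<not> T (w @ [a]))"
    then obtain n where n: "\<And>a v. a < q \<Longrightarrow> word q v \<Longrightarrow> length v = n a \<Longrightarrow> P (w @ a # v)"
      unfolding T_def by auto metis
    have "P (w @ v)" if v: "word q v" "length v = Suc (Max (n ` {..<q}))" for v
    proof -
      obtain a v' where v': "v = a # v'" using v by (cases v) auto
      have "n a \<le> length v'" using v v' by simp
      then have "P (w @ a # take (n a) v')"
        using n[of a "take (n a) v'"] v v' set_take_subset[of "n a" v'] by auto
      then have "P ((w @ a # take (n a) v') @ drop (n a) v')"
        using \<open>word q w\<close> v v' set_take_subset[of "n a" v'] set_drop_subset[of "n a" v']
        by (intro ext'[of "w @ a # take (n a) v'" "drop (n a) v'"]) auto
      then show ?thesis by (simp add: v')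
    qed
    then show False using \<open>\<not> T w\<close> unfolding T_def by blast
  qed
  have "T []"
  proof (rule ccontr)
    assume "\<not> T []"
    define nxt where "nxt w = (SOME a. a < q \<and> \<not> T (w @ [a]))" for w
    have nxt: "nxt w < q \<and> \<not> T (w @ [nxt w])" if "\<not> T w" "word q w" for w
      unfolding nxt_def by (rule someI_ex) (use T_step[OF that] in blast)
    define b where "b = rec_nat [] (\<lambda>_ w. w @ [nxt w])"
    have b: "b 0 = []" "b (Suc n) = b n @ [nxt (b n)]" for n by (simp_all add: b_def)
    have bT: "word q (b n) \<and> \<not> T (b n)" for n
      by (induction n) (use nxt \<open>\<not> T []\<close> in \<open>auto simp: b\<close>)
    define x where "x = smap (\<lambda>n. nxt (b n)) nats"
    have "stake n x = b n" for n
    proof (induction n)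
      case (Suc n)
      have "stake (Suc n) x = stake n x @ [x !! n]"
        by (metis One_nat_def sdrop_simps(1) stake.simps stake_add Suc_eq_plus1)
      then show ?case using Suc by (simp add: b x_def)
    qed (simp add: b)
    moreover have "x \<in> cantor q"
      using nxt bT by (auto simp: x_def cantor_def streams_iff_snth)
    ultimately obtain n where "P (b n)" using local by metis
    then have "T (b n)" unfolding T_def by (intro exI[of _ 0]) simp
    then show False using bT by blast
  qed
  then obtain N where N: "\<And>v. word q v \<Longrightarrow> length v = N \<Longrightarrow> P v" unfolding T_def by auto
  show thesis
  proof
    fix w assume w: "word q w" "N \<le> length w"
    have "P (take N w @ drop N w)"
      using w N[of "take N w"] set_take_subset[of N w] set_drop_subset[of N w]
      by (intro ext') auto
    then show "P w" by simp
  qed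
qed

section \<open>Cone maps, swaps and rotations\<close>

definition acts :: "nat \<Rightarrow> (nat stream \<Rightarrow> nat stream) \<Rightarrow> nat list \<Rightarrow> nat list \<Rightarrow> (nat \<Rightarrow> nat) \<Rightarrow> bool" where
  "acts q f w w' \<sigma> \<longleftrightarrow> (\<forall>u\<in>cantor q. f (w @- u) = w' @- smap \<sigma> u)"

definition moves :: "nat \<Rightarrow> (nat stream \<Rightarrow> nat stream) \<Rightarrow> nat list \<Rightarrow> nat list \<Rightarrow> bool" where
  "moves q f w w' \<longleftrightarrow> (\<forall>u\<in>cantor q. f (w @- u) = w' @- u)"

lemma moves_append: "moves q f w w' \<Longrightarrow> word q v \<Longrightarrow> moves q f (w @ v) (w' @ v)"
  by (simp add: moves_def)

lemma acts_append: "acts q f w w' \<sigma> \<Longrightarrow> word q v \<Longrightarrow> acts q f (w @ v) (w' @ map \<sigma> v) \<sigma>"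
  by (simp add: acts_def)

definition swap :: "nat \<Rightarrow> nat list \<Rightarrow> nat list \<Rightarrow> nat stream \<Rightarrow> nat stream" where
  "swap q w w' = (\<lambda>x\<in>cantor q. if pre w x then w' @- sdrop (length w) x
     else if pre w' x then w @- sdrop (length w') x else x)"

definition rot :: "nat \<Rightarrow> nat list \<Rightarrow> (nat \<Rightarrow> nat) \<Rightarrow> nat stream \<Rightarrow> nat stream" where
  "rot q w \<sigma> = (\<lambda>x\<in>cantor q. if pre w x then w @- smap \<sigma> (sdrop (length w) x) else x)"

lemma swap_left: "word q w \<Longrightarrow> moves q (swap q w w') w w'"
  by (simp add: swap_def moves_def)

lemma swap_right: "word q w' \<Longrightarrow> w \<parallel> w' \<Longrightarrow> moves q (swap q w w') w' w"
  by (simp add: swap_def moves_def)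

lemma swap_other: "x \<in> cantor q \<Longrightarrow> \<not> pre w x \<Longrightarrow> \<not> pre w' x \<Longrightarrow> swap q w w' x = x"
  by (simp add: swap_def)

text \<open>Thanks to this degenerate case, the generation argument can swap an image word with its
  target even when the two coincide.\<close>

lemma swap_self: "swap q w w = (\<lambda>x\<in>cantor q. x)"
  by (auto simp: swap_def pre_sdrop)

lemma rot_shift: "u \<in> cantor q \<Longrightarrow> word q w \<Longrightarrow> rot q w \<sigma> (w @- u) = w @- smap \<sigma> u"
  by (simp add: rot_def)

lemma rot_other: "x \<in> cantor q \<Longrightarrow> \<not> pre w x \<Longrightarrow> rot q w \<sigma> x = x"
  by (simp add: rot_def)

lemma cone_cases:
  assumes "x \<in> cantor q"
  obtains u where "x = w @- u" "u \<in> cantor q" "word q w" | "\<not> pre w x"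
proof (cases "pre w x")
  case True
  then have "x = w @- sdrop (length w) x" by (simp add: pre_sdrop)
  then show ?thesis using that(1)[of "sdrop (length w) x"] assms cantor_shift by metis
qed (use that in blast)

lemma swap_in: "word q w \<Longrightarrow> word q w' \<Longrightarrow> x \<in> cantor q \<Longrightarrow> swap q w w' x \<in> cantor q"
  by (auto simp: swap_def cantor_sdrop)

lemma swap_swap:
  assumes w: "word q w" "word q w'" "w \<parallel> w'" and x: "x \<in> cantor q"
  shows "swap q w w' (swap q w w' x) = x"
  using x
proof (cases rule: cone_cases[of x q w])
  case (1 u)
  then show ?thesis using swap_left[OF w(1)] swap_right[OF w(2,3)] by (simp add: moves_def)
next
  case 2
  from x show ?thesis
  proof (cases rule: cone_cases[of x q w'])
    case (1 u)
    then show ?thesis using swap_left[OF w(1)] swap_right[OF w(2,3)] by (simp add: moves_def)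
  next
    case 2
    then show ?thesis using \<open>\<not> pre w x\<close> x by (simp add: swap_other)
  qed
qed

lemma swap_commute:
  assumes w: "word q w" "word q w'" "w \<parallel> w'"
  shows "swap q w w' = swap q w' w"
proof
  fix x
  have "\<not> (pre w x \<and> pre w' x)" using pre_comparable w(3) by blast
  then show "swap q w w' x = swap q w' w x" by (auto simp: swap_def)
qed

lemma Bij_if_involution:
  assumes "f \<in> extensional S" "\<And>x. x \<in> S \<Longrightarrow> f x \<in> S" "\<And>x. x \<in> S \<Longrightarrow> f (f x) = x"
  shows "f \<in> Bij S"
  unfolding Bij_def using assms by (auto intro!: bij_betw_byWitness[where f'=f])

lemma swap_Bij:
  assumes "word q w" "word q w'" "w \<parallel> w'"
  shows "swap q w w' \<in> Bij (cantor q)"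
proof (rule Bij_if_involution)
  show "swap q w w' \<in> extensional (cantor q)" by (auto simp: swap_def)
qed (use assms swap_in swap_swap in auto)

lemma Bij_ext:
  assumes "f \<in> Bij S" "g \<in> Bij S" "\<And>x. x \<in> S \<Longrightarrow> f x = g x"
  shows "f = g"
  using assms by (auto intro: extensionalityI simp: Bij_def)

lemma Bij_in: "f \<in> Bij S \<Longrightarrow> x \<in> S \<Longrightarrow> f x \<in> S"
  by (auto simp: Bij_def dest: bij_betwE)

lemma Bij_inj: "f \<in> Bij S \<Longrightarrow> x \<in> S \<Longrightarrow> y \<in> S \<Longrightarrow> f x = f y \<Longrightarrow> x = y"
  by (auto simp: Bij_def bij_betw_def dest: inj_onD)

lemma Bij_surj: "f \<in> Bij S \<Longrightarrow> y \<in> S \<Longrightarrow> \<exists>x\<in>S. f x = y"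
  unfolding Bij_def bij_betw_def by (metis (mono_tags, lifting) Int_iff imageE mem_Collect_eq)

text \<open>Injectivity keeps moved points inside their region: if \<open>f x\<close> left it,
  \<open>f\<close> would fix \<open>f x\<close>, and then \<open>f x = x\<close>.\<close>

lemma compose_commute_disjoint_support:
  assumes "f \<in> Bij S" "g \<in> Bij S"
    and f: "\<And>x. x \<in> S \<Longrightarrow> \<not> P x \<Longrightarrow> f x = x" and g: "\<And>x. x \<in> S \<Longrightarrow> P x \<Longrightarrow> g x = x"
  shows "compose S f g = compose S g f"
proof (rule Bij_ext)
  fix x assume x: "x \<in> S"
  have "f (g x) = g (f x)"
  proof (cases "P x")
    case True
    have "P (f x) \<or> f x = x" using f Bij_inj[OF assms(1)] Bij_in[OF assms(1)] x by blast
    then show ?thesis using True g Bij_in[OF assms(1) x] x by auto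
  next
    case False
    have "\<not> P (g x) \<or> g x = x" using g Bij_inj[OF assms(2)] Bij_in[OF assms(2)] x by blast
    then show ?thesis using False f Bij_in[OF assms(2) x] x by auto
  qed
  then show "compose S f g x = compose S g f x" using x by (simp add: compose_def)
qed (auto intro!: compose_Bij assms)

text \<open>Only points outside both cones need thought: \<open>h\<close> maps each cone onto its
  image cone, so by injectivity such points stay outside the images. Writing the conjugation as an
  equation of composites avoids an inverse of \<open>h\<close>.\<close>

lemma compose_swap_conj:
  assumes h: "h \<in> Bij (cantor q)" "moves q h w a" "moves q h w' b"
    and w: "word q w" "word q w'" "w \<parallel> w'" and a: "word q a" "word q b" "a \<parallel> b"
  shows "compose (cantor q) h (swap q w w') = compose (cantor q) (swap q a b) h"
proof (rule Bij_ext)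
  fix x assume x: "x \<in> cantor q"
  have "h (swap q w w' x) = swap q a b (h x)"
    using x
  proof (cases rule: cone_cases[of x q w])
    case (1 u)
    then show ?thesis using swap_left[OF w(1)] swap_left[OF a(1)] h by (simp add: moves_def)
  next
    case 2
    note nw = 2
    from x show ?thesis
    proof (cases rule: cone_cases[of x q w'])
      case (1 u)
      then show ?thesis using swap_right[OF w(2,3)] swap_right[OF a(2,3)] h by (simp add: moves_def)
    next
      case 2
      have "\<not> pre c (h x)" if "moves q h y c" "\<not> pre y x" "word q y" for y c
      proof
        assume "pre c (h x)"
        then obtain u where u: "h x = c @- u" by (auto simp: pre_altdef)
        then have "u \<in> cantor q" using Bij_in[OF h(1) x] by simp
        then have "h x = h (y @- u)" using that u by (simp add: moves_def)
        then have "x = y @- u" using Bij_inj[OF h(1) x, of "y @- u"] \<open>u \<in> cantor q\<close> that by simp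
        then show False using that by simp
      qed
      then show ?thesis using 2 nw h w x Bij_in[OF h(1) x] by (simp add: swap_other)
    qed
  qed
  then show "compose (cantor q) h (swap q w w') x = compose (cantor q) (swap q a b) h x"
    using x by (simp add: compose_def)
qed (auto intro!: compose_Bij swap_Bij assms)

lemma swap_eq_conj:
  assumes "word q p" "word q p'" "p \<parallel> p'" "word q w" "word q w'" "w \<parallel> w'"
    "word q a" "word q b" "a \<parallel> b"
    "moves q (swap q p p') w a" "moves q (swap q p p') w' b"
  shows "swap q w w' = compose (cantor q) (swap q p p') (compose (cantor q) (swap q a b) (swap q p p'))"
proof (rule Bij_ext)
  let ?s = "swap q p p'"
  fix x assume x: "x \<in> cantor q"
  have "?s (swap q w w' x) = swap q a b (?s x)"
    using fun_cong[OF compose_swap_conj[of ?s q w a w' b], of x] assms x swap_Bij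
    by (simp add: compose_def)
  then have "swap q w w' x = ?s (swap q a b (?s x))"
    using swap_swap[OF assms(1-3), of "swap q w w' x"] swap_in[OF assms(4,5) x] by simp
  then show "swap q w w' x = compose (cantor q) ?s (compose (cantor q) (swap q a b) ?s) x"
    using x by (simp add: compose_def)
qed (use assms in \<open>auto intro!: compose_Bij swap_Bij\<close>)

text \<open>One letter would not do: for q = 2 the words \<open>a\<close> and \<open>b\<close> may
  begin with the two different letters. Either the word branching off \<open>a\<close> after its
  first letter is incomparable with \<open>b\<close>, or \<open>b\<close> runs through it and any
  other first letter is free.\<close>

lemma exists_parallel_word2:
  assumes "2 \<le> q" "a \<parallel> b" "word q a" "word q b" "2 \<le> length a"
  obtains p where "word q p" "length p = 2" "p \<parallel> a" "p \<parallel> b"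
proof -
  obtain a0 a1 as where a: "a = a0 # a1 # as"
    using assms(5) by (cases a; cases "tl a") auto
  define e where "e = (if a1 = 0 then 1 else 0::nat)"
  define e' where "e' = (if a0 = 0 then 1 else 0::nat)"
  have e: "e \<noteq> a1" "e < q" "e' \<noteq> a0" "e' < q" "a0 < q" using assms a by (auto simp: e_def e'_def)
  show thesis
  proof (cases "[a0, e] \<parallel> b")
    case True
    then show ?thesis using that[of "[a0, e]"] e by (auto simp: a parallel_def)
  next
    case False
    have "prefix [a0, e] b \<or> prefix b [a0, e]" using False by blast
    moreover have "b \<noteq> [a0]" "b \<noteq> []" using assms(2) a by auto
    ultimately have "prefix [a0, e] b" by (auto simp: prefix_Cons)
    then have "[e', 0] \<parallel> b" using e by (auto simp: prefix_def)
    then show ?thesis using that[of "[e', 0]"] e by (auto simp: a parallel_def)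
  qed
qed

section \<open>Generation of local subgroups\<close>

text \<open>The analogue of \<open>division\<close> inside one cylinder, taken as a set of pairwise
  incomparable words so that an induction can run on its cardinality.\<close>

definition partition_below :: "nat \<Rightarrow> nat list \<Rightarrow> nat list set \<Rightarrow> bool" where
  "partition_below q z D \<longleftrightarrow> finite D \<and> (\<forall>w\<in>D. word q w \<and> prefix z w) \<and>
     (\<forall>w\<in>D. \<forall>w'\<in>D. w \<noteq> w' \<longrightarrow> w \<parallel> w') \<and> (\<forall>x\<in>cantor q. pre z x \<longrightarrow> (\<exists>w\<in>D. pre w x))"

text \<open>Take the parent of a longest word. The word covering another child cannot be a prefix of
  the parent, as it would be comparable with the longest word, nor can it be longer than that
  child.\<close>

lemma partition_below_caret:
  assumes D: "partition_below q z D" and "z \<notin> D" "word q z" "2 \<le> q"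
  obtains p where "prefix z p" "word q p" "\<And>b. b < q \<Longrightarrow> p @ [b] \<in> D"
proof -
  have fin: "finite D" and ext: "\<And>w. w \<in> D \<Longrightarrow> word q w \<and> prefix z w"
    and anti: "\<And>w w'. w \<in> D \<Longrightarrow> w' \<in> D \<Longrightarrow> w \<noteq> w' \<Longrightarrow> w \<parallel> w'"
    and cov: "\<And>x. x \<in> cantor q \<Longrightarrow> pre z x \<Longrightarrow> \<exists>w\<in>D. pre w x"
    using D by (auto simp: partition_below_def)
  have "z @- sconst 0 \<in> cantor q" using assms by simp
  then have "D \<noteq> {}" using cov pre_shift_self by blast
  define m where "m = Max (length ` D)"
  have "m \<in> length ` D" unfolding m_def using fin \<open>D \<noteq> {}\<close> by (intro Max_in) auto
  then obtain w where w: "w \<in> D" "length w = m" by blast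
  have max: "length v \<le> m" if "v \<in> D" for v unfolding m_def using fin that by simp
  obtain s where "w = z @ s" using ext[OF w(1)] by (auto simp: prefix_def)
  then have "s \<noteq> []" using w(1) assms(2) by auto
  then obtain p a where pa: "w = p @ [a]" "prefix z p"
    using \<open>w = z @ s\<close> by (metis append_assoc append_butlast_last_id prefixI)
  show thesis
  proof
    show "prefix z p" by fact
    show pw: "word q p" using ext[OF w(1)] pa by simp
    fix b assume b: "b < q"
    define x where "x = (p @ [b]) @- sconst 0"
    have "x \<in> cantor q" using pw b assms by (simp add: x_def)
    moreover have "pre z x" unfolding x_def using pa(2) by (intro pre_shiftI) auto
    ultimately obtain v where v: "v \<in> D" "pre v x" using cov by blast
    have "prefix v (p @ [b]) \<or> prefix (p @ [b]) v"
      using pre_comparable[OF v(2), of "p @ [b]"] by (simp only: x_def pre_shift_self)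
    moreover have "\<not> prefix v p"
    proof
      assume "prefix v p"
      then have "prefix v w" using pa by simp
      then have "v = w" using anti[OF v(1) w(1)] by blast
      then show False using \<open>prefix v p\<close> pa by simp
    qed
    moreover have "length v \<le> length (p @ [b])" using max[OF v(1)] w pa by simp
    ultimately have "v = p @ [b]"
      by (metis append_eq_conv_conj prefix_def prefix_length_le prefix_snoc take_all_iff)
    then show "p @ [b] \<in> D" using v by simp
  qed
qed

locale label_group =
  fixes q :: nat and G :: "(nat \<Rightarrow> nat) set"
  assumes q: "2 \<le> q" and G: "subgroup G (BijGroup {..<q})"
begin

abbreviation "C \<equiv> cantor q"

lemma G_Bij: "\<sigma> \<in> G \<Longrightarrow> \<sigma> \<in> Bij {..<q}"
  using subgroup.subset[OF G] by (auto simp: BijGroup_def)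

lemma finite_G: "finite G"
proof (rule finite_subset)
  show "G \<subseteq> {..<q} \<rightarrow>\<^sub>E {..<q}"
    using G_Bij by (auto simp: PiE_def Bij_imp_extensional dest: Bij_imp_funcset)
qed (simp add: finite_PiE)

lemma label_less: "\<sigma> \<in> G \<Longrightarrow> a < q \<Longrightarrow> \<sigma> a < q"
  using Bij_in[OF G_Bij] by simp

lemma label_in [simp]: "\<sigma> \<in> G \<Longrightarrow> u \<in> C \<Longrightarrow> smap \<sigma> u \<in> C"
  using label_less by (auto simp: cantor_def intro: smap_streams)

lemma smap_cong_cantor: "(\<And>a. a < q \<Longrightarrow> \<sigma> a = \<tau> a) \<Longrightarrow> u \<in> C \<Longrightarrow> smap \<sigma> u = smap \<tau> u"
  by (auto simp: cantor_def streams_iff_sset intro!: stream.map_cong)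

definition label_id :: "nat \<Rightarrow> nat" where
  "label_id = (\<lambda>a\<in>{..<q}. a)"

lemma label_id: "label_id \<in> G" "u \<in> C \<Longrightarrow> smap label_id u = u"
  using subgroup.one_closed[OF G] smap_cong_cantor[of label_id id u]
  by (auto simp: label_id_def BijGroup_def stream.map_id)

lemma label_compose:
  assumes "\<sigma> \<in> G" "\<tau> \<in> G"
  obtains \<rho> where "\<rho> \<in> G" "\<And>u. u \<in> C \<Longrightarrow> smap \<rho> u = smap \<sigma> (smap \<tau> u)"
proof
  show "compose {..<q} \<sigma> \<tau> \<in> G"
    using subgroup.m_closed[OF G assms] assms G_Bij by (simp add: BijGroup_def)
  show "smap (compose {..<q} \<sigma> \<tau>) u = smap \<sigma> (smap \<tau> u)" if "u \<in> C" for u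
    using smap_cong_cantor[OF _ that, of "compose {..<q} \<sigma> \<tau>" "\<sigma> \<circ> \<tau>"]
    by (simp add: compose_def stream.map_comp)
qed

lemma label_inverse:
  assumes "\<sigma> \<in> G"
  obtains \<tau> where "\<tau> \<in> G" "\<And>u. u \<in> C \<Longrightarrow> smap \<tau> (smap \<sigma> u) = u"
    "\<And>u. u \<in> C \<Longrightarrow> smap \<sigma> (smap \<tau> u) = u"
proof
  define \<tau> where "\<tau> = (\<lambda>a\<in>{..<q}. inv_into {..<q} \<sigma> a)"
  show "\<tau> \<in> G"
    using subgroup.m_inv_closed[OF G assms] inv_BijGroup[OF G_Bij[OF assms]] by (simp add: \<tau>_def)
  have bij: "bij_betw \<sigma> {..<q} {..<q}" using G_Bij[OF assms] by (simp add: Bij_def)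
  show "smap \<tau> (smap \<sigma> u) = u" if "u \<in> C" for u
    using smap_cong_cantor[OF _ that, of "\<tau> \<circ> \<sigma>" id] bij label_less[OF assms]
    by (simp add: \<tau>_def stream.map_comp stream.map_id bij_betw_inv_into_left)
  show "smap \<sigma> (smap \<tau> u) = u" if "u \<in> C" for u
    using smap_cong_cantor[OF _ that, of "\<sigma> \<circ> \<tau>" id] bij
    by (simp add: \<tau>_def stream.map_comp stream.map_id bij_betw_inv_into_right)
qed

lemma rot_Bij:
  assumes "\<sigma> \<in> G" "word q w"
  shows "rot q w \<sigma> \<in> Bij C"
proof -
  obtain \<tau> where \<tau>: "\<tau> \<in> G" "\<And>u. u \<in> C \<Longrightarrow> smap \<tau> (smap \<sigma> u) = u"
    "\<And>u. u \<in> C \<Longrightarrow> smap \<sigma> (smap \<tau> u) = u"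
    using label_inverse[OF assms(1)] by blast
  have in_C: "rot q w \<rho> x \<in> C" if "\<rho> \<in> G" "x \<in> C" for \<rho> x
    using that assms by (auto simp: rot_def cantor_sdrop)
  have inv: "rot q w \<rho> (rot q w \<rho>' x) = x"
    if "\<rho> \<in> G" "\<rho>' \<in> G" "\<And>u. u \<in> C \<Longrightarrow> smap \<rho> (smap \<rho>' u) = u" "x \<in> C" for \<rho> \<rho>' x
    using that(4)
  proof (cases rule: cone_cases[of x q w])
    case (1 u)
    then show ?thesis using that by (simp add: rot_shift)
  qed (use that in \<open>simp add: rot_other\<close>)
  have "bij_betw (rot q w \<sigma>) C C"
    by (rule bij_betw_byWitness[where f' = "rot q w \<tau>"]) (use in_C inv assms \<tau> in auto)
  then show ?thesis by (simp add: Bij_def rot_def)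
qed

text \<open>Moves a rotation at a deep word to a fixed shallow one, so that finitely many rotations
  suffice as generators.\<close>

lemma rot_eq_swap_conj:
  assumes "word q w" "word q v" "w \<parallel> v" "\<sigma> \<in> G"
  shows "rot q w \<sigma> = compose C (swap q v w) (compose C (rot q v \<sigma>) (swap q v w))"
proof (rule Bij_ext)
  have vw: "v \<parallel> w" using assms(3) by (simp add: parallel_commute)
  note mv = swap_left[OF assms(2), of w] swap_right[OF assms(1) vw]
  fix x assume x: "x \<in> C"
  have "rot q w \<sigma> x = swap q v w (rot q v \<sigma> (swap q v w x))"
    using x
  proof (cases rule: cone_cases[of x q w])
    case (1 u)
    then show ?thesis using mv assms by (simp add: moves_def rot_shift)
  next
    case 2
    note nw = 2
    from x show ?thesis
    proof (cases rule: cone_cases[of x q v])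
      case (1 u)
      then show ?thesis using mv assms vw x by (simp add: moves_def rot_other)
    qed (use nw x in \<open>simp add: rot_other swap_other\<close>)
  qed
  then show "rot q w \<sigma> x = compose C (swap q v w) (compose C (rot q v \<sigma>) (swap q v w)) x"
    using x by (simp add: compose_def)
qed (use assms in \<open>auto intro!: compose_Bij swap_Bij rot_Bij simp: parallel_commute\<close>)

text \<open>In the step, the images of the words in a partition form a partition as well, and both
  contain a full set of siblings. Composing with swaps and rotations moves the one set to the other,
  which lets us replace the siblings in the partition by their parent.\<close>

lemma partition_generation:
  assumes comp: "\<And>f g. f \<in> K \<Longrightarrow> g \<in> K \<Longrightarrow> compose C f g \<in> K"
    and swaps: "\<And>w w'. \<lbrakk>word q w; word q w'; prefix z w; prefix z w'; w \<parallel> w'\<rbrakk> \<Longrightarrow> swap q w w' \<in> K"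
    and rots: "\<And>w \<sigma>. \<lbrakk>word q w; prefix z w; \<sigma> \<in> G\<rbrakk> \<Longrightarrow> rot q w \<sigma> \<in> K"
    and z: "word q z"
    and "partition_below q z D" "f \<in> Bij C" "\<And>x. x \<in> C \<Longrightarrow> \<not> pre z x \<Longrightarrow> f x = x"
    and "\<And>w. w \<in> D \<Longrightarrow> \<exists>w' \<sigma>. word q w' \<and> \<sigma> \<in> G \<and> acts q f w w' \<sigma>"
  shows "f \<in> K"
  using assms(5-8)
proof (induction "card D" arbitrary: D f rule: less_induct)
  case less
  note D = less.prems(1) and f = less.prems(2) and supp = less.prems(3)
  have fin: "finite D" and ext: "\<And>w. w \<in> D \<Longrightarrow> word q w \<and> prefix z w"
    and anti: "\<And>w w'. w \<in> D \<Longrightarrow> w' \<in> D \<Longrightarrow> w \<noteq> w' \<Longrightarrow> w \<parallel> w'"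
    and cov: "\<And>x. x \<in> C \<Longrightarrow> pre z x \<Longrightarrow> \<exists>w\<in>D. pre w x"
    using D by (auto simp: partition_below_def)
  have below: "pre z (f x)" if "x \<in> C" "pre z x" for x
    using that supp Bij_inj[OF f Bij_in[OF f that(1)] that(1)] Bij_in[OF f that(1)] by metis
  obtain img lab where il: "\<And>w. w \<in> D \<Longrightarrow> word q (img w) \<and> lab w \<in> G \<and> acts q f w (img w) (lab w)"
    using less.prems(4) by metis
  have img_onto: "\<exists>u\<in>C. f (w @- u) = img w @- v" if w: "w \<in> D" "v \<in> C" for w v
  proof -
    obtain \<tau> where "\<tau> \<in> G" "smap (lab w) (smap \<tau> v) = v"
      using label_inverse[of "lab w"] il[OF w(1)] w(2) by metis
    then show ?thesis using il[OF w(1)] w(2) by (intro bexI[of _ "smap \<tau> v"]) (simp_all add: acts_def)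
  qed
  have img_prefix: "prefix z (img w)" if w: "w \<in> D" for w
  proof (rule prefix_if_always_pre[OF q])
    fix v assume "v \<in> C"
    then obtain u where u: "u \<in> C" "f (w @- u) = img w @- v" using img_onto[OF w] by blast
    have "pre z (f (w @- u))" using below[of "w @- u"] ext[OF w] u by (simp add: pre_shiftI)
    then show "pre z (img w @- v)" using u by simp
  qed
  have pre_inv: "pre w x" if w: "w \<in> D" "x \<in> C" "pre (img w) (f x)" for w x
  proof -
    obtain v where v: "f x = img w @- v" using w(3) by (auto simp: pre_altdef)
    then have "v \<in> C" using Bij_in[OF f w(2)] by simp
    then obtain u where u: "u \<in> C" "f (w @- u) = f x" using img_onto[OF w(1)] v by metis
    then have "w @- u = x" using Bij_inj[OF f _ w(2) u(2)] ext[OF w(1)] by simp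
    then show ?thesis by auto
  qed
  have img_word: "word q (img w)" if "w \<in> D" for w using il that by blast
  have img_parallel: "img w \<parallel> img w'" if "w \<in> D" "w' \<in> D" "w \<noteq> w'" for w w'
  proof -
    have np: "\<not> prefix (img v) (img v')" if "v \<in> D" "v' \<in> D" "v \<noteq> v'" for v v'
    proof
      assume pr: "prefix (img v) (img v')"
      define x where "x = v' @- sconst 0"
      have x: "x \<in> C" using ext[OF that(2)] q by (simp add: x_def)
      have "f x = img v' @- smap (lab v') (sconst 0)"
        using il[OF that(2)] q by (simp add: acts_def x_def)
      then have "pre (img v) (f x)" using pr by (simp add: pre_shiftI)
      then have "pre v x" by (rule pre_inv[OF that(1) x])
      then show False using anti[OF that] by (simp add: x_def)
    qed
    then show ?thesis using that by blast
  qed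
  have inj: "inj_on img D"
  proof (rule inj_onI, rule ccontr)
    fix w w' assume "w \<in> D" "w' \<in> D" "img w = img w'" "w \<noteq> w'"
    then show False using img_parallel[of w w'] by auto
  qed
  have D': "partition_below q z (img ` D)"
    unfolding partition_below_def
  proof (intro conjI ballI impI)
    show "finite (img ` D)" using fin by simp
    show "word q w" "prefix z w" if "w \<in> img ` D" for w using that img_word img_prefix by auto
    show "w \<parallel> w'" if "w \<in> img ` D" "w' \<in> img ` D" "w \<noteq> w'" for w w'
      using that img_parallel by auto
    fix y assume y: "y \<in> C" "pre z y"
    obtain x where x: "x \<in> C" "f x = y" using Bij_surj[OF f y(1)] by blast
    then have "pre z x" using supp y by metis
    then obtain w where w: "w \<in> D" "pre w x" using cov x by blast
    then obtain u where "x = w @- u" by (auto simp: pre_altdef)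
    then have "y = img w @- smap (lab w) u" using il[OF w(1)] x by (simp add: acts_def)
    then have "pre (img w) y" by simp
    then show "\<exists>w\<in>img ` D. pre w y" using w(1) by blast
  qed
  show "f \<in> K"
  proof (cases "z \<in> D")
    case True
    \<comment> \<open>A partition containing its root is trivial, and so is its image;
      \<open>f\<close> is then a single rotation at \<open>z\<close>.\<close>
    have Dz: "D = {z}" using True ext anti by fastforce
    then have "prefix (img z) z"
    proof (intro prefix_if_always_pre[OF q])
      fix u assume "u \<in> C"
      moreover have "partition_below q z {img z}" using D' Dz by simp
      ultimately show "pre (img z) (z @- u)" using z by (auto simp: partition_below_def)
    qed
    then have "img z = z" using img_prefix[OF True] by (simp add: prefix_order.antisym)
    then have "acts q f z z (lab z)" using il[OF True] by simp
    have "f = rot q z (lab z)"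
    proof (rule Bij_ext[OF f])
      show "rot q z (lab z) \<in> Bij C" using rot_Bij il[OF True] z by blast
      fix x assume x: "x \<in> C"
      then show "f x = rot q z (lab z) x"
      proof (cases rule: cone_cases[of x q z])
        case (1 u)
        then show ?thesis using \<open>acts q f z z (lab z)\<close> by (simp add: acts_def rot_shift)
      qed (use supp x in \<open>simp add: rot_other\<close>)
    qed
    then show ?thesis using rots[OF z] il[OF True] by simp
  next
    case False
    obtain p where p: "prefix z p" "word q p" "\<And>b. b < q \<Longrightarrow> p @ [b] \<in> D"
      using partition_below_caret[OF D False z q] by blast
    \<comment> \<open>If \<open>z\<close> were the image of \<open>w\<close>, all of I(z) would come
      from I(w), which makes \<open>w\<close> equal to \<open>z\<close>. So the image partition has
      a full set of siblings too.\<close>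
    have "z \<notin> img ` D"
    proof
      assume "z \<in> img ` D"
      then obtain w where w: "w \<in> D" "img w = z" by blast
      have "prefix w z"
      proof (rule prefix_if_always_pre[OF q])
        fix u assume "u \<in> C"
        then have "z @- u \<in> C" "pre z (z @- u)" using z by simp_all
        then show "pre w (z @- u)" using pre_inv[OF w(1)] below w(2) by metis
      qed
      then have "w = z" using ext[OF w(1)] by (simp add: prefix_order.antisym)
      then show False using w False by simp
    qed
    then obtain r where r: "prefix z r" "word q r" "\<And>b. b < q \<Longrightarrow> r @ [b] \<in> img ` D"
      using partition_below_caret[OF D' _ z q] by blast
    \<comment> \<open>Inner induction on the number \<open>b\<close> of siblings already matched:
      \<open>g\<close> is \<open>f\<close> corrected on the left by swaps and rotations, and \<pi>
      records the image word of each word of \<open>D\<close> under \<open>g\<close>. The set of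
      image words never changes, so the target siblings stay available.\<close>
    have "\<exists>g \<pi>. g \<in> Bij C \<and> (\<forall>x\<in>C. \<not> pre z x \<longrightarrow> g x = x) \<and> (g \<in> K \<longrightarrow> f \<in> K) \<and>
        bij_betw \<pi> D (img ` D) \<and> (\<forall>w\<in>D. \<exists>\<sigma>\<in>G. acts q g w (\<pi> w) \<sigma>) \<and>
        (\<forall>c<b. \<pi> (p @ [c]) = r @ [c] \<and> moves q g (p @ [c]) (r @ [c]))" if "b \<le> q" for b
      using that
    proof (induction b)
      case 0
      then show ?case
        using f supp il inj by (intro exI[of _ f] exI[of _ img]) (auto simp: bij_betw_def)
    next
      case (Suc b)
      then have "b \<le> q" by simp
      then obtain g \<pi> where "g \<in> Bij C" "\<forall>x\<in>C. \<not> pre z x \<longrightarrow> g x = x" "g \<in> K \<longrightarrow> f \<in> K"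
        "bij_betw \<pi> D (img ` D)" "\<forall>w\<in>D. \<exists>\<sigma>\<in>G. acts q g w (\<pi> w) \<sigma>"
        "\<forall>c<b. \<pi> (p @ [c]) = r @ [c] \<and> moves q g (p @ [c]) (r @ [c])"
        using Suc.IH by (elim exE conjE meta_impE)
      then have g: "g \<in> Bij C" "\<And>x. x \<in> C \<Longrightarrow> \<not> pre z x \<Longrightarrow> g x = x" "g \<in> K \<Longrightarrow> f \<in> K"
        and \<pi>: "bij_betw \<pi> D (img ` D)" "\<And>w. w \<in> D \<Longrightarrow> \<exists>\<sigma>\<in>G. acts q g w (\<pi> w) \<sigma>"
        and pr: "\<And>c. c < b \<Longrightarrow> \<pi> (p @ [c]) = r @ [c] \<and> moves q g (p @ [c]) (r @ [c])"
        by blast+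
      have b: "b < q" using Suc by simp
      define w where "w = \<pi> (p @ [b])"
      define t where "t = r @ [b]"
      have pD: "p @ [b] \<in> D" using p b by simp
      have tD: "t \<in> img ` D" using r b by (simp add: t_def)
      have wD: "w \<in> img ` D" using \<pi>(1) pD by (auto simp: w_def bij_betw_def)
      have im: "word q v \<and> prefix z v" if "v \<in> img ` D" for v
        using that img_word img_prefix by auto
      have par: "v \<parallel> v'" if "v \<in> img ` D" "v' \<in> img ` D" "v \<noteq> v'" for v v'
        using that img_parallel by auto
      obtain \<sigma> where \<sigma>: "\<sigma> \<in> G" "acts q g (p @ [b]) w \<sigma>" using \<pi>(2)[OF pD] by (auto simp: w_def)
      obtain \<tau> where \<tau>: "\<tau> \<in> G" "\<And>u. u \<in> C \<Longrightarrow> smap \<tau> (smap \<sigma> u) = u"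
        "\<And>u. u \<in> C \<Longrightarrow> smap \<sigma> (smap \<tau> u) = u"
        using label_inverse[OF \<sigma>(1)] by metis
      \<comment> \<open>First \<rho> cancels the label of \<open>g\<close> on the current sibling,
        then \<open>s\<close> exchanges its image word \<open>w\<close> with the wanted word
        \<open>t\<close>.\<close>
      define s where "s = swap q w t"
      define \<rho> where "\<rho> = rot q w \<tau>"
      define g' where "g' = compose C s (compose C \<rho> g)"
      define \<pi>' where "\<pi>' = Transposition.transpose w t \<circ> \<pi>"
      have s_K: "s \<in> K"
      proof (cases "w = t")
        case True
        \<comment> \<open>\<open>K\<close> is only known to be closed under composition; the
          identity belongs to it as the rotation with identity label.\<close>
        have "rot q z label_id = (\<lambda>x\<in>C. x)"
          by (auto simp: rot_def label_id cantor_sdrop pre_sdrop)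
        then show ?thesis using rots[OF z _ label_id(1)] True by (simp add: s_def swap_self)
      next
        case False
        then show ?thesis unfolding s_def using swaps im wD tD par by blast
      qed
      have s_Bij: "s \<in> Bij C"
        using swap_Bij[of w q t] im wD tD par by (cases "w = t") (auto simp: s_def swap_self id_Bij)
      have s_s: "s (s x) = x" if "x \<in> C" for x
        using swap_swap[of w q t x] im wD tD par that by (cases "w = t") (auto simp: s_def swap_self)
      have \<rho>_K: "\<rho> \<in> K" unfolding \<rho>_def using rots im wD \<tau>(1) by blast
      have \<rho>_Bij: "\<rho> \<in> Bij C" unfolding \<rho>_def using rot_Bij[OF \<tau>(1)] im wD by blast
      \<comment> \<open>No inverses are available in \<open>K\<close> in general, so \<rho> is
        undone by the explicit rotation with the original label \<sigma>. The swap \<open>s\<close>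
        undoes itself.\<close>
      define \<rho>' where "\<rho>' = rot q w \<sigma>"
      have \<rho>'_K: "\<rho>' \<in> K" unfolding \<rho>'_def using rots im wD \<sigma>(1) by blast
      have \<rho>'_\<rho>: "\<rho>' (\<rho> x) = x" if "x \<in> C" for x
        using that
      proof (cases rule: cone_cases[of x q w])
        case (1 u)
        then show ?thesis using im[OF wD] \<tau> by (simp add: \<rho>_def \<rho>'_def rot_shift)
      qed (use that in \<open>simp add: \<rho>_def \<rho>'_def rot_other\<close>)
      have g'_Bij: "g' \<in> Bij C" unfolding g'_def by (intro compose_Bij s_Bij \<rho>_Bij g(1))
      have g'_eq: "g' x = s (\<rho> (g x))" if "x \<in> C" for x
        using that by (simp add: g'_def compose_def)
      have g_eq: "g = compose C \<rho>' (compose C s g')"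
      proof (rule Bij_ext)
        show "compose C \<rho>' (compose C s g') \<in> Bij C"
          unfolding \<rho>'_def using rot_Bij[OF \<sigma>(1)] im wD by (intro compose_Bij s_Bij g'_Bij) blast
        show "g x = compose C \<rho>' (compose C s g') x" if "x \<in> C" for x
          using that s_s \<rho>'_\<rho> Bij_in[OF g(1) that] Bij_in[OF \<rho>_Bij]
          by (simp add: compose_def g'_eq)
      qed (rule g(1))
      have act': "\<exists>\<sigma>\<in>G. acts q g' v (\<pi>' v) \<sigma>" if v: "v \<in> D" for v
      proof -
        obtain \<alpha> where \<alpha>: "\<alpha> \<in> G" "acts q g v (\<pi> v) \<alpha>" using \<pi>(2)[OF v] by blast
        have vD: "\<pi> v \<in> img ` D" using \<pi>(1) that by (auto simp: bij_betw_def)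
        obtain \<beta> where \<beta>: "\<beta> \<in> G" "\<And>u. u \<in> C \<Longrightarrow> smap \<beta> u = smap \<tau> (smap \<alpha> u)"
          using label_compose[OF \<tau>(1) \<alpha>(1)] by blast
        consider "\<pi> v = w" | "\<pi> v = t" "\<pi> v \<noteq> w" | "\<pi> v \<noteq> t" "\<pi> v \<noteq> w" by blast
        then show ?thesis
        proof cases
          case 1
          have "acts q g' v t \<beta>"
            unfolding acts_def
          proof
            fix u assume u: "u \<in> C"
            have "\<rho> (g (v @- u)) = w @- smap \<beta> u"
              using \<alpha> 1 u \<beta> im[OF wD] by (simp add: acts_def \<rho>_def rot_shift)
            moreover have "s (w @- smap \<beta> u) = t @- smap \<beta> u"
              using swap_left[of w q t] im[OF wD] label_in[OF \<beta>(1) u]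
              unfolding s_def moves_def by blast
            ultimately show "g' (v @- u) = t @- smap \<beta> u"
              using g'_eq[of "v @- u"] ext[OF that] u by simp
          qed
          then show ?thesis using \<beta>(1) 1 by (auto simp: \<pi>'_def)
        next
          case 2
          then have wt: "w \<parallel> t" using par[OF wD tD] by metis
          have "acts q g' v w \<alpha>"
            unfolding acts_def
          proof
            fix u assume u: "u \<in> C"
            have "\<rho> (g (v @- u)) = t @- smap \<alpha> u"
              using \<alpha> 2 u im[OF tD] wt by (simp add: acts_def \<rho>_def rot_other)
            moreover have "s (t @- smap \<alpha> u) = w @- smap \<alpha> u"
              using swap_right[of t q w] wt im[OF tD] \<alpha> u by (simp add: s_def moves_def)
            ultimately show "g' (v @- u) = w @- smap \<alpha> u"
              using g'_eq[of "v @- u"] ext[OF that] u by simp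
          qed
          then show ?thesis using \<alpha>(1) 2 by (auto simp: \<pi>'_def)
        next
          case 3
          then have par': "w \<parallel> \<pi> v" "t \<parallel> \<pi> v" using par wD tD vD by metis+
          have "acts q g' v (\<pi> v) \<alpha>"
            unfolding acts_def
          proof
            fix u assume u: "u \<in> C"
            have "\<pi> v @- smap \<alpha> u \<in> C" using im[OF vD] \<alpha> u by simp
            then show "g' (v @- u) = \<pi> v @- smap \<alpha> u"
              using g'_eq[of "v @- u"] ext[OF that] u \<alpha>(2) par'
              by (simp add: acts_def \<rho>_def s_def rot_other swap_other)
          qed
          then show ?thesis using \<alpha>(1) 3 by (auto simp: \<pi>'_def)
        qed
      qed
      have mv: "\<pi>' (p @ [c]) = r @ [c] \<and> moves q g' (p @ [c]) (r @ [c])" if c: "c < Suc b" for c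
      proof (cases "c = b")
        case True
        have "g' ((p @ [b]) @- u) = t @- u" if u: "u \<in> C" for u
        proof -
          have "(p @ [b]) @- u \<in> C" using p(2) b u by simp
          moreover have "g ((p @ [b]) @- u) = w @- smap \<sigma> u" using \<sigma>(2) u by (simp only: acts_def)
          moreover have "\<rho> (w @- smap \<sigma> u) = w @- u"
            using im[OF wD] \<sigma> \<tau> u by (simp add: \<rho>_def rot_shift)
          moreover have "s (w @- u) = t @- u"
            using swap_left[of w q t] im[OF wD] u by (simp add: s_def moves_def)
          ultimately show ?thesis using g'_eq by metis
        qed
        then show ?thesis using True unfolding moves_def by (simp add: \<pi>'_def w_def t_def)
      next
        case False
        then have cb: "c < b" using c by simp
        have pc: "p @ [c] \<in> D" using p cb b by simp
        have "\<pi> (p @ [c]) \<noteq> \<pi> (p @ [b])"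
          using \<pi>(1) pc pD False by (auto simp: bij_betw_def dest: inj_onD)
        then have nw: "r @ [c] \<noteq> w" using pr[OF cb] by (simp add: w_def)
        have nt: "r @ [c] \<noteq> t" using False by (simp add: t_def)
        have rD: "r @ [c] \<in> img ` D" using r cb b by simp
        have par': "w \<parallel> r @ [c]" "t \<parallel> r @ [c]" using par wD tD rD nw nt by metis+
        have "g' ((p @ [c]) @- u) = (r @ [c]) @- u" if u: "u \<in> C" for u
        proof -
          have "(p @ [c]) @- u \<in> C" "(r @ [c]) @- u \<in> C" using p(2) r(2) b cb u by simp_all
          moreover have "g ((p @ [c]) @- u) = (r @ [c]) @- u"
            using pr[OF cb] u by (simp only: moves_def)
          moreover have "\<not> pre w ((r @ [c]) @- u)" "\<not> pre t ((r @ [c]) @- u)"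
            using par' parallel_not_pre by blast+
          ultimately show ?thesis using g'_eq by (simp only: \<rho>_def s_def rot_other swap_other not_False_eq_True)
        qed
        then show ?thesis using pr[OF cb] nw nt by (simp only: moves_def) (simp add: \<pi>'_def)
      qed
      have supp': "g' x = x" if "x \<in> C" "\<not> pre z x" for x
      proof -
        have "\<not> pre w x" "\<not> pre t x" using that(2) im wD tD pre_prefix by blast+
        then show ?thesis
          using that g(2) by (simp add: g'_eq \<rho>_def s_def rot_other swap_other)
      qed
      have "bij_betw \<pi>' D (img ` D)"
      proof -
        have "bij_betw (Transposition.transpose w t) (img ` D) (img ` D)"
          using wD tD by (simp add: bij_betw_transpose_iff)
        then show ?thesis unfolding \<pi>'_def by (rule bij_betw_trans[OF \<pi>(1)])
      qed
      moreover have "g' \<in> K \<Longrightarrow> f \<in> K" using g(3) g_eq comp s_K \<rho>'_K by metis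
      ultimately show ?case
        using g'_Bij supp' act' mv by (intro exI[of _ g'] exI[of _ \<pi>']) blast
    qed
    from this[OF order_refl] obtain g \<pi> where
        "g \<in> Bij C" "\<forall>x\<in>C. \<not> pre z x \<longrightarrow> g x = x" "g \<in> K \<longrightarrow> f \<in> K"
        "bij_betw \<pi> D (img ` D)" "\<forall>w\<in>D. \<exists>\<sigma>\<in>G. acts q g w (\<pi> w) \<sigma>"
        "\<forall>c<q. \<pi> (p @ [c]) = r @ [c] \<and> moves q g (p @ [c]) (r @ [c])"
      by (elim exE conjE)
    then have g: "g \<in> Bij C" "\<And>x. x \<in> C \<Longrightarrow> \<not> pre z x \<Longrightarrow> g x = x" "g \<in> K \<Longrightarrow> f \<in> K"
        and \<pi>: "bij_betw \<pi> D (img ` D)" "\<And>w. w \<in> D \<Longrightarrow> \<exists>\<sigma>\<in>G. acts q g w (\<pi> w) \<sigma>"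
        and mv: "\<And>c. c < q \<Longrightarrow> moves q g (p @ [c]) (r @ [c])"
      by blast+
    \<comment> \<open>The \<open>q\<close> siblings are replaced by their parent, on which the
      corrected map acts as one cone map. The cardinality drops by at least \<open>q - 1\<close>,
      which is positive.\<close>
    define S where "S = (\<lambda>b. p @ [b]) ` {..<q}"
    define E where "E = insert p (D - S)"
    have SD: "S \<subseteq> D" using p(3) by (auto simp: S_def)
    have "card S = q" unfolding S_def by (subst card_image) (auto simp: inj_on_def)
    then have "card (D - S) = card D - q" "q \<le> card D"
      using SD fin by (simp_all add: card_Diff_subset finite_subset card_mono flip: \<open>card S = q\<close>)
    moreover have "card E \<le> Suc (card (D - S))" unfolding E_def by (rule card_insert_le_m1) auto
    ultimately have "card E < card D" using q by linarith
    moreover have "partition_below q z E"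
      unfolding partition_below_def
    proof (intro conjI ballI impI)
      show "finite E" using fin by (simp add: E_def)
      show "word q w" "prefix z w" if "w \<in> E" for w using that ext p by (auto simp: E_def)
      have p_par: "p \<parallel> w" if w: "w \<in> D - S" for w
      proof
        show "\<not> prefix w p"
        proof
          assume "prefix w p"
          then have "prefix w (p @ [0])" by simp
          moreover have "p @ [0] \<in> S" using q by (simp add: S_def)
          ultimately show False using anti[of w "p @ [0]"] w SD by blast
        qed
        show "\<not> prefix p w"
        proof
          assume "prefix p w"
          then obtain v where v: "w = p @ v" by (auto simp: prefix_def)
          show False
          proof (cases v)
            case Nil
            then show False using \<open>\<not> prefix w p\<close> v by simp
          next
            case (Cons c v')
            then have "c < q" using ext[of w] w v by auto
            then have "p @ [c] \<in> S" by (simp add: S_def)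
            moreover have "prefix (p @ [c]) w" using v Cons by simp
            ultimately show False using anti[of "p @ [c]" w] w SD by blast
          qed
        qed
      qed
      show "w \<parallel> w'" if "w \<in> E" "w' \<in> E" "w \<noteq> w'" for w w'
        using that anti p_par parallel_commute unfolding E_def by blast
      fix x assume "x \<in> C" "pre z x"
      then obtain w where w: "w \<in> D" "pre w x" using cov by blast
      show "\<exists>w\<in>E. pre w x"
      proof (cases "w \<in> S")
        case True
        then have "pre p x" using w(2) by (auto simp: S_def elim: pre_prefix)
        then show ?thesis by (auto simp: E_def)
      qed (use w in \<open>auto simp: E_def\<close>)
    qed
    moreover have "\<exists>w' \<sigma>. word q w' \<and> \<sigma> \<in> G \<and> acts q g w w' \<sigma>" if "w \<in> E" for w
    proof (cases "w \<in> D")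
      case True
      then have "\<pi> w \<in> img ` D" using \<pi>(1) by (auto simp: bij_betw_def)
      then have "word q (\<pi> w)" using img_word by (metis imageE)
      then show ?thesis using \<pi>(2)[OF True] by metis
    next
      case False
      then have "w = p" using that by (simp add: E_def)
      have "acts q g p r label_id"
        unfolding acts_def
      proof
        fix u assume u: "u \<in> C"
        obtain a u' where a: "u = a ## u'" by (cases u)
        have "a < q" "u' \<in> C" using u a by simp_all
        then have "g ((p @ [a]) @- u') = (r @ [a]) @- u'" using mv by (simp only: moves_def)
        then show "g (p @- u) = r @- smap label_id u" using label_id(2)[OF u] by (simp add: a)
      qed
      then show ?thesis using \<open>w = p\<close> r(2) label_id(1) by blast
    qed
    ultimately have "g \<in> K" using less.hyps[of E g] g by blast
    then show ?thesis by (rule g(3))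
  qed
qed

section \<open>Local recognition of group elements and finite generation\<close>

abbreviation "V \<equiv> NR_maps q G"

lemma NR_maps_local:
  assumes "f \<in> V" "x \<in> C"
  obtains w w' \<sigma> where "word q w" "word q w'" "\<sigma> \<in> G" "pre w x" "acts q f w w' \<sigma>"
proof -
  obtain W W' \<sigma> where W: "division q W" "division q W'" "length W = length W'"
    "\<forall>i<length W. \<sigma> i \<in> G" "\<forall>i<length W. \<forall>u\<in>C. f (W ! i @- u) = W' ! i @- smap (\<sigma> i) u"
    using assms by (auto simp: NR_maps_def)
  have "x \<in> (\<Union>i<length W. cylinder q (W ! i))" using W(1) assms by (simp add: division_def)
  then obtain i where i: "i < length W" "x \<in> cylinder q (W ! i)" by blast
  then have "pre (W ! i) x" by (auto simp: cylinder_def)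
  moreover have "word q (W ! i)" "word q (W' ! i)"
    using W i nth_mem unfolding division_def by (metis in_listsD lessThan_iff subsetD subsetI)+
  ultimately show thesis using that[of "W ! i" "W' ! i" "\<sigma> i"] W i by (simp add: acts_def)
qed

lemma NR_maps_Bij: "f \<in> V \<Longrightarrow> f \<in> Bij C"
  by (simp add: NR_maps_def)

text \<open>Cone maps restrict to smaller cones, so compactness makes the local depths
  uniform.\<close>

lemma locally_acts_uniform:
  assumes "\<And>x. x \<in> C \<Longrightarrow>
    \<exists>w w' \<sigma>. word q w \<and> word q w' \<and> \<sigma> \<in> G \<and> pre w x \<and> acts q f w w' \<sigma>"
  obtains N where "\<And>w. word q w \<Longrightarrow> N \<le> length w \<Longrightarrow> \<exists>w' \<sigma>. word q w' \<and> \<sigma> \<in> G \<and> acts q f w w' \<sigma>"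
proof -
  define P where "P w \<longleftrightarrow> (\<exists>w' \<sigma>. word q w' \<and> \<sigma> \<in> G \<and> acts q f w w' \<sigma>)" for w
  have "P (w @ [a])" if w: "word q w" "a < q" "P w" for w a
  proof -
    obtain w' \<sigma> where "word q w'" "\<sigma> \<in> G" "acts q f w w' \<sigma>" using w(3) by (auto simp: P_def)
    moreover from this have "acts q f (w @ [a]) (w' @ map \<sigma> [a]) \<sigma>"
      using w(2) by (intro acts_append) auto
    moreover from calculation have "word q (w' @ map \<sigma> [a])" using label_less w(2) by simp
    ultimately show ?thesis unfolding P_def by blast
  qed
  moreover have "\<exists>n. P (stake n x)" if "x \<in> C" for x
    using assms[OF that] unfolding P_def pre_def by metis
  ultimately obtain N where "\<And>w. word q w \<Longrightarrow> N \<le> length w \<Longrightarrow> P w"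
    using cantor_compactness[of q P] by metis
  then show thesis by (intro that) (simp add: P_def)
qed

text \<open>All words of a uniform length form the source division. Their image words form the
  target division because labels permute the alphabet, so that a cone goes onto a full cone.
  Membership thus becomes a check at each point.\<close>

lemma NR_mapsI:
  assumes f: "f \<in> Bij C" and loc: "\<And>x. x \<in> C \<Longrightarrow>
    \<exists>w w' \<sigma>. word q w \<and> word q w' \<and> \<sigma> \<in> G \<and> pre w x \<and> acts q f w w' \<sigma>"
  shows "f \<in> V"
proof -
  obtain N where N: "\<And>w. word q w \<Longrightarrow> N \<le> length w \<Longrightarrow> \<exists>w' \<sigma>. word q w' \<and> \<sigma> \<in> G \<and> acts q f w w' \<sigma>"
    using locally_acts_uniform[of f] loc by blast
  obtain img lab where il: "\<And>w. word q w \<Longrightarrow> length w = N \<Longrightarrow>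
      word q (img w) \<and> lab w \<in> G \<and> acts q f w (img w) (lab w)"
    using N by (metis order_refl)
  obtain W where W: "set W = {w. word q w \<and> length w = N}" "distinct W"
    using finite_distinct_list[OF finite_lists_length_eq[of "{..<q}" N]] by auto
  have nth: "word q (W ! i) \<and> length (W ! i) = N" if "i < length W" for i
    using nth_mem[OF that] W(1) by blast
  have cyl: "cylinder q (map img W ! i) = f ` cylinder q (W ! i)" if i: "i < length W" for i
  proof -
    note w = il[of "W ! i"] nth[OF i]
    obtain \<tau> where \<tau>: "\<tau> \<in> G" "\<And>u. u \<in> C \<Longrightarrow> smap (lab (W ! i)) (smap \<tau> u) = u"
      using label_inverse[of "lab (W ! i)"] w by metis
    have "f ` cylinder q (W ! i) = {img (W ! i) @- smap (lab (W ! i)) u | u. u \<in> C}"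
      using w by (force simp: cylinder_def acts_def)
    also have "\<dots> = cylinder q (img (W ! i))"
      unfolding cylinder_def using \<tau> w label_in by (metis (no_types, lifting))
    finally show ?thesis using i by simp
  qed
  have disj: "cylinder q (W ! i) \<inter> cylinder q (W ! j) = {}"
    if "i < length W" "j < length W" "i \<noteq> j" for i j
    using that nth[of i] nth[of j] W(2) nth_eq_iff_index_eq[of W i j]
    by (auto simp: cylinder_iff pre_def)
  have sub: "cylinder q (W ! i) \<subseteq> C" if "i < length W" for i
    using nth[OF that] by (auto simp: cylinder_iff)
  have cover: "(\<Union>i<length W. cylinder q (W ! i)) = C"
  proof (intro equalityI subsetI)
    fix x assume x: "x \<in> C"
    then have "stake N x \<in> set W" using W(1) cantor_stake by simp
    then obtain i where "i < length W" "W ! i = stake N x" by (auto simp: in_set_conv_nth)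
    moreover from this have "x \<in> cylinder q (W ! i)"
      using x nth[of i] by (simp add: cylinder_iff pre_def)
    ultimately show "x \<in> (\<Union>i<length W. cylinder q (W ! i))" by blast
  qed (use sub in blast)
  have "division q W"
    unfolding division_def disjoint_family_on_def using disj cover W(1) by auto
  moreover have "division q (map img W)"
    unfolding division_def disjoint_family_on_def
  proof (intro conjI ballI impI)
    show "set (map img W) \<subseteq> lists {..<q}" using il W(1) by auto
    show "(\<Union>i<length (map img W). cylinder q (map img W ! i)) = C"
    proof -
      have "(\<Union>i<length (map img W). cylinder q (map img W ! i)) = f ` (\<Union>i<length W. cylinder q (W ! i))"
        using cyl by auto
      then show ?thesis using cover f by (simp add: Bij_def bij_betw_def)
    qed
    fix i j assume "i \<in> {..<length (map img W)}" "j \<in> {..<length (map img W)}" "i \<noteq> j"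
    then show "cylinder q (map img W ! i) \<inter> cylinder q (map img W ! j) = {}"
      using cyl disj[of i j] sub inj_on_image_Int[of f C "cylinder q (W ! i)" "cylinder q (W ! j)"] f
      by (simp add: Bij_def bij_betw_def)
  qed
  moreover have "\<forall>i<length W. lab (W ! i) \<in> G"
    "\<forall>i<length W. \<forall>u\<in>C. f (W ! i @- u) = map img W ! i @- smap (lab (W ! i)) u"
    using il nth by (auto simp: acts_def)
  ultimately show ?thesis
    unfolding NR_maps_def using f
    by (intro CollectI conjI exI[of _ W] exI[of _ "map img W"] exI[of _ "\<lambda>i. lab (W ! i)"]) simp_all
qed

lemma moves_imp_acts: "moves q f w w' \<Longrightarrow> acts q f w w' label_id"
  by (simp add: moves_def acts_def label_id)

lemma fixed_far:
  assumes "x \<in> C" "\<And>y. y \<in> C \<Longrightarrow> stake n y = stake n x \<Longrightarrow> f y = y"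
  shows "\<exists>w w' \<sigma>. word q w \<and> word q w' \<and> \<sigma> \<in> G \<and> pre w x \<and> acts q f w w' \<sigma>"
proof -
  have "moves q f (stake n x) (stake n x)"
    unfolding moves_def using assms cantor_stake[OF assms(1), of n]
    by (auto simp: stake_append take_stake)
  then show ?thesis
    using assms(1) cantor_stake label_id moves_imp_acts
    by (intro exI[of _ "stake n x"] exI[of _ label_id]) (simp add: pre_def)
qed

lemma swap_V:
  assumes "word q w" "word q w'" "w \<parallel> w'"
  shows "swap q w w' \<in> V"
proof (rule NR_mapsI)
  show "swap q w w' \<in> Bij C" using assms by (rule swap_Bij)
  fix x assume x: "x \<in> C"
  let ?n = "max (length w) (length w')"
  consider "pre w x" | "pre w' x" | "\<not> pre w x" "\<not> pre w' x" by blast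
  then show "\<exists>v v' \<sigma>. word q v \<and> word q v' \<and> \<sigma> \<in> G \<and> pre v x \<and> acts q (swap q w w') v v' \<sigma>"
  proof cases
    case 1
    then show ?thesis using moves_imp_acts[OF swap_left[OF assms(1)]] assms label_id(1) by blast
  next
    case 2
    then show ?thesis using moves_imp_acts[OF swap_right[OF assms(2,3)]] assms label_id(1) by blast
  next
    case 3
    show ?thesis
    proof (rule fixed_far[OF x, of ?n])
      fix y assume y: "y \<in> C" "stake ?n y = stake ?n x"
      have "\<not> pre v y" if "\<not> pre v x" "length v \<le> ?n" for v
        using that y(2) unfolding pre_def by (metis min_absorb1 take_stake)
      then show "swap q w w' y = y" using 3 y(1) by (simp add: swap_other)
    qed
  qed
qed

lemma rot_V:
  assumes "word q w" "\<sigma> \<in> G"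
  shows "rot q w \<sigma> \<in> V"
proof (rule NR_mapsI)
  show "rot q w \<sigma> \<in> Bij C" using assms by (intro rot_Bij)
  fix x assume x: "x \<in> C"
  show "\<exists>v v' \<tau>. word q v \<and> word q v' \<and> \<tau> \<in> G \<and> pre v x \<and> acts q (rot q w \<sigma>) v v' \<tau>"
  proof (cases "pre w x")
    case True
    moreover have "acts q (rot q w \<sigma>) w w \<sigma>" using assms by (simp add: acts_def rot_shift)
    ultimately show ?thesis using assms by blast
  next
    case False
    show ?thesis
    proof (rule fixed_far[OF x, of "length w"])
      show "rot q w \<sigma> y = y" if "y \<in> C" "stake (length w) y = stake (length w) x" for y
        using that False by (simp add: rot_other pre_def)
    qed
  qed
qed

text \<open>The bounds come from the reductions below: a word with more than 3 letters is shortened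
  by exchanging its first 3 letters with a word of length 2, and a rotation at a deeper word is
  moved to a single letter below \<open>z\<close>.\<close>

definition local_gens :: "nat list \<Rightarrow> (nat stream \<Rightarrow> nat stream) set" where
  "local_gens z =
    {swap q (z @ a) (z @ b) | a b. word q a \<and> word q b \<and> length a \<le> 3 \<and> length b \<le> 3 \<and> a \<parallel> b} \<union>
    {rot q (z @ a) \<sigma> | a \<sigma>. word q a \<and> length a \<le> 1 \<and> \<sigma> \<in> G}"

lemma swap_local_gens:
  "\<lbrakk>word q a; word q b; length a \<le> 3; length b \<le> 3; a \<parallel> b\<rbrakk> \<Longrightarrow> swap q (z @ a) (z @ b) \<in> local_gens z"
  unfolding local_gens_def by blast

lemma rot_local_gens:
  "\<lbrakk>word q a; length a \<le> 1; \<sigma> \<in> G\<rbrakk> \<Longrightarrow> rot q (z @ a) \<sigma> \<in> local_gens z"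
  unfolding local_gens_def by blast

lemma finite_local_gens: "finite (local_gens z)"
proof -
  have fin: "finite {a. word q a \<and> length a \<le> n}" for n
    by (rule finite_lists_length_le) simp
  have "local_gens z \<subseteq>
    (\<lambda>(a, b). swap q (z @ a) (z @ b)) ` ({a. word q a \<and> length a \<le> 3} \<times> {a. word q a \<and> length a \<le> 3}) \<union>
    (\<lambda>(a, \<sigma>). rot q (z @ a) \<sigma>) ` ({a. word q a \<and> length a \<le> 1} \<times> G)"
    unfolding local_gens_def by auto
  then show ?thesis by (rule finite_subset) (intro finite_UnI finite_imageI finite_cartesian_product fin finite_G)
qed

text \<open>Conjugation by a generator: replacing the first 3 letters \<open>p\<close> of
  \<open>a\<close> by a 2-letter word \<open>p'\<close> incomparable with both words shortens
  \<open>a\<close> and never lengthens \<open>b\<close>, so the total length decreases.\<close>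

lemma swap_below_generated:
  assumes comp: "\<And>f g. f \<in> K \<Longrightarrow> g \<in> K \<Longrightarrow> compose C f g \<in> K" and gens: "local_gens z \<subseteq> K"
    and z: "word q z"
    and "word q a" "word q b" "a \<parallel> b"
  shows "swap q (z @ a) (z @ b) \<in> K"
  using assms(4-6)
proof (induction "length a + length b" arbitrary: a b rule: less_induct)
  case less
  have par_z: "z @ c \<parallel> z @ c'" if "c \<parallel> c'" for c c' using that by (auto simp: parallel_def)
  show ?case
  proof (cases "length a \<le> 3 \<and> length b \<le> 3")
    case True
    then show ?thesis using less.prems gens swap_local_gens by blast
  next
    case False
    have main: "swap q (z @ a) (z @ b) \<in> K"
      if long: "3 < length a" and ab: "word q a" "word q b" "a \<parallel> b"
        and IH: "\<And>a' b'. length a' + length b' < length a + length b \<Longrightarrow> word q a' \<Longrightarrow> word q b' \<Longrightarrow>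
          a' \<parallel> b' \<Longrightarrow> swap q (z @ a') (z @ b') \<in> K" for a b
    proof -
      obtain p' where p': "word q p'" "length p' = 2" "p' \<parallel> a" "p' \<parallel> b"
        using exists_parallel_word2[OF q ab(3,1,2)] long by auto
      define p v where "p = take 3 a" and "v = drop 3 a"
      have a: "a = p @ v" "length p = 3" using long by (simp_all add: p_def v_def)
      have p: "word q p" "word q v" using ab(1) a by auto
      have pp': "p \<parallel> p'"
      proof
        show "\<not> prefix p' p" using p'(3) a by auto
        then show "\<not> prefix p p'" using a(2) p'(2) prefix_length_le by fastforce
      qed
      let ?s = "swap q (z @ p) (z @ p')"
      have zw: "word q (z @ p)" "word q (z @ p')" "z @ p \<parallel> z @ p'"
        using z p p' pp' par_z by auto
      have s: "?s \<in> K" using swap_local_gens[OF p(1) p'(1) _ _ pp'] a(2) p'(2) gens by auto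
      have mv1: "moves q ?s (z @ a) (z @ p' @ v)"
        using moves_append[OF swap_left[OF zw(1)] p(2), of "z @ p'"] a by simp
      obtain b' where b': "word q b'" "length b' \<le> length b" "moves q ?s (z @ b) (z @ b')" "p' @ v \<parallel> b'"
      proof (cases "prefix p b")
        case True
        then obtain v' where v': "b = p @ v'" by (auto simp: prefix_def)
        show ?thesis
        proof
          show "word q (p' @ v')" using ab(2) v' p'(1) by auto
          show "length (p' @ v') \<le> length b" using v' a p' by simp
          show "moves q ?s (z @ b) (z @ p' @ v')"
            using moves_append[OF swap_left[OF zw(1)], of v' "z @ p'"] v' ab(2) by simp
          show "p' @ v \<parallel> p' @ v'" using ab(3) a v' by (auto simp: parallel_def)
        qed
      next
        case False
        \<comment> \<open>\<open>b\<close> is not a prefix of \<open>p\<close> either, since it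
          would then be a prefix of \<open>a\<close>.\<close>
        then have "p \<parallel> b" using ab(3) a by (auto simp: parallel_def)
        show ?thesis
        proof
          show "moves q ?s (z @ b) (z @ b)"
            unfolding moves_def
          proof
            fix u assume "u \<in> C"
            moreover have "\<not> pre (z @ p) ((z @ b) @- u)" "\<not> pre (z @ p') ((z @ b) @- u)"
              using par_z[OF \<open>p \<parallel> b\<close>] par_z[OF p'(4)] parallel_not_pre by blast+
            ultimately show "?s ((z @ b) @- u) = (z @ b) @- u"
              using z ab(2) by (intro swap_other) auto
          qed
          show "p' @ v \<parallel> b" using parallel_append[OF p'(4), of v "[]"] by simp
        qed (use ab in auto)
      qed
      have "swap q (z @ p' @ v) (z @ b') \<in> K"
        using IH[of "p' @ v" b'] b' p p' a by simp
      moreover have "swap q (z @ a) (z @ b) = compose C ?s (compose C (swap q (z @ p' @ v) (z @ b')) ?s)"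
        by (rule swap_eq_conj) (use zw ab z p p' b' mv1 par_z in auto)
      ultimately show ?thesis using comp s by simp
    qed
    show ?thesis
    proof (cases "3 < length a")
      case True
      then show ?thesis using main[of a b] less by blast
    next
      case F: False
      have "swap q (z @ b) (z @ a) \<in> K"
        by (rule main) (use False F less in \<open>auto simp: add.commute parallel_commute\<close>)
      then show ?thesis using swap_commute[of "z @ a" q "z @ b"] less.prems z par_z by simp
    qed
  qed
qed

theorem supported_below_generated:
  assumes comp: "\<And>f g. f \<in> K \<Longrightarrow> g \<in> K \<Longrightarrow> compose C f g \<in> K" and gens: "local_gens z \<subseteq> K"
    and z: "word q z" and f: "f \<in> V" "\<And>x. x \<in> C \<Longrightarrow> \<not> pre z x \<Longrightarrow> f x = x"
  shows "f \<in> K"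
proof -
  have swaps: "swap q w w' \<in> K"
    if w: "word q w" "word q w'" "prefix z w" "prefix z w'" "w \<parallel> w'" for w w'
  proof -
    obtain a b where ab: "w = z @ a" "w' = z @ b" using w by (auto simp: prefix_def)
    then have "a \<parallel> b" using w(5) by (auto simp: parallel_def)
    then show ?thesis using swap_below_generated[OF comp gens z, of a b] w ab by auto
  qed
  have rots: "rot q w \<sigma> \<in> K" if w: "word q w" "prefix z w" "\<sigma> \<in> G" for w \<sigma>
  proof -
    have short: "rot q (z @ a) \<sigma> \<in> K" if "word q a" "length a \<le> 1" for a
      using that w(3) gens rot_local_gens by blast
    obtain a where a: "w = z @ a" using w by (auto simp: prefix_def)
    show ?thesis
    proof (cases a)
      case Nil
      then show ?thesis using short[of "[]"] a by simp
    next
      case (Cons c s)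
      \<comment> \<open>A letter different from the first one after \<open>z\<close>, which makes
        \<open>z @ [e]\<close> incomparable with \<open>w\<close>.\<close>
      define e where "e = (if c = 0 then 1 else 0::nat)"
      have e: "e < q" "e \<noteq> c" using q by (auto simp: e_def)
      have par: "w \<parallel> z @ [e]" using e a Cons by (auto simp: parallel_def)
      have ze: "word q (z @ [e])" using z e by simp
      have "rot q w \<sigma> = compose C (swap q (z @ [e]) w) (compose C (rot q (z @ [e]) \<sigma>) (swap q (z @ [e]) w))"
        using rot_eq_swap_conj[OF w(1) ze par w(3)] .
      moreover have "swap q (z @ [e]) w \<in> K"
        using swaps[OF ze w(1) _ w(2)] par by (simp add: parallel_commute)
      moreover have "rot q (z @ [e]) \<sigma> \<in> K" using short[of "[e]"] e by simp
      ultimately show ?thesis using comp by simp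
    qed
  qed
  obtain N where N: "\<And>w. word q w \<Longrightarrow> N \<le> length w \<Longrightarrow> \<exists>w' \<sigma>. word q w' \<and> \<sigma> \<in> G \<and> acts q f w w' \<sigma>"
    using locally_acts_uniform[of f] NR_maps_local[OF f(1)] by metis
  \<comment> \<open>Deep enough for \<open>f\<close> to act by cone maps, and at least
    \<open>length z\<close> so that the words of this length extending \<open>z\<close> cover
    I(z).\<close>
  define n where "n = max N (length z)"
  define D where "D = {w. word q w \<and> length w = n \<and> prefix z w}"
  have "partition_below q z D"
    unfolding partition_below_def
  proof (intro conjI ballI impI)
    show "finite D"
      by (rule finite_subset[OF _ finite_lists_length_eq[of "{..<q}" n]]) (auto simp: D_def)
    show "word q w" "prefix z w" if "w \<in> D" for w using that by (auto simp: D_def)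
    show "w \<parallel> w'" if "w \<in> D" "w' \<in> D" "w \<noteq> w'" for w w'
      using that by (intro not_equal_is_parallel) (auto simp: D_def)
    show "\<exists>w\<in>D. pre w x" if "x \<in> C" "pre z x" for x
      using that pre_stake[of z x n] cantor_stake
      by (intro bexI[of _ "stake n x"]) (auto simp: D_def pre_def n_def)
  qed
  show ?thesis
  proof (rule partition_generation[of K z D f])
    show "partition_below q z D" by fact
    show "\<exists>w' \<sigma>. word q w' \<and> \<sigma> \<in> G \<and> acts q f w w' \<sigma>" if "w \<in> D" for w
      using that N by (simp add: D_def n_def)
  qed (use comp swaps rots z f NR_maps_Bij in simp_all)
qed

end

section \<open>Fixed points\<close>

context label_group
begin

text \<open>The involution \<open>spread\<close> exchanges \<open>I(a)\<close> and \<open>I(0a)\<close> for all letters \<open>a \<noteq> 0\<close>, so it maps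
  the complement of \<open>I(0)\<close> into \<open>I(0)\<close>.\<close>

definition spread :: "nat stream \<Rightarrow> nat stream" where
  "spread = (\<lambda>x\<in>C. if shd x \<noteq> 0 then 0 ## x else if shd (stl x) \<noteq> 0 then stl x else x)"

lemma spread_involution:
  assumes "x \<in> C"
  shows "spread x \<in> C \<and> spread (spread x) = x"
proof -
  obtain a y where x: "x = a ## y" by (cases x)
  obtain b u where y: "y = b ## u" by (cases y)
  show ?thesis using assms q by (simp add: spread_def x y)
qed

lemma spread_V: "spread \<in> V"
proof (rule NR_mapsI)
  show "spread \<in> Bij C"
  proof (rule Bij_if_involution)
    show "spread \<in> extensional C" by (simp add: spread_def)
  qed (simp_all add: spread_involution)
  fix x assume x: "x \<in> C"
  obtain a y where "x = a ## y" by (cases x)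
  moreover obtain b u where "y = b ## u" by (cases y)
  ultimately have abu: "x = a ## b ## u" by simp
  have ab: "a < q" "b < q" "u \<in> C" using x abu by simp_all
  have "\<exists>w w'. word q w \<and> word q w' \<and> pre w x \<and> moves q spread w w'"
  proof (cases "a = 0")
    case True
    have "moves q spread [0, b] (if b = 0 then [0, 0] else [b])"
      using ab q by (simp add: moves_def spread_def)
    moreover have "pre [0, b] x" using True abu by (simp add: pre_def)
    moreover have "word q [0, b]" "word q (if b = 0 then [0, 0] else [b])" using ab q by simp_all
    ultimately show ?thesis by blast
  next
    case False
    have "moves q spread [a] [0, a]" using ab False by (simp add: moves_def spread_def)
    moreover have "pre [a] x" using abu by (simp add: pre_def)
    moreover have "word q [a]" "word q [0, a]" using ab q by simp_all
    ultimately show ?thesis by blast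
  qed
  then show "\<exists>w w' \<sigma>. word q w \<and> word q w' \<and> \<sigma> \<in> G \<and> pre w x \<and> acts q spread w w' \<sigma>"
    using moves_imp_acts label_id(1) by blast
qed

lemma spread_pre: "x \<in> C \<Longrightarrow> \<not> pre [0] x \<Longrightarrow> pre [0] (spread x)"
  by (cases x) (auto simp: pre_def spread_def)

lemma swap_not_pre:
  assumes "word q z" "word q z'" "z \<parallel> z'" "x \<in> C" "\<not> pre z' x"
  shows "\<not> pre z (swap q z z' x)"
  using assms(4)
proof (cases rule: cone_cases[of x q z])
  case (1 u)
  then show ?thesis using swap_left[OF assms(1), of z'] assms(3) by (simp add: moves_def)
qed (use assms in \<open>simp add: swap_other\<close>)

lemma rot_inverse:
  assumes "word q w" "\<And>u. u \<in> C \<Longrightarrow> smap \<sigma> (smap \<tau> u) = u" "\<tau> \<in> G" "x \<in> C"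
  shows "rot q w \<sigma> (rot q w \<tau> x) = x"
  using assms(4)
proof (cases rule: cone_cases[of x q w])
  case (1 u)
  then show ?thesis using assms by (simp add: rot_shift)
qed (use assms in \<open>simp add: rot_other\<close>)

lemma compose_rot:
  assumes "word q w" "\<sigma> \<in> G" "\<tau> \<in> G"
  obtains \<rho> where "\<rho> \<in> G" "compose C (rot q w \<sigma>) (rot q w \<tau>) = rot q w \<rho>"
proof -
  obtain \<rho> where \<rho>: "\<rho> \<in> G" "\<And>u. u \<in> C \<Longrightarrow> smap \<rho> u = smap \<sigma> (smap \<tau> u)"
    using label_compose[OF assms(2,3)] by blast
  have "compose C (rot q w \<sigma>) (rot q w \<tau>) = rot q w \<rho>"
  proof (rule Bij_ext)
    fix x assume x: "x \<in> C"
    then show "compose C (rot q w \<sigma>) (rot q w \<tau>) x = rot q w \<rho> x"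
    proof (cases rule: cone_cases[of x q w])
      case (1 u)
      then show ?thesis using assms \<rho> by (simp add: compose_def rot_shift)
    qed (use x in \<open>simp add: compose_def rot_other\<close>)
  qed (intro compose_Bij rot_Bij assms \<rho>)+
  then show thesis using that \<rho>(1) by blast
qed

end

section \<open>Fixed-point sets of an isometric action\<close>

locale NR_action = label_group q G + CN_space M d \<gamma>
  for q G and M :: "'a set" and d \<gamma> +
  fixes \<phi> :: "(nat stream \<Rightarrow> nat stream) \<Rightarrow> 'a \<Rightarrow> 'a" and k :: nat
  assumes action: "isometric_action (NR_group q G) M d \<phi>"
    and complete: mcomplete
    and dim: "covering_dim_le mtopology k"
    and nonempty: "M \<noteq> {}"
begin

abbreviation "H \<equiv> NR_group q G"

sublocale group_action H M \<phi>
  using action by (simp add: isometric_action_def)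

sublocale H: group H
  using group_hom by (rule group_hom.axioms(1))

lemma carrier_H [simp]: "carrier H = V"
  by (simp add: NR_group_def)

lemma mult_H: "f \<in> V \<Longrightarrow> g \<in> V \<Longrightarrow> f \<otimes>\<^bsub>H\<^esub> g = compose C f g"
  by (simp add: NR_group_def BijGroup_def NR_maps_Bij)

lemma one_H: "\<one>\<^bsub>H\<^esub> = (\<lambda>x\<in>C. x)"
  by (simp add: NR_group_def BijGroup_def)

lemma V_compose: "f \<in> V \<Longrightarrow> g \<in> V \<Longrightarrow> compose C f g \<in> V"
  using H.m_closed by (simp flip: mult_H)

lemma \<phi>_in: "g \<in> V \<Longrightarrow> x \<in> M \<Longrightarrow> \<phi> g x \<in> M"
  using surj_prop by fastforce

lemma \<phi>_isometry: "g \<in> V \<Longrightarrow> x \<in> M \<Longrightarrow> y \<in> M \<Longrightarrow> d (\<phi> g x) (\<phi> g y) = d x y"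
  using action by (simp add: isometric_action_def)

lemma \<phi>_compose: "f \<in> V \<Longrightarrow> g \<in> V \<Longrightarrow> x \<in> M \<Longrightarrow> \<phi> (compose C f g) x = \<phi> f (\<phi> g x)"
  using composition_rule[of x f g] by (simp add: mult_H)

lemma \<phi>_id: "x \<in> M \<Longrightarrow> \<phi> (\<lambda>x\<in>C. x) x = x"
  using id_eq_one by (metis one_H restrict_apply')

lemma V_inverse:
  assumes f: "f \<in> V"
  obtains f' where "f' \<in> V" "\<And>x. x \<in> C \<Longrightarrow> f' (f x) = x" "\<And>x. x \<in> C \<Longrightarrow> f (f' x) = x"
    "\<And>x. x \<in> M \<Longrightarrow> \<phi> f' (\<phi> f x) = x" "\<And>x. x \<in> M \<Longrightarrow> \<phi> f (\<phi> f' x) = x"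
proof
  define f' where "f' = inv\<^bsub>H\<^esub> f"
  show f': "f' \<in> V" unfolding f'_def using H.inv_closed[of f] f by simp
  have 1: "compose C f' f = (\<lambda>x\<in>C. x)"
    using H.l_inv[of f] f mult_H[OF f' f] by (simp add: one_H f'_def)
  have 2: "compose C f f' = (\<lambda>x\<in>C. x)"
    using H.r_inv[of f] f mult_H[OF f f'] by (simp add: one_H f'_def)
  show "f' (f x) = x" if "x \<in> C" for x
    using fun_cong[OF 1, of x] that by (simp add: compose_def)
  show "f (f' x) = x" if "x \<in> C" for x
    using fun_cong[OF 2, of x] that by (simp add: compose_def)
  show "\<phi> f' (\<phi> f x) = x" if "x \<in> M" for x
    using \<phi>_compose[OF f' f that] \<phi>_id[OF that] 1 by simp
  show "\<phi> f (\<phi> f' x) = x" if "x \<in> M" for x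
    using \<phi>_compose[OF f f' that] \<phi>_id[OF that] 2 by simp
qed

definition Fix :: "(nat stream \<Rightarrow> nat stream) set \<Rightarrow> 'a set" where
  "Fix T = {x \<in> M. \<forall>g\<in>T. \<phi> g x = x}"

lemma Fix_closed_convex:
  assumes "T \<subseteq> V"
  shows "closedin mtopology (Fix T) \<and> gconvex (Fix T)"
proof
  show "closedin mtopology (Fix T)"
    unfolding closedin_metric
  proof (intro conjI allI impI)
    show "Fix T \<subseteq> M" by (auto simp: Fix_def)
    fix x assume "x \<in> M - Fix T"
    then obtain g where x: "x \<in> M" and g: "g \<in> V" "g \<in> T" "\<phi> g x \<noteq> x" using assms by (auto simp: Fix_def)
    \<comment> \<open>An isometry moves \<open>x\<close> by at most twice the distance from
      \<open>x\<close> to any of its fixed points.\<close>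
    have "\<not> d x y < d x (\<phi> g x) / 2" if "y \<in> Fix T" for y
    proof
      assume "d x y < d x (\<phi> g x) / 2"
      moreover have y: "y \<in> M" "\<phi> g y = y" using that g by (auto simp: Fix_def)
      then have "d y (\<phi> g x) = d x y" using \<phi>_isometry[OF g(1) y(1) x] commute by simp
      then have "d x (\<phi> g x) \<le> 2 * d x y" using triangle[OF x y(1) \<phi>_in[OF g(1) x]] by simp
      ultimately show False by simp
    qed
    moreover have "0 < d x (\<phi> g x)" using x g \<phi>_in by simp
    ultimately show "\<exists>r>0. disjnt (Fix T) (mball x r)"
      by (intro exI[of _ "d x (\<phi> g x) / 2"]) (auto simp: disjnt_iff)
  qed
  show "gconvex (Fix T)"
    unfolding gconvex_def
  proof (intro conjI ballI allI impI)
    fix x y t assume *: "x \<in> Fix T" "y \<in> Fix T" "0 \<le> t \<and> t \<le> (1::real)"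
    have "\<phi> g (\<gamma> x y t) = \<gamma> x y t" if "g \<in> T" for g
      by (rule fixed_point_\<gamma>) (use * that assms \<phi>_in \<phi>_isometry in \<open>auto simp: Fix_def\<close>)
    then show "\<gamma> x y t \<in> Fix T" using * \<gamma>_in by (auto simp: Fix_def)
  qed (auto simp: Fix_def)
qed

lemma bounded_invariant_set:
  assumes "Y \<subseteq> M" "Y \<noteq> {}" "z \<in> M" "\<And>y. y \<in> Y \<Longrightarrow> d z y \<le> B"
  obtains c where "c \<in> M" "\<And>g. g \<in> V \<Longrightarrow> \<phi> g ` Y = Y \<Longrightarrow> \<phi> g c = c"
proof -
  obtain c where "c \<in> M"
    "\<And>g. \<lbrakk>g \<in> M \<rightarrow> M; \<And>x y. x \<in> M \<Longrightarrow> y \<in> M \<Longrightarrow> d (g x) (g y) = d x y; g ` Y = Y\<rbrakk> \<Longrightarrow> g c = c"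
    using circumcenter[OF complete assms] by blast
  then show thesis using that \<phi>_in \<phi>_isometry by (metis (no_types, lifting) Pi_I)
qed

text \<open>In the applications \<open>B\<close> is a finite group containing \<open>g\<close>. Its
  invariance under left multiplication by \<open>g\<close> makes a finite, hence bounded, set of
  translates of a point invariant, and the circumcenter is fixed.\<close>

lemma Fix_finite_orbit:
  assumes "g \<in> V" "finite B" "B \<noteq> {}" "B \<subseteq> V" "compose C g ` B = B"
  shows "Fix {g} \<noteq> {}"
proof -
  obtain x where x: "x \<in> M" using nonempty by blast
  define Y where "Y = (\<lambda>f. \<phi> f x) ` B"
  have "Y \<subseteq> M" "Y \<noteq> {}" "finite Y" using assms x \<phi>_in by (auto simp: Y_def)
  moreover from this have "d x y \<le> Max (d x ` Y)" if "y \<in> Y" for y using that by simp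
  ultimately obtain c where c: "c \<in> M" "\<And>g. g \<in> V \<Longrightarrow> \<phi> g ` Y = Y \<Longrightarrow> \<phi> g c = c"
    using bounded_invariant_set[OF _ _ x] by metis
  have "\<phi> g ` Y = (\<lambda>f. \<phi> (compose C g f) x) ` B"
    unfolding Y_def image_image using assms x by (intro image_cong) (auto simp: \<phi>_compose)
  also have "\<dots> = (\<lambda>f. \<phi> f x) ` compose C g ` B" by (simp add: image_image)
  finally have "\<phi> g ` Y = Y" using assms by (simp add: Y_def)
  then show ?thesis using c assms(1) by (auto simp: Fix_def)
qed

text \<open>The elements of \<open>T2\<close> preserve the sphere around a fixed point of \<open>T2\<close> in the fixed point
  set of \<open>T1\<close>, and all elements of \<open>T1\<close> and \<open>T2\<close> fix its circumcenter.\<close>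

lemma Fix_commuting:
  assumes T: "T1 \<subseteq> V" "T2 \<subseteq> V" and comm: "\<And>f g. f \<in> T1 \<Longrightarrow> g \<in> T2 \<Longrightarrow> compose C f g = compose C g f"
    and ne: "Fix T1 \<noteq> {}" "Fix T2 \<noteq> {}"
  shows "Fix (T1 \<union> T2) \<noteq> {}"
proof -
  obtain x y where x: "x \<in> M" "\<And>f. f \<in> T1 \<Longrightarrow> \<phi> f x = x" and y: "y \<in> M" "\<And>g. g \<in> T2 \<Longrightarrow> \<phi> g y = y"
    using ne by (auto simp: Fix_def)
  define Y where "Y = {p \<in> M. d y p = d y x \<and> (\<forall>f\<in>T1. \<phi> f p = p)}"
  have Y: "Y \<subseteq> M" "Y \<noteq> {}" using x by (auto simp: Y_def)
  obtain c where c: "c \<in> M" "\<And>g. g \<in> V \<Longrightarrow> \<phi> g ` Y = Y \<Longrightarrow> \<phi> g c = c"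
    using bounded_invariant_set[OF Y y(1), of "d y x"] Y_def by (metis (mono_tags, lifting) mem_Collect_eq order_refl)
  have "\<phi> f ` Y = Y" if "f \<in> T1" for f using that by (force simp: Y_def image_iff)
  moreover have "\<phi> g ` Y = Y" if g: "g \<in> T2" for g
  proof -
    have gV: "g \<in> V" using g T by blast
    obtain g' where g': "g' \<in> V" "\<And>x. x \<in> M \<Longrightarrow> \<phi> g' (\<phi> g x) = x" "\<And>x. x \<in> M \<Longrightarrow> \<phi> g (\<phi> g' x) = x"
      using V_inverse[OF gV] by metis
    have swap: "\<phi> f (\<phi> g p) = \<phi> g (\<phi> f p)" if "f \<in> T1" "p \<in> M" for f p
      using comm[OF that(1) g] \<phi>_compose[of f g p] \<phi>_compose[of g f p] that gV T by auto
    have iff: "\<phi> g p \<in> Y \<longleftrightarrow> p \<in> Y" if p: "p \<in> M" for p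
    proof -
      have "\<phi> g a = \<phi> g b \<longleftrightarrow> a = b" if "a \<in> M" "b \<in> M" for a b using g'(2) that by metis
      moreover have "d y (\<phi> g p) = d y p" using \<phi>_isometry[OF gV y(1) p] y(2)[OF g] by simp
      ultimately show ?thesis using p swap \<phi>_in gV T by (auto simp: Y_def subset_iff)
    qed
    show ?thesis
    proof (intro equalityI subsetI)
      fix p assume p: "p \<in> Y"
      then have "\<phi> g' p \<in> M" "\<phi> g (\<phi> g' p) = p" using \<phi>_in g' Y by auto
      then show "p \<in> \<phi> g ` Y" using iff p by (metis imageI)
    qed (use iff Y in auto)
  qed
  ultimately have "c \<in> Fix (T1 \<union> T2)" using c T by (auto simp: Fix_def)
  then show ?thesis by blast
qed

lemma Fix_commuting_family:
  fixes T :: "nat \<Rightarrow> (nat stream \<Rightarrow> nat stream) set"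
  assumes "\<And>i. T i \<subseteq> V" "\<And>i. Fix (T i) \<noteq> {}"
    and "\<And>i j f g. \<lbrakk>i \<noteq> j; f \<in> T i; g \<in> T j\<rbrakk> \<Longrightarrow> compose C f g = compose C g f"
  shows "Fix (\<Union>i\<le>n. T i) \<noteq> {}"
proof (induction n)
  case 0
  then show ?case using assms by simp
next
  case (Suc n)
  have "Fix ((\<Union>i\<le>n. T i) \<union> T (Suc n)) \<noteq> {}"
  proof (rule Fix_commuting)
    fix f g assume "f \<in> (\<Union>i\<le>n. T i)" and g: "g \<in> T (Suc n)"
    then obtain i where "i \<le> n" "f \<in> T i" by blast
    then show "compose C f g = compose C g f" using assms(3)[of i "Suc n" f g] g by simp
  qed (use assms Suc in auto)
  then show ?case by (simp add: atMost_Suc Un_commute)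
qed

text \<open>Conjugation without an inverse: every conjugator to which it is applied is an
  involution, either a swap of incomparable words or \<open>spread\<close>.\<close>

definition conj_by :: "(nat stream \<Rightarrow> nat stream) \<Rightarrow> (nat stream \<Rightarrow> nat stream) \<Rightarrow> nat stream \<Rightarrow> nat stream" where
  "conj_by h f = compose C h (compose C f h)"

lemma conj_by_V: "h \<in> V \<Longrightarrow> f \<in> V \<Longrightarrow> conj_by h f \<in> V"
  by (simp add: conj_by_def V_compose)

lemma \<phi>_involution:
  assumes "h \<in> V" "\<And>x. x \<in> C \<Longrightarrow> h (h x) = x" "x \<in> M"
  shows "\<phi> h (\<phi> h x) = x"
proof -
  have "compose C h h = (\<lambda>x\<in>C. x)" using assms(2) by (auto simp: compose_def)
  then show ?thesis using \<phi>_compose[OF assms(1,1,3)] \<phi>_id[OF assms(3)] by simp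
qed

lemma \<phi>_conj_by: "h \<in> V \<Longrightarrow> f \<in> V \<Longrightarrow> x \<in> M \<Longrightarrow> \<phi> (conj_by h f) x = \<phi> h (\<phi> f (\<phi> h x))"
  by (simp add: conj_by_def \<phi>_compose V_compose \<phi>_in)

lemma Fix_conj_by:
  assumes "h \<in> V" "\<And>x. x \<in> C \<Longrightarrow> h (h x) = x" "T \<subseteq> V" "x \<in> M"
  shows "x \<in> Fix (conj_by h ` T) \<longleftrightarrow> \<phi> h x \<in> Fix T"
proof -
  have "\<phi> h (\<phi> f (\<phi> h x)) = x \<longleftrightarrow> \<phi> f (\<phi> h x) = \<phi> h x" if "f \<in> T" for f
    using \<phi>_involution[OF assms(1,2)] assms that \<phi>_in by (metis subsetD)
  then show ?thesis using assms \<phi>_in by (auto simp: Fix_def \<phi>_conj_by subset_iff)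
qed

section \<open>Ellipticity of the subgroup supported in I(0)\<close>

definition supported :: "nat list \<Rightarrow> (nat stream \<Rightarrow> nat stream) set" where
  "supported z = {f \<in> V. \<forall>x\<in>C. \<not> pre z x \<longrightarrow> f x = x}"

lemma supported_commute:
  assumes "f \<in> supported z" "g \<in> supported z'" "z \<parallel> z'"
  shows "compose C f g = compose C g f"
proof (rule compose_commute_disjoint_support[where P="pre z"])
  show "g x = x" if "x \<in> C" "pre z x" for x
    using that assms pre_comparable[of z x z'] by (auto simp: supported_def)
qed (use assms NR_maps_Bij in \<open>auto simp: supported_def\<close>)

lemma conj_by_swap_supported:
  assumes z: "word q z" "word q z'" "z \<parallel> z'" and f: "f \<in> supported z"
  shows "conj_by (swap q z z') f \<in> supported z'"
proof -
  have "conj_by (swap q z z') f x = x" if x: "x \<in> C" "\<not> pre z' x" for x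
  proof -
    have "f (swap q z z' x) = swap q z z' x"
      using f swap_not_pre[OF z x] swap_in[OF z(1,2) x(1)] by (simp add: supported_def)
    then show ?thesis using x swap_swap[OF z x(1)] by (simp add: conj_by_def compose_def)
  qed
  then show ?thesis using f conj_by_V swap_V[OF z] by (simp add: supported_def)
qed

text \<open>Copies of \<open>T1\<close> and \<open>T2\<close> are placed in disjoint cylinders.
  Copies in different cylinders commute, so each choice of one copy per cylinder has a common fixed
  point, and \<open>convex_pairs_meet\<close> finds a cylinder whose two copies have one in common.
  Conjugating back brings it to \<open>T1\<close> and \<open>T2\<close>, which need not
  commute.\<close>

lemma Fix_Un_supported:
  assumes T: "T1 \<subseteq> supported [0]" "T2 \<subseteq> supported [0]" and ne: "Fix T1 \<noteq> {}" "Fix T2 \<noteq> {}"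
  shows "Fix (T1 \<union> T2) \<noteq> {}"
proof -
  \<comment> \<open>The words 1...10 with at least one 1 are pairwise incomparable and incomparable
    with \<open>[0]\<close>, over any alphabet with two letters; there are enough of them for every
    \<open>k\<close>.\<close>
  define w where "w i = replicate (Suc i) (1::nat) @ [0]" for i
  define h where "h i = swap q [0] (w i)" for i
  define T where "T b = (if b then T2 else T1)" for b
  define S where "S i b = conj_by (h i) ` T b" for i b
  have z: "word q [0]" "word q (w i)" "[0] \<parallel> w i" for i using q by (auto simp: w_def)
  have w_par: "w i \<parallel> w j" if "i \<noteq> j" for i j
  proof -
    have "w i \<parallel> w j" if "i < j" for i j
    proof -
      obtain m where "j = i + Suc m" using \<open>i < j\<close> less_iff_Suc_add by auto
      then have "w j = replicate (Suc i + Suc m) 1 @ [0]" by (simp add: w_def)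
      then have "w j = replicate (Suc i) 1 @ 1 # replicate m 1 @ [0]"
        unfolding replicate_add by simp
      then show ?thesis
        unfolding w_def by (simp only: parallel_def same_prefix_prefix) simp
    qed
    then show ?thesis using that by (metis linorder_neqE_nat parallel_commute)
  qed
  have hV: "h i \<in> V" and hh: "x \<in> C \<Longrightarrow> h i (h i x) = x" for i x
    unfolding h_def using swap_V[OF z] swap_swap[OF z] by simp_all
  have T_sup: "T b \<subseteq> supported [0]" "T b \<subseteq> V" for b using T by (auto simp: T_def supported_def)
  have S_sup: "S i b \<subseteq> supported (w i)" for i b
    unfolding S_def h_def using conj_by_swap_supported[OF z] T_sup by blast
  then have S_V: "S i b \<subseteq> V" for i b by (auto simp: supported_def)
  have S_iff: "x \<in> Fix (S i b) \<longleftrightarrow> \<phi> (h i) x \<in> Fix (T b)" if "x \<in> M" for x i b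
    unfolding S_def using Fix_conj_by[OF hV hh T_sup(2) that] .
  have S_ne: "Fix (S i b) \<noteq> {}" for i b
  proof -
    obtain x where x: "x \<in> Fix (T b)" using ne by (cases b) (auto simp: T_def)
    then have xM: "x \<in> M" by (simp add: Fix_def)
    then have "\<phi> (h i) x \<in> Fix (S i b)"
      using x S_iff[OF \<phi>_in[OF hV xM]] \<phi>_involution[OF hV hh xM] by simp
    then show ?thesis by blast
  qed
  have "\<exists>i\<le>k. Fix (S i False) \<inter> Fix (S i True) \<noteq> {}"
  proof (rule convex_pairs_meet[OF dim])
    show "closedin mtopology (Fix (S i b)) \<and> gconvex (Fix (S i b))" for i b
      using S_V by (rule Fix_closed_convex)
    fix \<epsilon> :: "nat \<Rightarrow> bool"
    have "Fix (\<Union>i\<le>k. S i (\<epsilon> i)) \<noteq> {}"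
    proof (rule Fix_commuting_family)
      show "compose C f g = compose C g f" if "i \<noteq> j" "f \<in> S i (\<epsilon> i)" "g \<in> S j (\<epsilon> j)" for i j f g
        using supported_commute[OF _ _ w_par[OF that(1)]] that S_sup by blast
    qed (use S_V S_ne in auto)
    then show "\<exists>x\<in>M. \<forall>i\<le>k. x \<in> Fix (S i (\<epsilon> i))" by (fastforce simp: Fix_def)
  qed
  then obtain i x where "x \<in> Fix (S i False)" "x \<in> Fix (S i True)" by blast
  moreover from this have "x \<in> M" by (simp add: Fix_def)
  ultimately have "\<phi> (h i) x \<in> Fix (T False)" "\<phi> (h i) x \<in> Fix (T True)" using S_iff by auto
  then have "\<phi> (h i) x \<in> Fix (T1 \<union> T2)" by (auto simp: T_def Fix_def)
  then show ?thesis by blast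
qed

lemma Fix_swap:
  assumes "word q w" "word q w'" "w \<parallel> w'"
  shows "Fix {swap q w w'} \<noteq> {}"
proof (rule Fix_finite_orbit)
  let ?s = "swap q w w'" and ?B = "{(\<lambda>x\<in>C. x), swap q w w'}"
  show s: "?s \<in> V" using assms by (rule swap_V)
  have "compose C ?s ?s = (\<lambda>x\<in>C. x)" using swap_swap[OF assms] by (auto simp: compose_def)
  moreover have "compose C ?s (\<lambda>x\<in>C. x) = ?s" by (auto simp: compose_def swap_def)
  ultimately show "compose C ?s ` ?B = ?B" by auto
  show "?B \<subseteq> V" using s H.one_closed by (simp add: one_H)
qed auto

lemma Fix_rot:
  assumes w: "word q w" and \<sigma>: "\<sigma> \<in> G"
  shows "Fix {rot q w \<sigma>} \<noteq> {}"
proof (rule Fix_finite_orbit)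
  let ?B = "rot q w ` G"
  show "rot q w \<sigma> \<in> V" "?B \<subseteq> V" using rot_V[OF w] \<sigma> by auto
  show "finite ?B" "?B \<noteq> {}" using finite_G \<sigma> by auto
  obtain \<tau> where \<tau>: "\<tau> \<in> G" "\<And>u. u \<in> C \<Longrightarrow> smap \<sigma> (smap \<tau> u) = u"
    using label_inverse[OF \<sigma>] by metis
  show "compose C (rot q w \<sigma>) ` ?B = ?B"
  proof (intro equalityI subsetI)
    fix f assume "f \<in> compose C (rot q w \<sigma>) ` ?B"
    then obtain \<rho> where \<rho>: "\<rho> \<in> G" "f = compose C (rot q w \<sigma>) (rot q w \<rho>)" by blast
    obtain \<rho>' where "\<rho>' \<in> G" "compose C (rot q w \<sigma>) (rot q w \<rho>) = rot q w \<rho>'"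
      using compose_rot[OF w \<sigma> \<rho>(1)] by blast
    then show "f \<in> ?B" using \<rho>(2) by simp
  next
    fix f assume "f \<in> ?B"
    then obtain \<rho> where \<rho>: "\<rho> \<in> G" "f = rot q w \<rho>" by blast
    obtain \<rho>' where \<rho>': "\<rho>' \<in> G" "compose C (rot q w \<tau>) (rot q w \<rho>) = rot q w \<rho>'"
      using compose_rot[OF w \<tau>(1) \<rho>(1)] by blast
    have "f = compose C (rot q w \<sigma>) (rot q w \<rho>')"
    proof (rule Bij_ext)
      show "f x = compose C (rot q w \<sigma>) (rot q w \<rho>') x" if x: "x \<in> C" for x
        using rot_inverse[OF w \<tau>(2,1), of "rot q w \<rho> x"] Bij_in[OF rot_Bij[OF \<rho>(1) w] x] x
          fun_cong[OF \<rho>'(2), of x] \<rho>(2) by (simp add: compose_def)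
    qed (auto simp: \<rho> intro!: compose_Bij rot_Bij w \<sigma> \<rho>(1) \<rho>'(1))
    then show "f \<in> compose C (rot q w \<sigma>) ` ?B" using \<rho>'(1) by blast
  qed
qed

lemma Fix_finite_supported:
  assumes "finite T" "T \<subseteq> supported [0]" "\<And>f. f \<in> T \<Longrightarrow> Fix {f} \<noteq> {}"
  shows "Fix T \<noteq> {}"
  using assms
proof (induction T)
  case empty
  then show ?case using nonempty by (simp add: Fix_def)
next
  case (insert f T)
  then show ?case using Fix_Un_supported[of "{f}" T] by simp
qed

lemma local_gens_supported:
  assumes "word q z" "f \<in> local_gens z"
  shows "f \<in> supported z"
proof -
  have nz: "\<not> pre (z @ a) x" if "\<not> pre z x" for a x using that pre_prefix[of "z @ a" x z] by auto
  consider a b where "f = swap q (z @ a) (z @ b)" "word q a" "word q b" "a \<parallel> b"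
    | a \<sigma> where "f = rot q (z @ a) \<sigma>" "word q a" "\<sigma> \<in> G"
    using assms(2) unfolding local_gens_def by blast
  then show ?thesis
  proof cases
    case 1
    moreover from this have "z @ a \<parallel> z @ b" by (auto simp: parallel_def)
    ultimately show ?thesis
      using nz assms(1) by (simp add: supported_def swap_V swap_other)
  next
    case 2
    then show ?thesis using nz assms(1) by (simp add: supported_def rot_V rot_other)
  qed
qed

lemma local_gens_elliptic:
  assumes "word q z" "f \<in> local_gens z"
  shows "Fix {f} \<noteq> {}"
proof -
  consider a b where "f = swap q (z @ a) (z @ b)" "word q a" "word q b" "a \<parallel> b"
    | a \<sigma> where "f = rot q (z @ a) \<sigma>" "word q a" "\<sigma> \<in> G"
    using assms(2) unfolding local_gens_def by blast
  then show ?thesis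
  proof cases
    case 1
    moreover from this have "z @ a \<parallel> z @ b" by (auto simp: parallel_def)
    ultimately show ?thesis using Fix_swap[of "z @ a" "z @ b"] assms(1) by simp
  next
    case 2
    then show ?thesis using Fix_rot[of "z @ a" \<sigma>] assms(1) by simp
  qed
qed

text \<open>The generators are elliptic one by one, so finitely many of them have a common fixed
  point. The elements fixing that point are closed under composition, which is all that
  \<open>supported_below_generated\<close> asks for.\<close>

theorem Fix_supported: "Fix (supported [0]) \<noteq> {}"
proof -
  have z: "word q [0]" using q by simp
  have "Fix (local_gens [0]) \<noteq> {}"
    by (rule Fix_finite_supported[OF finite_local_gens])
      (use local_gens_supported[OF z] local_gens_elliptic[OF z] in blast)+
  then obtain x where x: "x \<in> M" "\<And>g. g \<in> local_gens [0] \<Longrightarrow> \<phi> g x = x" by (auto simp: Fix_def)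
  have "f \<in> {g \<in> V. \<phi> g x = x}" if "f \<in> supported [0]" for f
  proof (rule supported_below_generated[of _ "[0]"])
    show "local_gens [0] \<subseteq> {g \<in> V. \<phi> g x = x}"
      using x local_gens_supported[OF z] by (auto simp: supported_def)
  qed (use that z x V_compose \<phi>_compose in \<open>auto simp: supported_def\<close>)
  then show ?thesis using x by (auto simp: Fix_def)
qed

definition fixing :: "nat list \<Rightarrow> (nat stream \<Rightarrow> nat stream) set" where
  "fixing z = {f \<in> V. \<forall>x\<in>C. pre z x \<longrightarrow> f x = x}"

text \<open>\<open>spread\<close> carries points outside I(0) into I(0), where elements of
  \<open>fixing [0]\<close> do nothing. Their conjugates are therefore supported in I(0).\<close>

lemma Fix_fixing: "Fix (fixing [0]) \<noteq> {}"
proof -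
  have "conj_by spread f \<in> supported [0]" if f: "f \<in> fixing [0]" for f
  proof -
    have "conj_by spread f x = x" if x: "x \<in> C" "\<not> pre [0] x" for x
      using f spread_involution[OF x(1)] spread_pre[OF x] x
      by (simp add: conj_by_def compose_def fixing_def)
    then show ?thesis using f conj_by_V spread_V by (simp add: supported_def fixing_def)
  qed
  moreover obtain x where x: "x \<in> Fix (supported [0])" using Fix_supported by blast
  ultimately have "x \<in> Fix (conj_by spread ` fixing [0])" by (auto simp: Fix_def)
  moreover have "x \<in> M" using x by (simp add: Fix_def)
  ultimately have "\<phi> spread x \<in> Fix (fixing [0])"
    using Fix_conj_by[of spread "fixing [0]" x] spread_V spread_involution by (auto simp: fixing_def)
  then show ?thesis by blast
qed

section \<open>Bounded displacement and the global fixed point\<close>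

definition disp :: "'a \<Rightarrow> (nat stream \<Rightarrow> nat stream) \<Rightarrow> real" where
  "disp x g = d x (\<phi> g x)"

lemma disp_compose:
  assumes "x \<in> M" "f \<in> V" "g \<in> V"
  shows "disp x (compose C f g) \<le> disp x f + disp x g"
  using triangle[of x "\<phi> f x" "\<phi> f (\<phi> g x)"] \<phi>_isometry[of f x "\<phi> g x"] assms \<phi>_in
  by (simp add: disp_def \<phi>_compose)

lemma disp_fixed:
  assumes "x \<in> M" "y \<in> M" "g \<in> V" "\<phi> g y = y"
  shows "disp x g \<le> 2 * d x y"
  using triangle[of x y "\<phi> g x"] \<phi>_isometry[of g y x] assms \<phi>_in commute[of y x]
  by (simp add: disp_def)

lemma disp_conj_by:
  assumes "x \<in> M" "h \<in> V" "f \<in> V"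
  shows "disp x (conj_by h f) \<le> 2 * disp x h + disp x f"
  using disp_compose[of x h "compose C f h"] disp_compose[of x f h] assms V_compose
  by (simp add: conj_by_def)

text \<open>The bound does not depend on the word: conjugation by the exchange of \<open>[0]\<close>
  with a 2-letter word incomparable with \<open>b # c # w\<close> turns the swap into an element
  fixing I(0) pointwise. Such elements share a fixed point, and only finitely many conjugators
  occur.\<close>

lemma disp_swap_bounded:
  assumes x: "x \<in> M"
  shows "\<exists>B. \<forall>b c w. word q (b # c # w) \<longrightarrow> b \<noteq> 0 \<longrightarrow> disp x (swap q [0] (b # c # w)) \<le> B"
proof -
  obtain y where y: "y \<in> M" "\<And>g. g \<in> fixing [0] \<Longrightarrow> \<phi> g y = y" using Fix_fixing by (auto simp: Fix_def)
  define Q where "Q = {p. word q p \<and> length p = 2}"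
  have Q: "finite Q" unfolding Q_def by (rule finite_lists_length_eq) simp
  define B where "B = Max ((\<lambda>p. 2 * disp x (swap q [0] p) + 2 * d x y) ` Q)"
  show ?thesis
  proof (intro exI allI impI)
    fix b c w assume w: "word q (b # c # w)" "b \<noteq> 0"
    \<comment> \<open>\<open>e\<close> differs from the second letter \<open>c\<close> and
      \<open>b\<close> differs from 0, so \<open>[b, e]\<close> is incomparable with the word and
      with \<open>[0]\<close>.\<close>
    define e where "e = (if c = 0 then 1 else 0::nat)"
    have e: "e < q" "e \<noteq> c" using q by (auto simp: e_def)
    let ?p = "[b, e]" and ?w = "b # c # w"
    have z: "word q [0]" "word q ?p" "[0] \<parallel> ?p" "word q ?w" "[0] \<parallel> ?w" "?p \<parallel> ?w"
      using w e q by (auto simp: parallel_def)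
    let ?h = "swap q [0] ?p" and ?f = "swap q [0] ?w"
    have hV: "?h \<in> V" and fV: "?f \<in> V" using z swap_V by blast+
    have hh: "?h (?h u) = u" if "u \<in> C" for u using swap_swap[OF z(1-3) that] .
    define g where "g = conj_by ?h ?f"
    have gV: "g \<in> V" unfolding g_def using conj_by_V hV fV .
    have "g u = u" if u: "u \<in> C" "pre [0] u" for u
    proof -
      obtain v where v: "u = [0] @- v" using u(2) unfolding pre_altdef by blast
      then have vC: "v \<in> C" using u by simp
      have "?h u = ?p @- v" using swap_left[OF z(1), of ?p] v vC by (simp only: moves_def)
      moreover have "\<not> pre [0] (?p @- v)" "\<not> pre ?w (?p @- v)"
        using parallel_not_pre[OF z(3)] parallel_not_pre[of ?w ?p] z(6) parallel_commute by blast+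
      ultimately have "?f (?h u) = ?h u" using swap_other[of "?p @- v" q "[0]" ?w] z(2) vC by simp
      then show ?thesis using hh[OF u(1)] u(1) by (simp add: g_def conj_by_def compose_def)
    qed
    then have "g \<in> fixing [0]" using gV by (simp add: fixing_def)
    then have "disp x g \<le> 2 * d x y" using disp_fixed[OF x y(1) gV] y(2) by simp
    moreover have "?f = conj_by ?h g"
    proof (rule Bij_ext)
      show "?f u = conj_by ?h g u" if u: "u \<in> C" for u
        using hh[OF u] hh[of "?f u"] swap_in[OF z(1,4) u] swap_in[OF z(1,2) u] u
        by (simp add: g_def conj_by_def compose_def)
    qed (use fV hV gV conj_by_V NR_maps_Bij in blast)+
    ultimately have "disp x ?f \<le> 2 * disp x ?h + 2 * d x y"
      using disp_conj_by[OF x hV gV] by simp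
    also have "\<dots> \<le> B" unfolding B_def using Q z(2) by (intro Max_ge) (auto simp: Q_def)
    finally show "disp x ?f \<le> B" .
  qed
qed

text \<open>A word beginning with 0 is comparable with \<open>[0]\<close>, so
  \<open>disp_swap_bounded\<close> does not reach it directly. The detour replaces its first letter
  by 1 and then exchanges I(0) and I(1).\<close>

lemma cone_transport_bounded:
  assumes x: "x \<in> M"
  shows "\<exists>B. \<forall>w. word q w \<longrightarrow> 2 \<le> length w \<longrightarrow> (\<exists>h\<in>V. moves q h [0] w \<and> disp x h \<le> B)"
proof -
  obtain B where B: "\<And>b c w. \<lbrakk>word q (b # c # w); b \<noteq> 0\<rbrakk> \<Longrightarrow> disp x (swap q [0] (b # c # w)) \<le> B"
    using disp_swap_bounded[OF x] by blast
  let ?c = "swap q [0] [1]"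
  have z: "word q [0]" "word q [1]" "[0] \<parallel> [1::nat]" using q by auto
  have cV: "?c \<in> V" using z by (rule swap_V)
  show ?thesis
  proof (intro exI allI impI)
    fix w assume w: "word q w" "2 \<le> length w"
    obtain b c v where v: "w = b # c # v" using w(2) by (cases w; cases "tl w") auto
    show "\<exists>h\<in>V. moves q h [0] w \<and> disp x h \<le> disp x ?c + B"
    proof (cases "b = 0")
      case False
      then have "swap q [0] w \<in> V" using w z(1) v by (intro swap_V) auto
      moreover have "disp x (swap q [0] w) \<le> disp x ?c + B"
        using B[of b c v] w v False x cV \<phi>_in by (simp add: disp_def add_increasing)
      ultimately show ?thesis using swap_left[OF z(1)] by blast
    next
      case True
      let ?s = "swap q [0] (1 # c # v)"
      have cv: "word q (1 # c # v)" using w v q by simp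
      have sV: "?s \<in> V" using z(1) cv by (intro swap_V) auto
      have "moves q (compose C ?c ?s) [0] w"
        unfolding moves_def
      proof
        fix u assume u: "u \<in> C"
        have "?s ([0] @- u) = (1 # c # v) @- u" using swap_left[OF z(1)] u by (simp only: moves_def)
        also have "\<dots> = [1] @- ((c # v) @- u)" by simp
        finally have "?s ([0] @- u) = [1] @- ((c # v) @- u)" .
        moreover have "?c ([1] @- ((c # v) @- u)) = [0] @- ((c # v) @- u)"
          using swap_right[OF z(2,3)] cv u unfolding moves_def by simp
        moreover have "[0] @- u \<in> C" using z(1) u by simp
        ultimately show "compose C ?c ?s ([0] @- u) = w @- u"
          using True v by (simp add: compose_def)
      qed
      moreover have "disp x (compose C ?c ?s) \<le> disp x ?c + B"
        using disp_compose[OF x cV sV] B[OF cv] by simp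
      ultimately show ?thesis using V_compose[OF cV sV] by blast
    qed
  qed
qed

text \<open>\<open>v\<close> carries some cone to a cone with a label. Elements \<open>h\<close> and
  \<open>h'\<close> of bounded displacement transport I(0) to these cones, and one of finitely many
  rotations absorbs the label. What remains fixes I(0) pointwise, so the common fixed point
  \<open>y\<close> bounds its displacement.\<close>

lemma disp_bounded:
  assumes x: "x \<in> M"
  shows "\<exists>B. \<forall>v\<in>V. disp x v \<le> B"
proof -
  obtain y where y: "y \<in> M" "\<And>g. g \<in> fixing [0] \<Longrightarrow> \<phi> g y = y" using Fix_fixing by (auto simp: Fix_def)
  obtain B where B: "\<And>w. word q w \<Longrightarrow> 2 \<le> length w \<Longrightarrow> \<exists>h\<in>V. moves q h [0] w \<and> disp x h \<le> B"
    using cone_transport_bounded[OF x] by blast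
  define R where "R = Max ((\<lambda>\<sigma>. disp x (rot q [0] \<sigma>)) ` G)"
  have z: "word q [0]" using q by simp
  show ?thesis
  proof (intro exI ballI)
    fix v assume v: "v \<in> V"
    have "sconst 0 \<in> C" using q by simp
    then obtain w0 w0' \<sigma> where w0: "word q w0" "word q w0'" "\<sigma> \<in> G" "acts q v w0 w0' \<sigma>"
      using NR_maps_local[OF v] by metis
    \<comment> \<open>Two further letters guarantee, on both sides, the length required by
      \<open>cone_transport_bounded\<close>.\<close>
    define w w' where "w = w0 @ [0, 0]" and "w' = w0' @ map \<sigma> [0, 0]"
    have w: "word q w" "word q w'" "2 \<le> length w" "2 \<le> length w'"
      using w0 q label_less[OF w0(3)] by (simp_all add: w_def w'_def)
    have acts: "acts q v w w' \<sigma>" unfolding w_def w'_def using w0(4) q by (intro acts_append) auto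
    obtain h where h: "h \<in> V" "moves q h [0] w" "disp x h \<le> B" using B w by blast
    obtain h' where h': "h' \<in> V" "moves q h' [0] w'" "disp x h' \<le> B" using B w by blast
    obtain i where i: "i \<in> V" "\<And>x. x \<in> C \<Longrightarrow> i (h x) = x" "\<And>x. x \<in> C \<Longrightarrow> h (i x) = x"
      "\<And>x. x \<in> M \<Longrightarrow> \<phi> i (\<phi> h x) = x" "\<And>x. x \<in> M \<Longrightarrow> \<phi> h (\<phi> i x) = x"
      using V_inverse[OF h(1)] by metis
    obtain i' where i': "i' \<in> V" "\<And>x. x \<in> C \<Longrightarrow> i' (h' x) = x" "\<And>x. x \<in> C \<Longrightarrow> h' (i' x) = x"
      using V_inverse[OF h'(1)] by metis
    obtain \<tau> where \<tau>: "\<tau> \<in> G" "\<And>u. u \<in> C \<Longrightarrow> smap \<tau> (smap \<sigma> u) = u"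
      "\<And>u. u \<in> C \<Longrightarrow> smap \<sigma> (smap \<tau> u) = u"
      using label_inverse[OF w0(3)] by metis
    let ?a = "rot q [0] \<sigma>" and ?b = "rot q [0] \<tau>"
    have aV: "?a \<in> V" and bV: "?b \<in> V" using rot_V[OF z] w0(3) \<tau>(1) by blast+
    \<comment> \<open>On I(0), undoing the target transport and then the label cancels what
      \<open>v\<close> does after the source transport.\<close>
    define r where "r = compose C ?b (compose C i' (compose C v h))"
    have rV: "r \<in> V" unfolding r_def by (intro V_compose bV i'(1) v h(1))
    have inC: "f u \<in> C" if "f \<in> V" "u \<in> C" for f u using Bij_in[OF NR_maps_Bij[OF that(1)] that(2)] .
    have r_eq: "r u = ?b (i' (v (h u)))" if "u \<in> C" for u using that by (simp add: r_def compose_def)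
    have "r u = u" if u: "u \<in> C" "pre [0] u" for u
    proof -
      obtain s where s: "u = [0] @- s" using u(2) unfolding pre_altdef by blast
      then have sC: "s \<in> C" using u by simp
      have "h u = w @- s" using h(2) s sC by (simp only: moves_def)
      then have "v (h u) = w' @- smap \<sigma> s" using acts sC by (simp only: acts_def)
      also have "\<dots> = h' ([0] @- smap \<sigma> s)"
        using h'(2) label_in[OF w0(3) sC] unfolding moves_def by metis
      finally have "i' (v (h u)) = [0] @- smap \<sigma> s"
        using i'(2)[of "[0] @- smap \<sigma> s"] z label_in[OF w0(3) sC] by simp
      then have "r u = [0] @- smap \<tau> (smap \<sigma> s)"
        using r_eq[OF u(1)] rot_shift[OF label_in[OF w0(3) sC] z] by metis
      then show ?thesis using \<tau>(2)[OF sC] s by metis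
    qed
    then have "r \<in> fixing [0]" using rV by (simp add: fixing_def)
    then have dr: "disp x r \<le> 2 * d x y" using disp_fixed[OF x y(1) rV] y(2) by simp
    have "v = compose C h' (compose C ?a (compose C r i))"
    proof (rule Bij_ext)
      show "v u = compose C h' (compose C ?a (compose C r i)) u" if u: "u \<in> C" for u
      proof -
        have "r (i u) = ?b (i' (v u))" using r_eq[OF inC[OF i(1) u]] i(3)[OF u] by simp
        then have "?a (r (i u)) = i' (v u)"
          using rot_inverse[OF z \<tau>(3,1), of "i' (v u)"] inC i'(1) v u by simp
        then show ?thesis using i'(3)[OF inC[OF v u]] u inC[OF i(1) u] by (simp add: compose_def)
      qed
    qed (intro NR_maps_Bij v V_compose h'(1) aV rV i(1))+
    then have "disp x v \<le> disp x h' + (disp x ?a + (disp x r + disp x i))"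
      using disp_compose[OF x h'(1), of "compose C ?a (compose C r i)"]
        disp_compose[OF x aV, of "compose C r i"] disp_compose[OF x rV i(1)]
        V_compose aV rV i(1) by (smt (verit, best))
    moreover have "disp x i = disp x h"
      using \<phi>_isometry[OF h(1) x \<phi>_in[OF i(1) x]] i(5)[OF x] commute by (simp add: disp_def)
    moreover have "disp x ?a \<le> R" unfolding R_def using finite_G w0(3) by (intro Max_ge) auto
    ultimately show "disp x v \<le> 2 * B + R + 2 * d x y" using dr h(3) h'(3) by simp
  qed
qed

theorem global_fixed_point: "has_global_fixed_point H M \<phi>"
proof -
  obtain x where x: "x \<in> M" using nonempty by blast
  obtain B where B: "\<And>v. v \<in> V \<Longrightarrow> disp x v \<le> B" using disp_bounded[OF x] by blast
  define Y where "Y = (\<lambda>g. \<phi> g x) ` V"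
  have Y: "Y \<subseteq> M" "Y \<noteq> {}" using x \<phi>_in H.one_closed by (auto simp: Y_def)
  have "d x y \<le> B" if "y \<in> Y" for y using that B by (auto simp: Y_def disp_def)
  then obtain c where c: "c \<in> M" "\<And>g. g \<in> V \<Longrightarrow> \<phi> g ` Y = Y \<Longrightarrow> \<phi> g c = c"
    using bounded_invariant_set[OF Y x] by metis
  have sub: "\<phi> g ` Y \<subseteq> Y" if "g \<in> V" for g
    using that x V_compose \<phi>_compose unfolding Y_def by (force simp: image_iff)
  have "\<phi> g ` Y = Y" if g: "g \<in> V" for g
  proof
    obtain g' where g': "g' \<in> V" "\<And>x. x \<in> M \<Longrightarrow> \<phi> g (\<phi> g' x) = x" using V_inverse[OF g] by metis
    show "Y \<subseteq> \<phi> g ` Y"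
    proof
      fix y assume y: "y \<in> Y"
      then have "\<phi> g' y \<in> Y" "\<phi> g (\<phi> g' y) = y" using sub[OF g'(1)] g'(2) Y by auto
      then show "y \<in> \<phi> g ` Y" by (metis imageI)
    qed
  qed (rule sub[OF g])
  then show ?thesis unfolding has_global_fixed_point_def using c by (intro bexI[of _ c]) simp_all
qed

end

theorem corollary3p4:
  fixes q k :: nat
    and G :: "(nat \<Rightarrow> nat) set"
    and M :: "'a set"
    and d :: "'a \<Rightarrow> 'a \<Rightarrow> real"
    and \<phi> :: "(nat stream \<Rightarrow> nat stream) \<Rightarrow> 'a \<Rightarrow> 'a"
  assumes "q \<ge> 2"
    and "subgroup G (BijGroup {..<q})"
    and "CAT0_space M d"
    and "Metric_space.mcomplete M d"
    and "covering_dim_eq (Metric_space.mtopology M d) k"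
    and "semisimple_action (NR_group q G) M d \<phi>"
  shows "has_global_fixed_point (NR_group q G) M \<phi>"
proof -
  obtain \<gamma> where "CN_space M d \<gamma>" using CAT0_imp_CN_space[OF assms(3)] by blast
  then interpret CN_space M d \<gamma> .
  interpret NR_action q G M d \<gamma> \<phi> k
    by (intro NR_action.intro label_group.intro NR_action_axioms.intro CN_space_axioms)
      (use assms in \<open>simp_all add: covering_dim_eq_def semisimple_action_def CAT0_space_def\<close>)
  show ?thesis by (rule global_fixed_point)
qed

end
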